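(* Let $n$ be a large integer and let $d,k,r$ be such that $\omega(\log^2 n)\leq d\leq n^{0.01}$ and $r\leq \frac{d}{1201k^2}$. Any depth four $\Sigma\wedge\Sigma\Pi$ circuit of bounded individual degree $r$ computing a function equivalent to $\mathsf{IMM}_{n,d}$ on $\{0,1\}^{n^2d}$ must have size at least $n^{\Omega(k)}$.
   Context: $\mathsf{IMM}_{n,d}$: let $X^{(1)},\dots,X^{(d)}$ be $n\times n$ matrices of distinct variables (disjoint across matrices), $x^{(k)}_{i,j}$ the $(i,j)$ entry of $X^{(k)}$; $\mathsf{IMM}_{n,d}(X)=\sum_{i_1,\dots,i_{d-1}\in[n]} x^{(1)}_{1,i_1}x^{(2)}_{i_1,i_2}\cdots x^{(d-1)}_{i_{d-2},i_{d-1}}x^{(d)}_{i_{d-1},1}$, the $(1,1)$ entry of $X^{(1)}\cdots X^{(d)}$, a polynomial in $N=n^2d$ variables. A depth four $\Sigma\wedge\Sigma\Pi$ circuit is an arithmetic circuit computing a polynomial of the form $\sum_{i=1}^{s'} Q_i^{e_i}$ (a sum of powers of polynomials $Q_i$, each $Q_i$ a sum of monomials); its size is its number of nodes. The circuit has bounded individual degree $r$ if the polynomial it outputs has degree at most $r$ in each variable. A circuit computes a function equivalent to a polynomial $P$ on $\{0,1\}^N$ if its output polynomial $f$ satisfies $f(\mathbf a)=P(\mathbf a)$ for all $\mathbf a\in\{0,1\}^N$. *)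

theory Defs
  imports
    Complex_Main
    "HOL-Library.FuncSet"
    "HOL-Library.Landau_Symbols"
    "HOL-Library.Poly_Mapping"
begin

text \<open>
  Multivariate polynomials over \<open>'a\<close> in variables \<open>'v\<close>: finitely supported maps from monomials
  (finitely supported exponent vectors) to coefficients. The ring operations are those of
  \<^theory>\<open>HOL-Library.Poly_Mapping\<close>, where multiplication is convolution.
\<close>

type_synonym ('v, 'a) mpoly = "('v \<Rightarrow>\<^sub>0 nat) \<Rightarrow>\<^sub>0 'a"

definition mp_const :: "'a::comm_semiring_1 \<Rightarrow> ('v, 'a) mpoly"
  where "mp_const c = Poly_Mapping.single 0 c"

definition mp_var :: "'v \<Rightarrow> ('v, 'a::comm_semiring_1) mpoly"
  where "mp_var v = Poly_Mapping.single (Poly_Mapping.single v 1) 1"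

definition mp_eval :: "('v \<Rightarrow> 'a::comm_semiring_1) \<Rightarrow> ('v, 'a) mpoly \<Rightarrow> 'a"
  where "mp_eval a p =
    (\<Sum>m\<in>Poly_Mapping.keys p. Poly_Mapping.lookup p m *
       (\<Prod>v\<in>Poly_Mapping.keys m. a v ^ Poly_Mapping.lookup m v))"

definition individual_degree_le :: "nat \<Rightarrow> ('v, 'a::zero) mpoly \<Rightarrow> bool"
  where "individual_degree_le r p \<longleftrightarrow>
    (\<forall>m\<in>Poly_Mapping.keys p. \<forall>v. Poly_Mapping.lookup m v \<le> r)"


text \<open>The variable \<open>(t, i, j)\<close> is the \<open>(i, j)\<close> entry of the \<open>t\<close>-th matrix; indices start at 1.\<close>

type_synonym imm_var = "nat \<times> nat \<times> nat"

definition imm_vars :: "nat \<Rightarrow> nat \<Rightarrow> imm_var set"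
  where "imm_vars n d = {1..d} \<times> {1..n} \<times> {1..n}"

text \<open>
  The list \<open>is\<close> is \<open>i\<^sub>1, \<dots>, i\<^bsub>d-1\<^esub>\<close>. Padding it to \<open>1, i\<^sub>1, \<dots>, i\<^bsub>d-1\<^esub>, 1\<close> makes the
  \<open>t\<close>-th factor, for \<open>t = 1, \<dots>, d\<close>, the variable at positions \<open>t - 1\<close> and \<open>t\<close> of the padded list.
\<close>

definition IMM :: "nat \<Rightarrow> nat \<Rightarrow> (imm_var, 'a::comm_semiring_1) mpoly"
  where "IMM n d =
    (\<Sum>is\<in>{is. length is = d - 1 \<and> set is \<subseteq> {1..n}}.
       \<Prod>t = 1..d. mp_var (t, ([1] @ is @ [1]) ! (t - 1), ([1] @ is @ [1]) ! t))"


text \<open>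
  A circuit is a directed acyclic graph, given as the list of its nodes in topological order: a
  gate refers to its children by their positions in the list, and the last node is the output.
  A node may be used by several gates, and a child may occur repeatedly in a gate (parallel wires).
  Wires carry no labels: coefficients enter through constant leaves.
\<close>

datatype ('v, 'a) gate =
    Var 'v
  | Const 'a
  | Sum "nat list"
  | Prod "nat list"
  | Pow nat nat  \<comment> \<open>child and exponent\<close>

type_synonym ('v, 'a) circuit = "('v, 'a) gate list"

fun children :: "('v, 'a) gate \<Rightarrow> nat set" where
  "children (Var v) = {}"
| "children (Const c) = {}"
| "children (Sum js) = set js"
| "children (Prod js) = set js"
| "children (Pow j e) = {j}"

fun gate_vars :: "('v, 'a) gate \<Rightarrow> 'v set" where
  "gate_vars (Var v) = {v}"
| "gate_vars _ = {}"

definition circuit_over :: "'v set \<Rightarrow> ('v, 'a) circuit \<Rightarrow> bool"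
  where "circuit_over V C \<longleftrightarrow>
    C \<noteq> [] \<and> (\<forall>i<length C. children (C ! i) \<subseteq> {..<i} \<and> gate_vars (C ! i) \<subseteq> V)"

fun gate_poly :: "(nat \<Rightarrow> ('v, 'a) mpoly) \<Rightarrow> ('v, 'a::comm_semiring_1) gate \<Rightarrow> ('v, 'a) mpoly" where
  "gate_poly h (Var v) = mp_var v"
| "gate_poly h (Const c) = mp_const c"
| "gate_poly h (Sum js) = (\<Sum>j\<leftarrow>js. h j)"
| "gate_poly h (Prod js) = (\<Prod>j\<leftarrow>js. h j)"
| "gate_poly h (Pow j e) = h j ^ e"

definition node_polys :: "('v, 'a::comm_semiring_1) circuit \<Rightarrow> ('v, 'a) mpoly list"
  where "node_polys C = foldl (\<lambda>ps g. ps @ [gate_poly (\<lambda>j. ps ! j) g]) [] C"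

definition output_poly :: "('v, 'a::comm_semiring_1) circuit \<Rightarrow> ('v, 'a) mpoly"
  where "output_poly C = last (node_polys C)"

definition circuit_size :: "('v, 'a) circuit \<Rightarrow> nat"
  where "circuit_size C = length C"

definition leaf_node :: "('v, 'a) circuit \<Rightarrow> nat \<Rightarrow> bool"
  where "leaf_node C i \<longleftrightarrow> (\<exists>v. C ! i = Var v) \<or> (\<exists>c. C ! i = Const c)"

definition monomial_node :: "('v, 'a) circuit \<Rightarrow> nat \<Rightarrow> bool"
  where "monomial_node C i \<longleftrightarrow> (\<exists>js. C ! i = Prod js \<and> (\<forall>j\<in>set js. leaf_node C j))"

definition sum_of_monomials_node :: "('v, 'a) circuit \<Rightarrow> nat \<Rightarrow> bool"
  where "sum_of_monomials_node C i \<longleftrightarrow> (\<exists>js. C ! i = Sum js \<and> (\<forall>j\<in>set js. monomial_node C j))"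

definition power_node :: "('v, 'a) circuit \<Rightarrow> nat \<Rightarrow> bool"
  where "power_node C i \<longleftrightarrow> (\<exists>j e. C ! i = Pow j e \<and> sum_of_monomials_node C j)"

definition sum_pow_sum_prod :: "('v, 'a) circuit \<Rightarrow> bool"
  where "sum_pow_sum_prod C \<longleftrightarrow>
    (\<exists>js. C ! (length C - 1) = Sum js \<and> (\<forall>j\<in>set js. power_node C j))"

definition equivalent_on_cube ::
    "'v set \<Rightarrow> ('v, 'a::comm_semiring_1) mpoly \<Rightarrow> ('v, 'a) mpoly \<Rightarrow> bool"
  where "equivalent_on_cube V f p \<longleftrightarrow> (\<forall>a\<in>V \<rightarrow> {0, 1}. mp_eval a f = mp_eval a p)"

end

theory Submission
  imports
    Defs
    "HOL-Computational_Algebra.Computational_Algebra"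
    "HOL-Library.Function_Algebras"
    "HOL-Real_Asymp.Real_Asymp"
begin

text \<open>
  Restrict \<open>IMM\<close> to \<open>k\<close> consecutive blocks of \<open>c + 2\<close> layers, where \<open>c\<close> is of order \<open>d/k\<close>. Block \<open>b\<close> starts
  with an edge that selects a row \<open>\<beta>(b)\<close>, and then computes the elementary symmetric polynomial of
  degree \<open>c\<close> in those of \<open>2h\<close> new Boolean variables of the block that lie in a set \<open>W\<^sub>i\<close>, \<open>i = \<beta>(b)\<close>.
  Several edges may read the same new variable, because the individual degree only matters for the
  selecting edges. Every vertex comes in \<open>q\<close> copies of which one is kept; since the circuit has fewer
  than \<open>q\<close> to the power \<open>T + 1\<close> monomials, some choice of copies kills all monomials reading more than
  \<open>T\<close> new variables.

  Scale the \<open>k\<close> selecting edges of \<open>\<beta>\<close> by a variable \<open>\<tau>\<close>. The output has degree at most \<open>kr\<close> in \<open>\<tau>\<close>, so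
  expanding the powers of the \<open>Q\<^sub>i\<close> around \<open>\<tau> = 0\<close> shows that for all \<open>\<beta>\<close> at once the restricted function
  is a combination of at most \<open>s(kr + 1)\<close> fixed functions with coefficients of degree at most \<open>Tkr\<close>,
  which is at most \<open>kc/2\<close>. Multiply by all monomials with \<open>h - c\<close> variables in each block and project to the
  monomials with \<open>h\<close> variables in each block. The left-hand sides then span almost the whole space of
  these monomials, while the right-hand sides lie in the projection of a space of dimension
  \<open>s(kr + 1)\<close> times the number of monomials of degree at most \<open>kh - kc/2\<close>. This number is
  smaller than the former dimension by a factor exponential in \<open>k c\<^sup>2 / h\<close>, and \<open>h\<close> is chosen so that
  \<open>c\<^sup>2 / h\<close> is of order \<open>ln n\<close>.

  The spanning claim must hold in every characteristic. A monomial \<open>S\<close> with a bias of at least \<open>c\<close> towards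
  some \<open>W\<^sub>i\<close> in every block is, by inclusion-exclusion, a combination of products of a monomial and an
  elementary symmetric polynomial of degree \<open>i \<ge> c\<close> in each block. If \<open>i < 2c\<close>, that polynomial is a
  multiple of the one of degree \<open>c\<close> up to the factor \<open>i choose c\<close>, which is nonzero when \<open>c\<close> is a power of
  the characteristic. The terms with some \<open>i \<ge> 2c\<close> span a space that is small, again by Chernoff.
\<close>

section \<open>Binomial coefficients in a field\<close>

text \<open>With \<open>i = c + r\<close> and \<open>r < c\<close>, Frobenius gives (1 + x)^i = (1 +
  x)^r (1 + x^c). The factor (1 + x)^r has constant coefficient 1 and degree below \<open>c\<close>,
  so the coefficient at \<open>c\<close> is 1.\<close>

lemma of_nat_choose_power_CHAR:
  fixes c i n :: nat
  assumes "CHAR('a::field) > 0" "c = CHAR('a) ^ n" "c \<le> i" "i < 2 * c"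
  shows "of_nat (i choose c) = (1 :: 'a)"
proof -
  have "prime CHAR('a)"
    using assms(1) by (rule prime_CHAR_semidom)
  then have pr: "prime CHAR('a poly)"
    by simp
  obtain r where r: "i = c + r"
    using assms(3) by (metis le_Suc_ex)
  with assms(4) have rc: "r < c"
    by simp
  have "[:1, 1:] = (1 + monom 1 1 :: 'a poly)"
    by (simp add: one_pCons monom_Suc monom_0)
  then have "[:1, 1 :: 'a:] ^ c = 1 + monom 1 c"
    using freshmans_dream'[OF pr, of c n 1 "monom 1 1"] assms(2) by (simp add: monom_power)
  then have "[:1, 1 :: 'a:] ^ i = [:1, 1:] ^ r + monom 1 c * [:1, 1:] ^ r"
    by (simp add: r power_add algebra_simps)
  then have "coeff ([:1, 1 :: 'a:] ^ i) c = coeff ([:1, 1:] ^ r) c + coeff ([:1, 1:] ^ r) 0"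
    by (simp add: coeff_monom_mult)
  then show ?thesis
    using rc coeff_linear_poly_power[of c i "1::'a" 1] coeff_eq_0[of "[:1, 1:] ^ r" c]
    by (metis (no_types, lifting) add_0 coeff_0_power coeff_pCons_0 degree_linear_power le_add1 mult.right_neutral power_one r)
qed

text \<open>Characteristic 0 allows \<open>c = M\<close>; in positive characteristic,
  \<open>c\<close> is the largest power of it that is at most \<open>M\<close>. The loss factor
  \<open>P\<close> depends only on the field, so it costs a constant in the final exponent.\<close>

lemma exists_nonvanishing_choose:
  "\<exists>P\<ge>2. \<forall>M\<ge>1. \<exists>c::nat. 1 \<le> c \<and> c \<le> M \<and> M \<le> P * c \<and>
     (\<forall>i. c \<le> i \<longrightarrow> i < 2 * c \<longrightarrow> of_nat (i choose c) \<noteq> (0 :: 'a::field))"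
proof (cases "CHAR('a) = 0")
  case True
  then have "of_nat m \<noteq> (0::'a)" if "m > 0" for m
    using that by (simp add: of_nat_eq_0_iff_char_dvd)
  then have *: "of_nat (i choose c) \<noteq> (0::'a)" if "c \<le> i" for i c
    using that by simp
  show ?thesis
  proof (rule exI[of _ 2], intro conjI allI impI)
    fix M :: nat assume M: "M \<ge> 1"
    show "\<exists>c. 1 \<le> c \<and> c \<le> M \<and> M \<le> 2 * c \<and> (\<forall>i. c \<le> i \<longrightarrow> i < 2 * c \<longrightarrow> of_nat (i choose c) \<noteq> (0 :: 'a))"
      using * M by (intro exI[of _ M]) auto
  qed simp
next
  case False
  then have pos: "CHAR('a) > 0" by simp
  then have "prime CHAR('a)"
    by (rule prime_CHAR_semidom)
  then have p2: "CHAR('a) \<ge> 2"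
    by (rule prime_ge_2_nat)
  show ?thesis
  proof (rule exI[of _ "CHAR('a)"], intro conjI allI impI)
    fix M :: nat assume M: "M \<ge> 1"
    obtain n where n: "CHAR('a) ^ n \<le> M" "M < CHAR('a) ^ (n + 1)"
      using ex_power_ivl1[of "CHAR('a)" M] p2 M by auto
    show "\<exists>c. 1 \<le> c \<and> c \<le> M \<and> M \<le> CHAR('a) * c \<and> (\<forall>i. c \<le> i \<longrightarrow> i < 2 * c \<longrightarrow> of_nat (i choose c) \<noteq> (0 :: 'a))"
      using n of_nat_choose_power_CHAR[where ?'a = 'a, OF pos refl, of n] p2
      by (intro exI[of _ "CHAR('a) ^ n"]) auto
  qed (fact p2)
qed

section \<open>Evaluation of polynomials and circuits\<close>

definition monom_eval :: "('v \<Rightarrow> 'b::comm_semiring_1) \<Rightarrow> ('v \<Rightarrow>\<^sub>0 nat) \<Rightarrow> 'b"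
  where "monom_eval a m = (\<Prod>v\<in>Poly_Mapping.keys m. a v ^ Poly_Mapping.lookup m v)"

text \<open>The coefficient map \<open>h\<close> lets one definition serve for values in the field
  and for values among the univariate polynomials in \<tau>, where \<open>h\<close> embeds the
  constants.\<close>

definition hom_eval :: "('a::comm_semiring_1 \<Rightarrow> 'b) \<Rightarrow> ('v \<Rightarrow> 'b::comm_semiring_1) \<Rightarrow> ('v, 'a) mpoly \<Rightarrow> 'b"
  where "hom_eval h a p =
    (\<Sum>m\<in>Poly_Mapping.keys p. h (Poly_Mapping.lookup p m) * monom_eval a m)"

lemma mp_eval_eq_hom_eval: "mp_eval = hom_eval (\<lambda>c. c)"
  by (intro ext) (simp add: mp_eval_def hom_eval_def monom_eval_def)

lemma monom_eval_superset:
  assumes "finite V" "Poly_Mapping.keys m \<subseteq> V"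
  shows "monom_eval a m = (\<Prod>v\<in>V. a v ^ Poly_Mapping.lookup m v)"
  unfolding monom_eval_def using assms
  by (intro prod.mono_neutral_left) (auto simp: in_keys_iff)

lemma monom_eval_zero [simp]: "monom_eval a 0 = 1"
  by (simp add: monom_eval_def)

lemma monom_eval_single [simp]: "monom_eval a (Poly_Mapping.single v n) = a v ^ n"
  by (cases "n = 0") (auto simp: monom_eval_def)

lemma monom_eval_add: "monom_eval a (m + m') = monom_eval a m * monom_eval a m'"
proof -
  let ?V = "Poly_Mapping.keys m \<union> Poly_Mapping.keys m'"
  have "monom_eval a (m + m') = (\<Prod>v\<in>?V. a v ^ Poly_Mapping.lookup (m + m') v)"
    by (intro monom_eval_superset) (simp_all add: Poly_Mapping.keys_add)
  also have "\<dots> = (\<Prod>v\<in>?V. a v ^ Poly_Mapping.lookup m v) * (\<Prod>v\<in>?V. a v ^ Poly_Mapping.lookup m' v)"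
    by (simp add: lookup_add power_add prod.distrib)
  also have "\<dots> = monom_eval a m * monom_eval a m'"
    by (simp add: monom_eval_superset[of ?V])
  finally show ?thesis .
qed

lemma mpoly_eq_sum_single:
  "p = (\<Sum>m\<in>Poly_Mapping.keys p. Poly_Mapping.single m (Poly_Mapping.lookup p m))"
proof (rule poly_mapping_eqI)
  fix k
  have "Poly_Mapping.lookup (\<Sum>m\<in>Poly_Mapping.keys p. Poly_Mapping.single m (Poly_Mapping.lookup p m)) k
     = (\<Sum>m\<in>Poly_Mapping.keys p. if m = k then Poly_Mapping.lookup p k else 0)"
    by (auto simp: lookup_sum lookup_single when_def intro!: sum.cong)
  also have "\<dots> = Poly_Mapping.lookup p k"
    by (auto simp: in_keys_iff)
  finally show "Poly_Mapping.lookup p k =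
    Poly_Mapping.lookup (\<Sum>m\<in>Poly_Mapping.keys p. Poly_Mapping.single m (Poly_Mapping.lookup p m)) k" ..
qed

locale coeff_hom =
  fixes h :: "'a::comm_semiring_1 \<Rightarrow> 'b::comm_semiring_1"
  assumes hom_zero: "h 0 = 0" and hom_one: "h 1 = 1"
    and hom_add: "h (x + y) = h x + h y" and hom_mult: "h (x * y) = h x * h y"
begin

lemma hom_eval_superset:
  assumes "finite M" "Poly_Mapping.keys p \<subseteq> M"
  shows "hom_eval h a p = (\<Sum>m\<in>M. h (Poly_Mapping.lookup p m) * monom_eval a m)"
  unfolding hom_eval_def using assms
  by (intro sum.mono_neutral_left) (auto simp: in_keys_iff hom_zero)

lemma hom_eval_zero [simp]: "hom_eval h a 0 = 0"
  by (simp add: hom_eval_def)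

lemma hom_eval_single: "hom_eval h a (Poly_Mapping.single m c) = h c * monom_eval a m"
  by (cases "c = 0") (auto simp: hom_eval_def hom_zero)

lemma hom_eval_one [simp]: "hom_eval h a 1 = 1"
  using hom_eval_single[of a 0 1] by (simp add: hom_one)

lemma hom_eval_var: "hom_eval h a (mp_var v) = a v"
  by (simp add: mp_var_def hom_eval_single hom_one)

lemma hom_eval_add: "hom_eval h a (p + q) = hom_eval h a p + hom_eval h a q"
proof -
  let ?M = "Poly_Mapping.keys p \<union> Poly_Mapping.keys q"
  have "hom_eval h a (p + q) = (\<Sum>m\<in>?M. h (Poly_Mapping.lookup (p + q) m) * monom_eval a m)"
    by (intro hom_eval_superset) (simp_all add: Poly_Mapping.keys_add)
  also have "\<dots> = hom_eval h a p + hom_eval h a q"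
    by (simp add: lookup_add hom_add distrib_right sum.distrib hom_eval_superset[of ?M])
  finally show ?thesis .
qed

lemma hom_eval_sum: "hom_eval h a (\<Sum>i\<in>I. f i) = (\<Sum>i\<in>I. hom_eval h a (f i))"
  by (induction I rule: infinite_finite_induct) (auto simp: hom_eval_add)

lemma hom_eval_mult: "hom_eval h a (p * q) = hom_eval h a p * hom_eval h a q"
proof -
  let ?s = "\<lambda>p m. Poly_Mapping.single m (Poly_Mapping.lookup p m)"
  have "hom_eval h a (p * q) =
    hom_eval h a ((\<Sum>m\<in>Poly_Mapping.keys p. ?s p m) * (\<Sum>m\<in>Poly_Mapping.keys q. ?s q m))"
    using mpoly_eq_sum_single[of p] mpoly_eq_sum_single[of q] by simp
  also have "\<dots> = (\<Sum>m\<in>Poly_Mapping.keys p. \<Sum>m'\<in>Poly_Mapping.keys q.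
      (h (Poly_Mapping.lookup p m) * monom_eval a m) * (h (Poly_Mapping.lookup q m') * monom_eval a m'))"
    by (simp add: sum_product hom_eval_sum mult_single hom_eval_single hom_mult monom_eval_add mult_ac)
  also have "\<dots> = hom_eval h a p * hom_eval h a q"
    by (simp add: hom_eval_def sum_product)
  finally show ?thesis .
qed

lemma hom_eval_prod: "hom_eval h a (\<Prod>i\<in>I. f i) = (\<Prod>i\<in>I. hom_eval h a (f i))"
  by (induction I rule: infinite_finite_induct) (auto simp: hom_eval_mult)

lemma hom_eval_power: "hom_eval h a (p ^ n) = hom_eval h a p ^ n"
  by (induction n) (auto simp: hom_eval_mult)

end

interpretation mp_eval: coeff_hom "\<lambda>c. c"
  by standard auto

interpretation const_poly: coeff_hom "\<lambda>c :: 'a::comm_semiring_1. [:c:]"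
  by standard (auto simp: mult.commute)

lemma poly_hom_eval_const_poly:
  "poly (hom_eval (\<lambda>c. [:c:]) a p) x = mp_eval (\<lambda>v. poly (a v) x) p"
  by (simp add: hom_eval_def mp_eval_def poly_sum monom_eval_def poly_prod)

section \<open>Node polynomials of a circuit and their monomials\<close>

lemma node_polys_snoc: "node_polys (C @ [g]) = node_polys C @ [gate_poly (\<lambda>j. node_polys C ! j) g]"
  by (simp add: node_polys_def)

lemma length_node_polys [simp]: "length (node_polys C) = length C"
  by (induction C rule: rev_induct) (auto simp: node_polys_snoc node_polys_def)

lemma gate_poly_cong:
  "(\<And>j. j \<in> children g \<Longrightarrow> h j = h' j) \<Longrightarrow> gate_poly h g = gate_poly h' g"
  by (cases g) (auto intro!: arg_cong[of _ _ sum_list] arg_cong[of _ _ prod_list])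

lemma node_polys_nth:
  assumes "\<forall>i<length C. children (C ! i) \<subseteq> {..<i}" "i < length C"
  shows "node_polys C ! i = gate_poly (\<lambda>j. node_polys C ! j) (C ! i)"
  using assms
proof (induction C arbitrary: i rule: rev_induct)
  case (snoc g C)
  have ch: "\<forall>i<length C. children (C ! i) \<subseteq> {..<i}"
    using snoc.prems(1) by (metis butlast_snoc length_append_singleton less_Suc_eq nth_butlast)
  show ?case
  proof (cases "i < length C")
    case True
    have "children (C ! i) \<subseteq> {..<i}"
      using ch True by blast
    then show ?thesis
      using True snoc.IH[OF ch True]
      by (auto simp: node_polys_snoc nth_append intro!: gate_poly_cong)
  next
    case False
    with snoc.prems have i: "i = length C" by simp
    have "children g \<subseteq> {..<length C}"
      using snoc.prems(1)[rule_format, of "length C"] by simp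
    then show ?thesis
      by (auto simp: i node_polys_snoc nth_append intro!: gate_poly_cong)
  qed
qed simp

text \<open>Every monomial of a product is a sum of one exponent vector per factor, so single terms
  multiply to at most one term. There may be none, since a constant leaf may be 0.\<close>

lemma keys_prod_list_card_le_one:
  assumes "\<And>p. p \<in> set ps \<Longrightarrow> card (Poly_Mapping.keys p) \<le> 1"
  shows "card (Poly_Mapping.keys (prod_list ps :: ('v, 'a::comm_semiring_1) mpoly)) \<le> 1"
  using assms
proof (induction ps)
  case Nil
  have "Poly_Mapping.keys (1 :: ('v, 'a) mpoly) \<subseteq> {0}"
    by simp
  then show ?case
    using card_mono[of "{0 :: 'v \<Rightarrow>\<^sub>0 nat}"] by force
next
  case (Cons p ps)
  let ?A = "Poly_Mapping.keys p" and ?B = "Poly_Mapping.keys (prod_list ps)"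
  have "Poly_Mapping.keys (p * prod_list ps) \<subseteq> {a + b |a b. a \<in> ?A \<and> b \<in> ?B}"
    by (rule keys_mult)
  also have "\<dots> = (\<lambda>(a, b). a + b) ` (?A \<times> ?B)"
    by auto
  finally have "card (Poly_Mapping.keys (p * prod_list ps)) \<le> card (?A \<times> ?B)"
    by (meson card_image_le card_mono finite_SigmaI finite_imageI finite_keys le_trans)
  also have "\<dots> \<le> 1 * 1"
    unfolding card_cartesian_product using Cons by (intro mult_mono) auto
  finally show ?case by simp
qed

lemma sum_list_eq_sum_count:
  fixes h :: "nat \<Rightarrow> 'b::comm_semiring_1"
  shows "(\<Sum>j\<leftarrow>js. h j) = (\<Sum>j\<in>set js. of_nat (count_list js j) * h j)"
proof -
  have "(\<Sum>j\<leftarrow>js. h j) = (\<Sum>j\<in>S. of_nat (count_list js j) * h j)" if "finite S" "set js \<subseteq> S" for S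
    using that(2)
  proof (induction js)
    case (Cons a js)
    have "(\<Sum>j\<in>S. of_nat (count_list (a # js) j) * h j) =
      (\<Sum>j\<in>S. (if j = a then h j else 0) + of_nat (count_list js j) * h j)"
      by (intro sum.cong) (auto simp: algebra_simps)
    also have "\<dots> = h a + (\<Sum>j\<leftarrow>js. h j)"
      using Cons that(1) by (simp add: sum.distrib)
    finally show ?case by simp
  qed simp
  then show ?thesis
    by blast
qed

lemma keys_sum_list_subset:
  "Poly_Mapping.keys (sum_list ps) \<subseteq> (\<Union>p\<in>set ps. Poly_Mapping.keys p)"
  by (induction ps) (use Poly_Mapping.keys_add in fastforce)+

text \<open>\<open>K\<close> collects the monomials of all monomial nodes. Each such node has at
  most one, so \<open>card K\<close> is bounded by the number of nodes even when several
  \<open>Q j\<close> share them. \<open>Q j\<close> is the polynomial below the power gate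
  \<open>j\<close>, and parallel wires into the output gate become the multiplicities
  \<open>m j\<close>.\<close>

lemma sum_pow_sum_prod_decomposition:
  fixes C :: "('v, 'a::comm_ring_1) circuit"
  assumes "circuit_over V C" "sum_pow_sum_prod C"
  obtains J :: "nat set" and K :: "('v \<Rightarrow>\<^sub>0 nat) set" and Q e m
  where "finite J" "card J \<le> circuit_size C" "finite K" "card K \<le> circuit_size C"
    "\<And>j. j \<in> J \<Longrightarrow> Poly_Mapping.keys (Q j) \<subseteq> K"
    "output_poly C = (\<Sum>j\<in>J. of_nat (m j) * Q j ^ e j)"
proof -
  let ?N = "node_polys C"
  have ch: "\<forall>i<length C. children (C ! i) \<subseteq> {..<i}" and ne: "C \<noteq> []"
    using assms(1) by (auto simp: circuit_over_def)
  have child: "j < length C" if "i < length C" "j \<in> children (C ! i)" for i j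
    using ch that by (meson lessThan_iff order.strict_trans subsetD)
  obtain js where js: "C ! (length C - 1) = Sum js" "\<forall>j\<in>set js. power_node C j"
    using assms(2) by (auto simp: sum_pow_sum_prod_def)
  have last: "length C - 1 < length C"
    using ne by simp
  have js_le: "j < length C" if "j \<in> set js" for j
    using child[OF last] js that by simp
  have "\<forall>j\<in>set js. \<exists>i e. C ! j = Pow i e \<and> sum_of_monomials_node C i"
    using js(2) by (simp add: power_node_def)
  then obtain ci ex where ci: "C ! j = Pow (ci j) (ex j)" "sum_of_monomials_node C (ci j)"
    if "j \<in> set js" for j
    by metis
  have ci_le: "ci j < length C" if "j \<in> set js" for j
    using child[OF js_le[OF that]] ci that by simp
  define I where "I = {i. i < length C \<and> monomial_node C i}"
  define K where "K = (\<Union>i\<in>I. Poly_Mapping.keys (?N ! i))"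
  have card_leaf: "card (Poly_Mapping.keys (?N ! i)) \<le> 1" if "i < length C" "leaf_node C i" for i
    using that by (auto simp: node_polys_nth[OF ch] leaf_node_def mp_var_def mp_const_def)
  have card_mono: "card (Poly_Mapping.keys (?N ! i)) \<le> 1" if "i \<in> I" for i
  proof -
    have i: "i < length C" and "monomial_node C i"
      using that by (auto simp: I_def)
    then obtain ls where ls: "C ! i = Prod ls" "\<forall>l\<in>set ls. leaf_node C l"
      by (auto simp: monomial_node_def)
    then have "l < length C" if "l \<in> set ls" for l
      using child[OF i] that by simp
    then have "card (Poly_Mapping.keys p) \<le> 1" if "p \<in> set (map ((!) ?N) ls)" for p
      using that ls card_leaf by auto
    then have "card (Poly_Mapping.keys (prod_list (map ((!) ?N) ls))) \<le> 1"
      by (rule keys_prod_list_card_le_one)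
    then show ?thesis
      by (simp add: node_polys_nth[OF ch i] ls)
  qed
  have "I \<subseteq> {..<length C}"
    by (auto simp: I_def)
  then have finI: "finite I" "card I \<le> length C"
    using Finite_Set.card_mono[of "{..<length C}" I] finite_subset by auto
  have "card K \<le> (\<Sum>i\<in>I. card (Poly_Mapping.keys (?N ! i)))"
    unfolding K_def by (rule card_UN_le[OF finI(1)])
  also have "\<dots> \<le> (\<Sum>i\<in>I. 1)"
    by (intro sum_mono card_mono)
  finally have cardK: "card K \<le> length C"
    using finI by simp
  show ?thesis
  proof (rule that[of "set js" K "\<lambda>j. ?N ! ci j" "\<lambda>j. count_list js j" ex])
    have "set js \<subseteq> {..<length C}"
      using js_le by auto
    then show "card (set js) \<le> circuit_size C"
      using Finite_Set.card_mono[of "{..<length C}" "set js"] by (simp add: circuit_size_def)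
    show "finite K"
      using finI by (simp add: K_def)
    show "card K \<le> circuit_size C"
      using cardK by (simp add: circuit_size_def)
    show "Poly_Mapping.keys (?N ! ci j) \<subseteq> K" if j: "j \<in> set js" for j
    proof -
      obtain ls where ls: "C ! ci j = Sum ls" "\<forall>l\<in>set ls. monomial_node C l"
        using ci(2)[OF j] by (auto simp: sum_of_monomials_node_def)
      then have "set ls \<subseteq> I"
        using child[OF ci_le[OF j]] by (auto simp: I_def)
      have "Poly_Mapping.keys (?N ! ci j) = Poly_Mapping.keys (\<Sum>l\<leftarrow>ls. ?N ! l)"
        by (simp add: node_polys_nth[OF ch ci_le[OF j]] ls)
      also have "\<dots> \<subseteq> (\<Union>p\<in>set (map (\<lambda>l. ?N ! l) ls). Poly_Mapping.keys p)"
        by (rule keys_sum_list_subset)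
      also have "\<dots> \<subseteq> K"
        using \<open>set ls \<subseteq> I\<close> by (auto simp: K_def)
      finally show ?thesis .
    qed
    have "?N \<noteq> []"
      using ne length_node_polys[of C] by (metis length_0_conv)
    then have "output_poly C = ?N ! (length C - 1)"
      by (simp add: output_poly_def last_conv_nth)
    also have "\<dots> = (\<Sum>j\<leftarrow>js. ?N ! j)"
      using node_polys_nth[OF ch last] js by simp
    also have "\<dots> = (\<Sum>j\<in>set js. of_nat (count_list js j) * ?N ! j)"
      by (rule sum_list_eq_sum_count)
    also have "\<dots> = (\<Sum>j\<in>set js. of_nat (count_list js j) * (?N ! ci j) ^ ex j)"
      by (intro sum.cong refl) (simp add: node_polys_nth[OF ch js_le] ci)
    finally show "output_poly C = (\<Sum>j\<in>set js. of_nat (count_list js j) * (?N ! ci j) ^ ex j)" .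
  qed simp
qed

section \<open>Restrictions of iterated matrix multiplication\<close>

fun path_weight :: "nat \<Rightarrow> (imm_var \<Rightarrow> 'a::comm_semiring_1) \<Rightarrow> nat \<Rightarrow> nat \<Rightarrow> 'a" where
  "path_weight n a 0 v = of_bool (v = 1)"
| "path_weight n a (Suc t) v = (\<Sum>v'\<in>{1..n}. path_weight n a t v' * a (Suc t, v', v))"

text \<open>\<open>path_weight n a t v\<close> is the entry (1, v) of the product of the first
  \<open>t\<close> matrices, filled by \<open>a\<close>. The induction splits off the last inner
  vertex of a path.\<close>

lemma sum_paths_eq_path_weight:
  assumes "n \<ge> 1"
  shows "(\<Sum>is\<in>{is. length is = t \<and> set is \<subseteq> {1..n}}.
      \<Prod>s = 1..Suc t. a (s, (1 # is @ [v]) ! (s - 1), (1 # is @ [v]) ! s)) = path_weight n a (Suc t) v"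
proof (induction t arbitrary: v)
  case 0
  have "{is. length is = 0 \<and> set is \<subseteq> {1..n}} = {[] :: nat list}"
    by auto
  moreover have "(\<Sum>v'\<in>{1..n}. of_bool (v' = 1) * a (Suc 0, v', v)) = a (Suc 0, 1, v)"
    using assms by (subst sum.remove[of _ 1]) (auto intro!: sum.neutral)
  ultimately show ?case
    by simp
next
  case (Suc t)
  let ?L = "\<lambda>t. {is. length is = t \<and> set is \<subseteq> {1..n}}"
  let ?p = "\<lambda>is v s. a (s, (1 # is @ [v]) ! (s - 1), (1 # is @ [v]) ! s)"
  have bij: "bij_betw (\<lambda>(x, is). is @ [x]) ({1..n} \<times> ?L t) (?L (Suc t))"
    by (rule bij_betw_byWitness[where f' = "\<lambda>is. (last is, butlast is)"])
       (auto simp: length_Suc_conv_rev dest: in_set_butlastD)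
  have split: "(\<Prod>s = 1..Suc (Suc t). ?p (is @ [x]) v s) = (\<Prod>s = 1..Suc t. ?p is x s) * a (Suc (Suc t), x, v)"
    if "is \<in> ?L t" for x "is"
  proof -
    have "?p (is @ [x]) v s = ?p is x s" if "s \<in> {1..Suc t}" for s
      using that \<open>is \<in> ?L t\<close> by (auto simp: nth_append nth_Cons split: nat.splits)
    moreover have "?p (is @ [x]) v (Suc (Suc t)) = a (Suc (Suc t), x, v)"
      using that by (auto simp: nth_append)
    ultimately show ?thesis
      by (subst prod.nat_ivl_Suc') (auto simp: mult.commute)
  qed
  have "(\<Sum>is\<in>?L (Suc t). \<Prod>s = 1..Suc (Suc t). ?p is v s) =
      (\<Sum>(x, is)\<in>{1..n} \<times> ?L t. \<Prod>s = 1..Suc (Suc t). ?p (is @ [x]) v s)"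
    by (subst sum.reindex_bij_betw[OF bij, symmetric]) (simp add: case_prod_unfold)
  also have "\<dots> = (\<Sum>x\<in>{1..n}. \<Sum>is\<in>?L t. (\<Prod>s = 1..Suc t. ?p is x s) * a (Suc (Suc t), x, v))"
    unfolding sum.cartesian_product by (intro sum.cong refl) (use split in auto)
  also have "\<dots> = (\<Sum>x\<in>{1..n}. path_weight n a (Suc t) x * a (Suc (Suc t), x, v))"
    unfolding Suc.IH[symmetric] by (simp only: sum_distrib_right)
  finally show ?case
    by (simp only: path_weight.simps)
qed

lemma mp_eval_IMM:
  assumes "n \<ge> 1" "d \<ge> 1"
  shows "mp_eval a (IMM n d) = path_weight n a d 1"
proof -
  have "mp_eval a (IMM n d) = (\<Sum>is\<in>{is. length is = d - 1 \<and> set is \<subseteq> {1..n}}.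
       \<Prod>t = 1..d. a (t, ([1] @ is @ [1]) ! (t - 1), ([1] @ is @ [1]) ! t))"
    unfolding IMM_def mp_eval_eq_hom_eval mp_eval.hom_eval_sum mp_eval.hom_eval_prod mp_eval.hom_eval_var ..
  then show ?thesis
    using sum_paths_eq_path_weight[where t = "d - 1" and a = a and v = 1, OF assms(1)] assms(2) by simp
qed

text \<open>\<open>chain_sum Y m j\<close> counts the \<open>m\<close>-element subsets of \<open>Y\<close> with maximum \<open>j\<close>; the empty set has \<open>j = 0\<close>.\<close>

fun chain_sum :: "nat set \<Rightarrow> nat \<Rightarrow> nat \<Rightarrow> 'a::comm_semiring_1" where
  "chain_sum Y 0 j = of_bool (j = 0)"
| "chain_sum Y (Suc m) j = of_bool (j \<in> Y) * (\<Sum>j'<j. chain_sum Y m j')"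

text \<open>Each nonempty subset of \<open>Y\<close> is counted at its maximum. Since 0 marks the
  empty set, it must not be an element of \<open>Y\<close>.\<close>

lemma sum_chain_sum:
  assumes "0 \<notin> Y"
  shows "(\<Sum>j\<le>J. chain_sum Y m j) = of_nat (card (Y \<inter> {..J}) choose m)"
proof (induction m arbitrary: J)
  case 0
  show ?case by simp
next
  case (Suc m)
  show ?case
  proof (induction J)
    case 0
    have "Y \<inter> {..0} = {}"
      using assms by auto
    then show ?case by simp
  next
    case (Suc J)
    have "Y \<inter> {..Suc J} = (if Suc J \<in> Y then insert (Suc J) (Y \<inter> {..J}) else Y \<inter> {..J})"
      by (auto simp: le_Suc_eq)
    then have "card (Y \<inter> {..Suc J}) = card (Y \<inter> {..J}) + of_bool (Suc J \<in> Y)"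
      by simp
    then show ?case
      using Suc \<open>\<And>J. (\<Sum>j\<le>J. chain_sum Y m j) = of_nat (card (Y \<inter> {..J}) choose m)\<close>[of J]
      by (auto simp: lessThan_Suc_atMost add.commute)
  qed
qed

lemma mult_add_div_mod:
  fixes a m r :: nat
  assumes "r < m"
  shows "(a * m + r) div m = a" "(a * m + r) mod m = r"
  using assms by (simp_all add: div_mult1_eq)

text \<open>There are \<open>k\<close> blocks of \<open>c + 2\<close> layers, \<open>w\<close> rows,
  \<open>q\<close> copies of every vertex and \<open>u\<close> Boolean variables per block; row
  \<open>i\<close> reads only labels in \<open>W i\<close>. The width leaves room for the hub and
  for one vertex per row, label (0 included) and copy.\<close>

locale imm_restriction =
  fixes n d k c w q u :: nat and W :: "nat \<Rightarrow> nat set"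
  assumes depth: "k * (c + 2) \<le> d" and width: "1 + w * (u + 1) * q \<le> n"
    and k_pos: "k \<ge> 1"
    and W_subset: "\<And>i. i < w \<Longrightarrow> W i \<subseteq> {1..u}"
begin

text \<open>
  Vertex 1 of each layer is the hub at which blocks begin and end. A vertex \<open>v \<ge> 2\<close> encodes a row, the
  label in \<open>{0..u}\<close> of the variable read last, and a copy.
\<close>

definition vert :: "nat \<Rightarrow> nat \<Rightarrow> nat \<Rightarrow> nat"
  where "vert i j x = 2 + ((i * (u + 1) + j) * q + x)"

definition row :: "nat \<Rightarrow> nat" where "row v = (v - 2) div q div (u + 1)"
definition lab :: "nat \<Rightarrow> nat" where "lab v = (v - 2) div q mod (u + 1)"
definition cop :: "nat \<Rightarrow> nat" where "cop v = (v - 2) mod q"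

definition block :: "nat \<Rightarrow> nat" where "block t = (t - 1) div (c + 2)"
definition pos :: "nat \<Rightarrow> nat" where "pos t = (t - 1) mod (c + 2)"

text \<open>
  Within a block, position 0 holds the selecting edges, positions 1 to \<open>c\<close> read variables with
  increasing labels, and position \<open>c + 1\<close> returns to the hub. The layers after the last block stay at
  the hub. Positions are only meaningful for \<open>t \<ge> 1\<close>; the variables with \<open>t = 0\<close> are junk.
\<close>

fun reading :: "imm_var \<Rightarrow> bool" where
  "reading (t, v', v) \<longleftrightarrow> block t < k \<and> 1 \<le> pos t \<and> pos t \<le> c"

text \<open>A set of at most one pair of block and label, so that the Boolean variables read by a
  monomial form a union over its edges.\<close>

fun lbl :: "imm_var \<Rightarrow> (nat \<times> nat) set" where
  "lbl (t, v', v) = (if reading (t, v', v) then {(block t, lab v)} else {})"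

text \<open>The value of an edge apart from the Boolean variable that it reads;
  \<open>[:0, 1:]\<close> is \<tau>. A reading edge stays in its row, increases the label and enters
  the copy kept by \<open>\<sigma>\<close>. The test \<open>t \<ge> 1\<close> excludes the junk
  variables with \<open>t = 0\<close>, which truncated subtraction would place at position 0 of
  block 0; thus exactly \<open>k\<close> variables carry \<tau>.\<close>

fun coef :: "(nat \<times> nat \<Rightarrow> nat) \<Rightarrow> (nat \<Rightarrow> nat) \<Rightarrow> imm_var \<Rightarrow> 'a::comm_ring_1 poly" where
  "coef \<sigma> \<beta> (t, v', v) =
    (if reading (t, v', v) then
       of_bool (v' \<ge> 2 \<and> v \<ge> 2 \<and> row v' = row v \<and> row v < w \<and> lab v' < lab v \<and>
         lab v \<in> W (row v) \<and> cop v = \<sigma> (block t, lab v))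
     else if block t < k \<and> pos t = 0 then
       (if t \<ge> 1 \<and> v' = 1 \<and> v = vert (\<beta> (block t)) 0 0 then [:0, 1:] else 0)
     else of_bool (v = 1))"

text \<open>\<open>X\<close> is the set of Boolean variables with value 1, so the test
  \<open>lbl e \<subseteq> X\<close> is the value of the variable read by \<open>e\<close>.\<close>

definition wt :: "(nat \<times> nat \<Rightarrow> nat) \<Rightarrow> (nat \<Rightarrow> nat) \<Rightarrow> (nat \<times> nat) set \<Rightarrow> imm_var \<Rightarrow> 'a::comm_ring_1 poly"
  where "wt \<sigma> \<beta> X e = (if lbl e \<subseteq> X then coef \<sigma> \<beta> e else 0)"

lemma vert_decode:
  assumes "x < q" "j \<le> u"
  shows "row (vert i j x) = i" "lab (vert i j x) = j" "cop (vert i j x) = x" "vert i j x \<ge> 2"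
proof -
  have v: "vert i j x - 2 = (i * (u + 1) + j) * q + x"
    by (simp add: vert_def)
  have j: "j < u + 1"
    using assms by simp
  show "row (vert i j x) = i" "lab (vert i j x) = j" "cop (vert i j x) = x"
    unfolding row_def lab_def cop_def v mult_add_div_mod[OF assms(1)] mult_add_div_mod[OF j] by (rule refl)+
  show "vert i j x \<ge> 2"
    by (simp add: vert_def)
qed

lemma vert_encode: "v \<ge> 2 \<Longrightarrow> v = vert (row v) (lab v) (cop v)"
  unfolding row_def lab_def cop_def vert_def div_mult_mod_eq by simp

lemma lab_le: "lab v \<le> u"
  using mod_less_divisor[of "u + 1"] by (simp add: lab_def less_Suc_eq_le)

lemma vert_range:
  assumes "i < w" "j \<le> u" "x < q"
  shows "vert i j x \<in> {1..n}"
proof -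
  have "(i * (u + 1) + j) * q + x < (i * (u + 1) + j + 1) * q"
    using assms by simp
  also have "\<dots> \<le> (i * (u + 1) + (u + 1)) * q"
    using assms by (intro mult_right_mono) auto
  also have "\<dots> = Suc i * (u + 1) * q"
    by simp
  also have "\<dots> \<le> w * (u + 1) * q"
    using assms by (intro mult_right_mono) auto
  finally show ?thesis
    using width by (simp add: vert_def)
qed

lemma block_pos:
  assumes "i < c + 2"
  shows "block (Suc (b * (c + 2) + i)) = b" "pos (Suc (b * (c + 2) + i)) = i"
  unfolding block_def pos_def diff_Suc_1 by (rule mult_add_div_mod[OF assms])+

text \<open>At \<tau> = 1 all weights are 0 or 1, so the restriction becomes a point of the cube,
  where the circuit agrees with \<open>IMM\<close>.\<close>

definition ev :: "(nat \<times> nat \<Rightarrow> nat) \<Rightarrow> (nat \<Rightarrow> nat) \<Rightarrow> (nat \<times> nat) set \<Rightarrow> imm_var \<Rightarrow> 'a::comm_ring_1"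
  where "ev \<sigma> \<beta> X e = poly (wt \<sigma> \<beta> X e) 1"

context
  fixes \<sigma> :: "nat \<times> nat \<Rightarrow> nat" and \<beta> :: "nat \<Rightarrow> nat" and X :: "(nat \<times> nat) set"
  assumes \<sigma>: "\<And>x. \<sigma> x < q" and \<beta>: "\<And>b. b < k \<Longrightarrow> \<beta> b < w"
begin

abbreviation (input) evX :: "imm_var \<Rightarrow> 'a::comm_ring_1" where "evX \<equiv> ev \<sigma> \<beta> X"

lemma ev_Pi: "evX \<in> V \<rightarrow> {0, 1}"
  by (auto simp: ev_def wt_def split: if_splits)

lemma n_pos: "1 \<in> {1..n}"
  using width by simp

text \<open>Inside the block, all weight sits in row \<open>\<beta> b\<close> on one active vertex
  per label, where it counts the sets of labels read so far by their maximum. The return to the hub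
  adds up over all maxima.\<close>

lemma path_weight_block:
  fixes g :: "'a::comm_ring_1"
  assumes b: "b < k" and start: "\<And>v. path_weight n evX (b * (c + 2)) v = of_bool (v = 1) * g"
  shows "path_weight n evX (Suc b * (c + 2)) v =
    of_bool (v = 1) * (g * of_nat (card (X `` {b} \<inter> W (\<beta> b)) choose c))"
proof -
  define B where "B = b * (c + 2)"
  have block_B: "block (Suc (B + i)) = b" "pos (Suc (B + i)) = i" if "i < c + 2" for i
    unfolding B_def by (rule block_pos[OF that])+
  have start_B: "path_weight n evX B v = of_bool (v = 1) * g" for v
    unfolding B_def by (rule start)
  define Y where "Y = X `` {b} \<inter> W (\<beta> b)"
  have Y: "Y \<subseteq> {1..u}"
    using W_subset[OF \<beta>[OF b]] by (auto simp: Y_def)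
  \<comment> \<open>The selecting edge enters copy 0 at label 0; every later edge enters the copy
    kept by \<open>\<sigma>\<close>.\<close>
  define act where "act m j = vert (\<beta> b) j (if m = 0 then 0 else \<sigma> (b, j))" for m j :: nat
  have q: "q > 0"
    using \<sigma>[of undefined] by simp
  have act: "row (act m j) = \<beta> b" "lab (act m j) = j" "act m j \<ge> 2" "act m j \<in> {1..n}" if "j \<le> u" for m j
    using that vert_decode \<sigma> q vert_range[OF \<beta>[OF b]] by (auto simp: act_def)
  have main: "path_weight n evX (Suc (B + m)) v = (\<Sum>j\<le>u. of_bool (v = act m j) * (g * chain_sum Y m j))"
    if "m \<le> c" for m v
    using that
  proof (induction m arbitrary: v)
    case 0
    have "evX (Suc (B), v', v) = (of_bool (v' = 1 \<and> v = act 0 0) :: 'a)" for v'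
      using block_B[of 0] b by (auto simp: ev_def wt_def act_def)
    then have "path_weight n evX (Suc (B + 0)) v =
        (\<Sum>v'\<in>{1..n}. if v' = 1 then g * of_bool (v = act 0 0) else 0)"
      unfolding path_weight.simps add_0_right start_B by (intro sum.cong refl) auto
    also have "\<dots> = g * of_bool (v = act 0 0)"
      using n_pos by simp
    also have "\<dots> = (\<Sum>j\<le>u. if j = 0 then g * of_bool (v = act 0 0) else 0)"
      by simp
    also have "\<dots> = (\<Sum>j\<le>u. of_bool (v = act 0 j) * (g * chain_sum Y 0 j))"
      by (intro sum.cong refl) simp
    finally show ?case .
  next
    case (Suc m)
    let ?t = "Suc (B + Suc m)"
    have edge: "evX (?t, act m j', v) = (\<Sum>j\<le>u. of_bool (v = act (Suc m) j) * (of_bool (j \<in> Y) * of_bool (j' < j)) :: 'a)"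
      if j': "j' \<le> u" for j'
    proof -
      have rd: "reading (?t, v', v)" "block ?t = b" for v'
        using block_B[of "Suc m"] b Suc.prems by auto
      have "evX (?t, act m j', v) = of_bool ((b, lab v) \<in> X \<and> v \<ge> 2 \<and> row v = \<beta> b \<and> j' < lab v \<and>
         lab v \<in> W (\<beta> b) \<and> cop v = \<sigma> (b, lab v))"
        unfolding ev_def wt_def using rd act[OF j', of m] \<beta>[OF b] by (auto simp del: reading.simps)
      also have "\<dots> = (\<Sum>j\<le>u. if j = lab v then of_bool (v = act (Suc m) j) * (of_bool (j \<in> Y) * of_bool (j' < j)) else 0)"
      proof -
        have "v = act (Suc m) (lab v) \<longleftrightarrow> v \<ge> 2 \<and> row v = \<beta> b \<and> cop v = \<sigma> (b, lab v)"
        proof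
          assume "v = act (Suc m) (lab v)"
          then show "v \<ge> 2 \<and> row v = \<beta> b \<and> cop v = \<sigma> (b, lab v)"
            using vert_decode[OF \<sigma>[of "(b, lab v)"] lab_le[of v], of "\<beta> b"] by (simp add: act_def)
        next
          assume "v \<ge> 2 \<and> row v = \<beta> b \<and> cop v = \<sigma> (b, lab v)"
          then show "v = act (Suc m) (lab v)"
            using vert_encode[of v] by (simp add: act_def)
        qed
        then show ?thesis
          using lab_le[of v] by (auto simp: Y_def)
      qed
      also have "\<dots> = (\<Sum>j\<le>u. of_bool (v = act (Suc m) j) * (of_bool (j \<in> Y) * of_bool (j' < j)))"
        using act(2)[of _ "Suc m"] by (intro sum.cong refl) auto
      finally show ?thesis .
    qed
    have IH: "path_weight n evX (Suc (B + m)) v' = (\<Sum>j\<le>u. of_bool (v' = act m j) * (g * chain_sum Y m j))" for v'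
      using Suc by simp
    have "path_weight n evX ?t v =
      (\<Sum>v'\<in>{1..n}. path_weight n evX (Suc (B + m)) v' * evX (?t, v', v))"
      by (simp only: path_weight.simps add_Suc_right)
    also have "\<dots> = (\<Sum>v'\<in>{1..n}. \<Sum>j'\<le>u. of_bool (v' = act m j') * (g * chain_sum Y m j') * evX (?t, v', v))"
      by (simp only: IH sum_distrib_right)
    also have "\<dots> = (\<Sum>j'\<le>u. \<Sum>v'\<in>{1..n}. of_bool (v' = act m j') * (g * chain_sum Y m j') * evX (?t, v', v))"
      by (rule sum.swap)
    also have "\<dots> = (\<Sum>j'\<le>u. (g * chain_sum Y m j') * evX (?t, act m j', v))"
    proof (intro sum.cong refl)
      fix j' assume "j' \<in> {..u}"
      then have "act m j' \<in> {1..n}"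
        using act by simp
      then show "(\<Sum>v'\<in>{1..n}. of_bool (v' = act m j') * (g * chain_sum Y m j') * evX (?t, v', v)) =
          (g * chain_sum Y m j') * evX (?t, act m j', v)"
        by (subst sum.remove) (auto intro!: sum.neutral)
    qed
    also have "\<dots> = (\<Sum>j'\<le>u. \<Sum>j\<le>u. (g * chain_sum Y m j') * (of_bool (v = act (Suc m) j) * (of_bool (j \<in> Y) * of_bool (j' < j))))"
      unfolding sum_distrib_left[symmetric] by (intro sum.cong refl) (simp only: edge atMost_iff)
    also have "\<dots> = (\<Sum>j\<le>u. \<Sum>j'\<le>u. (g * chain_sum Y m j') * (of_bool (v = act (Suc m) j) * (of_bool (j \<in> Y) * of_bool (j' < j))))"
      by (rule sum.swap)
    also have "\<dots> = (\<Sum>j\<le>u. of_bool (v = act (Suc m) j) * (g * chain_sum Y (Suc m) j))"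
    proof (intro sum.cong refl)
      fix j assume j: "j \<in> {..u}"
      have "(\<Sum>j'\<le>u. (g * chain_sum Y m j') * (of_bool (v = act (Suc m) j) * (of_bool (j \<in> Y) * of_bool (j' < j)))) =
        of_bool (v = act (Suc m) j) * (g * (of_bool (j \<in> Y) * (\<Sum>j'\<le>u. of_bool (j' < j) * chain_sum Y m j')))"
        by (simp only: sum_distrib_left) (intro sum.cong refl, simp only: ac_simps)
      also have "(\<Sum>j'\<le>u. of_bool (j' < j) * chain_sum Y m j') = (\<Sum>j'<j. chain_sum Y m j' :: 'a)"
        using j by (intro sum.mono_neutral_cong_right) auto
      finally show "(\<Sum>j'\<le>u. (g * chain_sum Y m j') * (of_bool (v = act (Suc m) j) * (of_bool (j \<in> Y) * of_bool (j' < j)))) =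
        of_bool (v = act (Suc m) j) * (g * chain_sum Y (Suc m) j)"
        by simp
    qed
    finally show ?case .
  qed
  have last: "evX (Suc (B + Suc c), v', v) = (of_bool (v = 1) :: 'a)" for v'
    using block_B[of "Suc c"] by (auto simp: ev_def wt_def)
  have "Suc b * (c + 2) = Suc (B + Suc c)"
    by (simp add: B_def)
  then have "path_weight n evX (Suc b * (c + 2)) v = (path_weight n evX (Suc (B + Suc c)) v :: 'a)"
    by (simp only:)
  also have "\<dots> = (\<Sum>v'\<in>{1..n}. path_weight n evX (Suc (B + c)) v' * of_bool (v = 1))"
    by (simp only: path_weight.simps(2)[of n evX "B + Suc c"] last, simp only: add_Suc_right)
  also have "\<dots> = of_bool (v = 1) * (\<Sum>v'\<in>{1..n}. \<Sum>j\<le>u. of_bool (v' = act c j) * (g * chain_sum Y c j))"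
    by (simp only: main[OF order.refl] mult.commute[of _ "of_bool (v = 1)"] flip: sum_distrib_left)
  also have "(\<Sum>v'\<in>{1..n}. \<Sum>j\<le>u. of_bool (v' = act c j) * (g * chain_sum Y c j)) =
      (\<Sum>j\<le>u. \<Sum>v'\<in>{1..n}. of_bool (v' = act c j) * (g * chain_sum Y c j))"
    by (rule sum.swap)
  also have "\<dots> = (\<Sum>j\<le>u. g * chain_sum Y c j)"
  proof (intro sum.cong refl)
    fix j assume "j \<in> {..u}"
    then have "act c j \<in> {1..n}"
      using act by simp
    then show "(\<Sum>v'\<in>{1..n}. of_bool (v' = act c j) * (g * chain_sum Y c j)) = g * chain_sum Y c j"
      by (subst sum.remove) (auto intro!: sum.neutral)
  qed
  also have "\<dots> = g * of_nat (card (Y \<inter> {..u}) choose c)"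
    using Y by (subst sum_chain_sum[symmetric]) (auto simp: sum_distrib_left)
  also have "Y \<inter> {..u} = Y"
    using Y by auto
  finally show ?thesis
    by (simp add: Y_def)
qed

lemma path_weight_blocks:
  assumes "b \<le> k"
  shows "path_weight n evX (b * (c + 2)) v =
    (of_bool (v = 1) * (\<Prod>b'<b. of_nat (card (X `` {b'} \<inter> W (\<beta> b')) choose c)) :: 'a::comm_ring_1)"
  using assms
proof (induction b arbitrary: v)
  case (Suc b)
  then show ?case
    using path_weight_block[of b "\<Prod>b'<b. of_nat (card (X `` {b'} \<inter> W (\<beta> b')) choose c) :: 'a" v]
    by (simp del: mult_Suc)
qed simp

lemma path_weight_padding:
  fixes g :: "'a::comm_ring_1"
  assumes "\<And>v. path_weight n evX (k * (c + 2)) v = of_bool (v = 1) * g"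
  shows "path_weight n evX (k * (c + 2) + i) v = of_bool (v = 1) * g"
proof (induction i arbitrary: v)
  case 0
  then show ?case
    using assms by simp
next
  case (Suc i)
  let ?t = "Suc (k * (c + 2) + i)"
  have "k * (c + 2) div (c + 2) \<le> (k * (c + 2) + i) div (c + 2)"
    by (rule div_le_mono) simp
  then have "k \<le> block ?t"
    by (simp only: block_def diff_Suc_1 nonzero_mult_div_cancel_right)
  then have "evX (?t, v', v) = (of_bool (v = 1) :: 'a)" for v'
    by (auto simp: ev_def wt_def)
  then have "path_weight n evX (k * (c + 2) + Suc i) v = (\<Sum>v'\<in>{1..n}. if v' = 1 then of_bool (v = 1) * g else 0)"
    using Suc by (auto intro!: sum.cong)
  then show ?case
    using n_pos by simp
qed

text \<open>The blocks multiply because all weight passes through the hub between them; the layers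
  after the last block keep it there.\<close>

lemma mp_eval_ev_IMM:
  "mp_eval evX (IMM n d) = (\<Prod>b<k. of_nat (card (X `` {b} \<inter> W (\<beta> b)) choose c) :: 'a::comm_ring_1)"
proof -
  have "d \<ge> 1"
    using depth k_pos by (cases d) auto
  then have "mp_eval evX (IMM n d) = (path_weight n evX d 1 :: 'a)"
    using n_pos by (intro mp_eval_IMM) auto
  moreover have "d = k * (c + 2) + (d - k * (c + 2))"
    using depth by simp
  ultimately show ?thesis
    using path_weight_padding[OF path_weight_blocks[OF order.refl], of "d - k * (c + 2)" 1] by simp
qed

end

end

section \<open>Functions of low degree and the representation of a circuit\<close>

text \<open>A set \<open>X\<close> stands for a point of the cube and
  \<open>of_bool (A \<subseteq> X)\<close> for the multilinear monomial of \<open>A\<close>. Thus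
  \<open>f\<close> agrees on the cube with a polynomial of degree at most \<open>D\<close>.\<close>

definition low_degree :: "'x set \<Rightarrow> nat \<Rightarrow> ('x set \<Rightarrow> 'a::comm_ring_1) \<Rightarrow> bool"
  where "low_degree V D f \<longleftrightarrow>
    (\<exists>r. \<forall>X\<subseteq>V. f X = (\<Sum>A\<in>{A. A \<subseteq> V \<and> card A \<le> D}. r A * of_bool (A \<subseteq> X)))"

lemma low_degree_family:
  assumes "finite V" "finite I" "\<And>i. i \<in> I \<Longrightarrow> S i \<subseteq> V \<and> card (S i) \<le> D"
    and "\<And>X. X \<subseteq> V \<Longrightarrow> f X = (\<Sum>i\<in>I. a i * of_bool (S i \<subseteq> X))"
  shows "low_degree V D f"
proof -
  let ?K = "{A. A \<subseteq> V \<and> card A \<le> D}"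
  have fin: "finite ?K"
    by (rule finite_subset[of _ "Set.Pow V"]) (use assms(1) in auto)
  have "f X = (\<Sum>A\<in>?K. (\<Sum>i\<in>{i\<in>I. S i = A}. a i) * of_bool (A \<subseteq> X))" if "X \<subseteq> V" for X
  proof -
    have "f X = (\<Sum>A\<in>?K. \<Sum>i\<in>{i\<in>I. S i = A}. a i * of_bool (S i \<subseteq> X))"
      using assms that fin by (subst sum.group) auto
    also have "\<dots> = (\<Sum>A\<in>?K. (\<Sum>i\<in>{i\<in>I. S i = A}. a i) * of_bool (A \<subseteq> X))"
      unfolding sum_distrib_right by (intro sum.cong refl) auto
    finally show ?thesis .
  qed
  then show ?thesis
    unfolding low_degree_def by (intro exI[of _ "\<lambda>A. \<Sum>i\<in>{i\<in>I. S i = A}. a i"]) auto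
qed

context
  fixes V :: "'x set"
  assumes V: "finite V"
begin

lemma finite_low_degree_sets: "finite {A. A \<subseteq> V \<and> card A \<le> D}"
  by (rule finite_subset[of _ "Set.Pow V"]) (use V in auto)

lemma low_degree_indicator:
  assumes "A \<subseteq> V" "card A \<le> D"
  shows "low_degree V D (\<lambda>X. a * of_bool (A \<subseteq> X))"
  using assms V by (intro low_degree_family[of V "{()}" "\<lambda>_. A" D _ "\<lambda>_. a"]) auto

lemma low_degree_const: "low_degree V D (\<lambda>X. a)"
  using low_degree_indicator[of "{}" D a] by simp

lemma low_degree_sum:
  assumes "\<And>i. i \<in> I \<Longrightarrow> low_degree V D (f i)"
  shows "low_degree V D (\<lambda>X. \<Sum>i\<in>I. f i X)"
proof -
  have "\<forall>i\<in>I. \<exists>r. \<forall>X\<subseteq>V. f i X = (\<Sum>A\<in>{A. A \<subseteq> V \<and> card A \<le> D}. r A * of_bool (A \<subseteq> X))"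
    using assms by (simp add: low_degree_def)
  from bchoice[OF this] obtain r
    where r: "\<forall>i\<in>I. \<forall>X\<subseteq>V. f i X = (\<Sum>A\<in>{A. A \<subseteq> V \<and> card A \<le> D}. r i A * of_bool (A \<subseteq> X))" ..
  have "(\<Sum>i\<in>I. f i X) = (\<Sum>A\<in>{A. A \<subseteq> V \<and> card A \<le> D}. (\<Sum>i\<in>I. r i A) * of_bool (A \<subseteq> X))" if "X \<subseteq> V" for X
  proof -
    have "(\<Sum>i\<in>I. f i X) = (\<Sum>i\<in>I. \<Sum>A\<in>{A. A \<subseteq> V \<and> card A \<le> D}. r i A * of_bool (A \<subseteq> X))"
    proof (intro sum.cong refl)
      fix i assume "i \<in> I"
      then show "f i X = (\<Sum>A\<in>{A. A \<subseteq> V \<and> card A \<le> D}. r i A * of_bool (A \<subseteq> X))"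
        using r that by simp
    qed
    then show ?thesis
      by (subst (asm) sum.swap) (simp only: sum_distrib_right)
  qed
  then show ?thesis
    unfolding low_degree_def by (intro exI[of _ "\<lambda>A. \<Sum>i\<in>I. r i A"]) auto
qed

text \<open>On the cube, the monomials of \<open>A\<close> and \<open>B\<close> multiply to the
  monomial of \<open>A \<union> B\<close>.\<close>

lemma low_degree_mult:
  assumes "low_degree V D f" "low_degree V D' g"
  shows "low_degree V (D + D') (\<lambda>X. f X * g X)"
proof -
  let ?K = "\<lambda>D. {A. A \<subseteq> V \<and> card A \<le> D}"
  obtain r where r: "\<And>X. X \<subseteq> V \<Longrightarrow> f X = (\<Sum>A\<in>?K D. r A * of_bool (A \<subseteq> X))"
    using assms(1) by (auto simp: low_degree_def)
  obtain r' where r': "\<And>X. X \<subseteq> V \<Longrightarrow> g X = (\<Sum>A\<in>?K D'. r' A * of_bool (A \<subseteq> X))"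
    using assms(2) by (auto simp: low_degree_def)
  show ?thesis
  proof (rule low_degree_family[of V "?K D \<times> ?K D'" "\<lambda>p. fst p \<union> snd p" _ _ "\<lambda>p. r (fst p) * r' (snd p)"])
    show "fst p \<union> snd p \<subseteq> V \<and> card (fst p \<union> snd p) \<le> D + D'" if "p \<in> ?K D \<times> ?K D'" for p
      using that card_Un_le[of "fst p" "snd p"] by auto
    fix X assume "X \<subseteq> V"
    then have "f X * g X = (\<Sum>A\<in>?K D. \<Sum>B\<in>?K D'. (r A * of_bool (A \<subseteq> X)) * (r' B * of_bool (B \<subseteq> X)))"
      by (simp only: r r' sum_product)
    also have "\<dots> = (\<Sum>p\<in>?K D \<times> ?K D'. r (fst p) * r' (snd p) * of_bool (fst p \<union> snd p \<subseteq> X))"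
      unfolding sum.cartesian_product by (intro sum.cong refl) (simp add: case_prod_unfold of_bool_def)
    finally show "f X * g X = (\<Sum>p\<in>?K D \<times> ?K D'. r (fst p) * r' (snd p) * of_bool (fst p \<union> snd p \<subseteq> X))" .
  qed (use V finite_low_degree_sets in auto)
qed

lemma low_degree_mono:
  assumes "low_degree V D f" "D \<le> D'"
  shows "low_degree V D' f"
  using low_degree_mult[OF assms(1) low_degree_const[of "D' - D" 1]] assms(2) by simp

definition low_degree_poly :: "nat \<Rightarrow> ('x set \<Rightarrow> 'a::comm_ring_1 poly) \<Rightarrow> bool"
  where "low_degree_poly D F \<longleftrightarrow> (\<forall>i. low_degree V D (\<lambda>X. coeff (F X) i))"

lemma low_degree_poly_mult:
  assumes "low_degree_poly D F" "low_degree_poly D' G"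
  shows "low_degree_poly (D + D') (\<lambda>X. F X * G X)"
  using assms unfolding low_degree_poly_def coeff_mult
  by (intro allI low_degree_sum low_degree_mult) auto

lemma low_degree_poly_power:
  assumes "low_degree_poly D F"
  shows "low_degree_poly (l * D) (\<lambda>X. F X ^ l)"
proof (induction l)
  case 0
  show ?case
    by (simp add: low_degree_poly_def low_degree_const)
next
  case (Suc l)
  from low_degree_poly_mult[OF assms this] show ?case
    by simp
qed

end

text \<open>Subtracting the constant coefficient leaves a multiple of the variable, whose power
  \<open>l\<close> contributes nothing below degree \<open>l\<close>. Coefficients up to
  \<open>L\<close> therefore need only the terms with \<open>l \<le> L\<close>, however large
  \<open>e\<close> is. For \<open>l > e\<close> the binomial coefficient is 0, which makes the
  truncation in \<open>e - l\<close> harmless.\<close>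

lemma coeff_power_expand:
  fixes p :: "'a::comm_ring_1 poly"
  assumes "i \<le> L"
  shows "coeff (p ^ e) i =
    (\<Sum>l\<le>L. of_nat (e choose l) * coeff p 0 ^ (e - l) * coeff ((p - [:coeff p 0:]) ^ l) i)"
proof -
  define p1 where "p1 = p - [:coeff p 0:]"
  have van: "coeff (p1 ^ l) i = 0" if "i < l" for l
  proof -
    have "[:0, 1:] dvd p1"
      by (simp add: p1_def flip: poly_eq_0_iff_dvd[of _ 0, simplified] poly_0_coeff_0)
    then have "[:0, 1:] ^ l dvd p1 ^ l"
      by (rule dvd_power_same)
    then obtain s where "p1 ^ l = monom 1 l * s"
      by (auto simp: dvd_def monom_altdef)
    then show ?thesis
      using that by (simp add: coeff_monom_mult)
  qed
  have "p ^ e = (p1 + [:coeff p 0:]) ^ e"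
    by (simp add: p1_def)
  also have "\<dots> = (\<Sum>l\<le>e. of_nat (e choose l) * p1 ^ l * [:coeff p 0:] ^ (e - l))"
    by (rule binomial_ring)
  also have "\<dots> = (\<Sum>l\<le>e. smult (of_nat (e choose l) * coeff p 0 ^ (e - l)) (p1 ^ l))"
    by (intro sum.cong refl) (simp add: poly_const_pow of_nat_poly mult_ac)
  finally have "coeff (p ^ e) i = (\<Sum>l\<le>e. of_nat (e choose l) * coeff p 0 ^ (e - l) * coeff (p1 ^ l) i)"
    by (simp add: coeff_sum)
  also have "\<dots> = (\<Sum>l\<le>max e L. of_nat (e choose l) * coeff p 0 ^ (e - l) * coeff (p1 ^ l) i)"
    by (intro sum.mono_neutral_left) (auto simp: binomial_eq_0)
  also have "\<dots> = (\<Sum>l\<le>L. of_nat (e choose l) * coeff p 0 ^ (e - l) * coeff (p1 ^ l) i)"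
    using assms van by (intro sum.mono_neutral_right) auto
  finally show ?thesis
    by (simp add: p1_def)
qed

text \<open>Union bound: agreeing with \<open>g m\<close> on \<open>S m\<close> fixes
  \<open>\<sigma>\<close> at more than \<open>T\<close> points, which leaves at most q^(card V - T -
  1) of the q^(card V) functions.\<close>

lemma exists_function_avoiding:
  fixes g :: "'m \<Rightarrow> 'x \<Rightarrow> nat"
  assumes V: "finite V" and K: "finite K" "card K < q ^ (T + 1)"
    and S: "\<And>m. m \<in> K \<Longrightarrow> S m \<subseteq> V \<and> T < card (S m)"
  shows "\<exists>\<sigma>. (\<forall>x. \<sigma> x < q) \<and> (\<forall>m\<in>K. \<exists>x\<in>S m. \<sigma> x \<noteq> g m x)"
proof (cases "K = {}")
  case True
  have "q > 0"
    using K by (cases q) auto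
  with True show ?thesis
    by (intro exI[of _ "\<lambda>_. 0"]) auto
next
  case False
  then obtain m0 where "m0 \<in> K" by auto
  then have cV: "T + 1 \<le> card V"
    using S[of m0] card_mono[of V "S m0"] V by auto
  have q: "q > 0"
    using K by (cases q) auto
  let ?F = "V \<rightarrow>\<^sub>E {..<q}"
  let ?bad = "\<lambda>m. {\<sigma>\<in>?F. \<forall>x\<in>S m. \<sigma> x = g m x}"
  have finF: "finite ?F"
    using V by (intro finite_PiE) auto
  have bad: "card (?bad m) \<le> q ^ (card V - (T + 1))" if m: "m \<in> K" for m
  proof -
    have "inj_on (\<lambda>\<sigma>. restrict \<sigma> (V - S m)) (?bad m)"
    proof (rule inj_onI)
      fix \<sigma> \<tau> assume *: "\<sigma> \<in> ?bad m" "\<tau> \<in> ?bad m" "restrict \<sigma> (V - S m) = restrict \<tau> (V - S m)"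
      show "\<sigma> = \<tau>"
      proof (rule PiE_ext[of _ V "\<lambda>_. {..<q}"])
        fix x assume x: "x \<in> V"
        show "\<sigma> x = \<tau> x"
        proof (cases "x \<in> S m")
          case True
          have "\<sigma> x = g m x" "\<tau> x = g m x"
            using *(1,2) True by simp_all
          then show ?thesis
            by simp
        next
          case False
          with x fun_cong[OF *(3), of x] show ?thesis
            by (simp only: restrict_apply Diff_iff) simp
        qed
      next
        show "\<sigma> \<in> ?F" "\<tau> \<in> ?F"
          using *(1,2) by simp_all
      qed
    qed
    moreover have "(\<lambda>\<sigma>. restrict \<sigma> (V - S m)) ` ?bad m \<subseteq> (V - S m) \<rightarrow>\<^sub>E {..<q}"
      by auto
    ultimately have "card (?bad m) \<le> card ((V - S m) \<rightarrow>\<^sub>E {..<q})"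
      using V by (intro card_inj_on_le finite_PiE) auto
    also have "\<dots> = q ^ (card V - card (S m))"
      using V S[OF m] by (simp add: card_PiE card_Diff_subset finite_subset[of "S m" V])
    also have "\<dots> \<le> q ^ (card V - (T + 1))"
      using S[OF m] q by (intro power_increasing) auto
    finally show ?thesis .
  qed
  have "card (\<Union>m\<in>K. ?bad m) \<le> (\<Sum>m\<in>K. card (?bad m))"
    using K by (intro card_UN_le)
  also have "\<dots> \<le> (\<Sum>m\<in>K. q ^ (card V - (T + 1)))"
    using bad by (rule sum_mono)
  also have "\<dots> = card K * q ^ (card V - (T + 1))"
    by simp
  also have "\<dots> < q ^ (T + 1) * q ^ (card V - (T + 1))"
    using K q by simp
  also have "\<dots> = q ^ card V"
    using cV by (simp only: le_add_diff_inverse flip: power_add)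
  also have "\<dots> = card ?F"
    using V by (simp add: card_PiE)
  finally have "\<not> ?F \<subseteq> (\<Union>m\<in>K. ?bad m)"
    using card_mono[of "\<Union>m\<in>K. ?bad m" ?F] K finF by (auto simp: not_le[symmetric])
  then obtain \<sigma> where "\<sigma> \<in> ?F" "\<sigma> \<notin> (\<Union>m\<in>K. ?bad m)"
    by (meson subsetI)
  then have \<sigma>: "\<sigma> \<in> ?F" "\<And>m. m \<in> K \<Longrightarrow> \<exists>x\<in>S m. \<sigma> x \<noteq> g m x"
    by simp_all
  show ?thesis
  proof (intro exI[of _ "\<lambda>x. if x \<in> V then \<sigma> x else 0"] conjI ballI allI)
    show "(if x \<in> V then \<sigma> x else 0) < q" for x
      using PiE_mem[OF \<sigma>(1), of x] q by simp
    show "\<exists>x\<in>S m. (if x \<in> V then \<sigma> x else 0) \<noteq> g m x" if m: "m \<in> K" for m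
    proof -
      obtain x where "x \<in> S m" "\<sigma> x \<noteq> g m x"
        using \<sigma>(2)[OF m] by blast
      moreover have "x \<in> V"
        using S[OF m] \<open>x \<in> S m\<close> by blast
      ultimately show ?thesis
        by (intro bexI[of _ x]) auto
    qed
  qed
qed

section \<open>Killing monomials and expanding the restricted circuit in \<tau>\<close>

context imm_restriction
begin

definition Om :: "(nat \<times> nat) set" where "Om = {..<k} \<times> {1..u}"

definition labels :: "(imm_var \<Rightarrow>\<^sub>0 nat) \<Rightarrow> (nat \<times> nat) set"
  where "labels m = (\<Union>e\<in>Poly_Mapping.keys m. lbl e)"

lemma finite_Om: "finite Om"
  by (simp add: Om_def)

lemma coef_reading_nonzero:
  assumes "reading (t, v', v)" "(coef \<sigma> \<beta> (t, v', v) :: 'a::comm_ring_1 poly) \<noteq> 0"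
  shows "cop v = \<sigma> (block t, lab v)" "(block t, lab v) \<in> Om"
proof -
  have *: "row v < w" "lab v \<in> W (row v)" "cop v = \<sigma> (block t, lab v)"
    using assms by (auto simp del: reading.simps split: if_splits)
  then show "cop v = \<sigma> (block t, lab v)"
    by simp
  show "(block t, lab v) \<in> Om"
    using * W_subset[OF *(1)] assms(1) by (auto simp: Om_def)
qed

lemma monom_eval_eq_0:
  assumes "e \<in> Poly_Mapping.keys m" "a e = 0"
  shows "monom_eval a m = 0"
proof -
  have "a e ^ Poly_Mapping.lookup m e = 0"
    using assms by (simp add: in_keys_iff power_0_left)
  then show ?thesis
    unfolding monom_eval_def using assms(1) by (intro prod_zero) auto
qed

lemma monom_eval_wt:
  "monom_eval (wt \<sigma> \<beta> X) m = (if labels m \<subseteq> X then monom_eval (coef \<sigma> \<beta>) m else 0 :: 'a::comm_ring_1 poly)"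
proof (cases "labels m \<subseteq> X")
  case True
  have "wt \<sigma> \<beta> X e = (coef \<sigma> \<beta> e :: 'a poly)" if "e \<in> Poly_Mapping.keys m" for e
  proof -
    have "lbl e \<subseteq> X"
      using that True unfolding labels_def by blast
    then show ?thesis
      by (simp add: wt_def)
  qed
  then have "monom_eval (wt \<sigma> \<beta> X) m = (monom_eval (coef \<sigma> \<beta>) m :: 'a poly)"
    unfolding monom_eval_def by (intro prod.cong refl) simp
  with True show ?thesis
    by simp
next
  case False
  then obtain e where "e \<in> Poly_Mapping.keys m" "\<not> lbl e \<subseteq> X"
    by (auto simp: labels_def)
  then have "monom_eval (wt \<sigma> \<beta> X) m = (0 :: 'a poly)"
    by (intro monom_eval_eq_0[of e]) (auto simp: wt_def)
  with False show ?thesis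
    by simp
qed

text \<open>Phrased through a reading edge that vanishes under \<open>\<sigma>\<close> for every
  selection \<open>\<beta>\<close>, so that one \<open>\<sigma>\<close> serves all selections.
  Monomials with a label outside \<open>Om\<close> must vanish too, since the survivors have to be
  monomials over \<open>Om\<close>.\<close>

definition kills :: "nat \<Rightarrow> (nat \<times> nat \<Rightarrow> nat) \<Rightarrow> (imm_var \<Rightarrow>\<^sub>0 nat) set \<Rightarrow> bool"
  where "kills T \<sigma> K \<longleftrightarrow> (\<forall>m\<in>K. T < card (labels m) \<or> \<not> labels m \<subseteq> Om \<longrightarrow>
    (\<exists>t v' v. (t, v', v) \<in> Poly_Mapping.keys m \<and> reading (t, v', v) \<and>
      (cop v \<noteq> \<sigma> (block t, lab v) \<or> (block t, lab v) \<notin> Om)))"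

lemma killsD:
  assumes "kills T \<sigma> K" "m \<in> K" "T < card (labels m) \<or> \<not> labels m \<subseteq> Om"
  shows "monom_eval (coef \<sigma> \<beta>) m = (0 :: 'a::comm_ring_1 poly)"
proof -
  obtain t v' v where e: "(t, v', v) \<in> Poly_Mapping.keys m" "reading (t, v', v)"
      "cop v \<noteq> \<sigma> (block t, lab v) \<or> (block t, lab v) \<notin> Om"
    using assms unfolding kills_def by blast
  then have "(coef \<sigma> \<beta> (t, v', v) :: 'a poly) = 0"
    using coef_reading_nonzero by blast
  with e(1) show ?thesis
    by (rule monom_eval_eq_0)
qed

text \<open>
  Two vertices with the same block and label have the same copy kept, so a monomial with label set \<open>L\<close>
  survives for a fraction of at most \<open>1 / q\<close> to the power \<open>card L\<close> of all \<open>\<sigma>\<close>.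
\<close>

lemma exists_kills:
  assumes K: "finite K" "card K < q ^ (T + 1)"
  shows "\<exists>\<sigma>. (\<forall>x. \<sigma> x < q) \<and> kills T \<sigma> K"
proof -
  define K' where "K' = {m\<in>K. labels m \<subseteq> Om \<and> T < card (labels m)}"
  define R where "R m x v \<longleftrightarrow> (\<exists>t v'. (t, v', v) \<in> Poly_Mapping.keys m \<and> reading (t, v', v) \<and> x = (block t, lab v))" for m :: "imm_var \<Rightarrow>\<^sub>0 nat" and x v
  \<comment> \<open>One edge of \<open>m\<close> is chosen for each label; where
    \<open>\<sigma>\<close> differs from its copy, this edge kills \<open>m\<close>.\<close>
  define g where "g m x = cop (SOME v. R m x v)" for m x
  have "card K' \<le> card K"
    using K(1) by (intro card_mono) (auto simp: K'_def)
  then have "\<exists>\<sigma>. (\<forall>x. \<sigma> x < q) \<and> (\<forall>m\<in>K'. \<exists>x\<in>labels m. \<sigma> x \<noteq> g m x)"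
    using K by (intro exists_function_avoiding[OF finite_Om]) (auto simp: K'_def)
  then obtain \<sigma> where \<sigma>: "\<And>x. \<sigma> x < q" "\<And>m. m \<in> K' \<Longrightarrow> \<exists>x\<in>labels m. \<sigma> x \<noteq> g m x"
    by blast
  have "kills T \<sigma> K"
    unfolding kills_def
  proof (intro ballI impI)
    fix m assume m: "m \<in> K" "T < card (labels m) \<or> \<not> labels m \<subseteq> Om"
    show "\<exists>t v' v. (t, v', v) \<in> Poly_Mapping.keys m \<and> reading (t, v', v) \<and>
      (cop v \<noteq> \<sigma> (block t, lab v) \<or> (block t, lab v) \<notin> Om)"
    proof (cases "labels m \<subseteq> Om")
      case True
      with m have "m \<in> K'"
        by (simp add: K'_def)
      then obtain x where x: "x \<in> labels m" "\<sigma> x \<noteq> g m x"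
        using \<sigma>(2) by blast
      from x(1) obtain t v' v where e: "(t, v', v) \<in> Poly_Mapping.keys m" "x \<in> lbl (t, v', v)"
        unfolding labels_def by (metis UN_E prod_cases3)
      from e(2) have "reading (t, v', v)" "x = (block t, lab v)"
        by (simp_all del: reading.simps split: if_splits)
      with e(1) have "\<exists>v. R m x v"
        unfolding R_def by blast
      then have "R m x (SOME v. R m x v)"
        by (rule someI_ex)
      then obtain t v' where "(t, v', SOME v. R m x v) \<in> Poly_Mapping.keys m"
          "reading (t, v', SOME v. R m x v)" "x = (block t, lab (SOME v. R m x v))"
        unfolding R_def[of m x "SOME v. R m x v"] by blast
      moreover have "cop (SOME v. R m x v) \<noteq> \<sigma> x"
        using x(2) by (simp add: g_def)
      ultimately show ?thesis
        by metis
    next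
      case False
      then obtain e where "e \<in> Poly_Mapping.keys m" "\<not> lbl e \<subseteq> Om"
        by (auto simp: labels_def)
      then show ?thesis
        by (cases e) (auto simp del: reading.simps split: if_splits)
    qed
  qed
  with \<sigma>(1) show ?thesis
    by blast
qed

text \<open>Only the \<open>k\<close> selecting edges of \<open>\<beta>\<close> carry \<tau>, each
  with exponent at most \<open>r\<close>. This is where the bound on the individual degree
  enters.\<close>

lemma degree_monom_eval_coef:
  assumes "\<And>v. Poly_Mapping.lookup m v \<le> r"
  shows "degree (monom_eval (coef \<sigma> \<beta>) m :: 'a::comm_ring_1 poly) \<le> k * r"
proof -
  define E0 where "E0 = (\<lambda>b. (Suc (b * (c + 2)), 1 :: nat, vert (\<beta> b) 0 0)) ` {..<k}"
  have deg: "degree (coef \<sigma> \<beta> e :: 'a poly) \<le> of_bool (e \<in> E0)" for e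
  proof (cases e)
    case (fields t v' v)
    show ?thesis
    proof (cases "\<not> reading (t, v', v) \<and> block t < k \<and> pos t = 0 \<and> t \<ge> 1 \<and> v' = 1 \<and> v = vert (\<beta> (block t)) 0 0")
      case True
      then have "t - 1 = block t * (c + 2)"
        using div_mult_mod_eq[of "t - 1" "c + 2"] by (simp add: block_def pos_def)
      then have "e \<in> E0"
        using True fields unfolding E0_def by (intro image_eqI[of _ _ "block t"]) auto
      then show ?thesis
        using True fields by simp
    next
      case False
      then have "degree (coef \<sigma> \<beta> e :: 'a poly) = 0"
        using fields by (auto simp del: reading.simps)
      then show ?thesis
        by simp
    qed
  qed
  have "degree (monom_eval (coef \<sigma> \<beta>) m :: 'a poly) \<le>
      sum (degree \<circ> (\<lambda>e. coef \<sigma> \<beta> e ^ Poly_Mapping.lookup m e :: 'a poly)) (Poly_Mapping.keys m)"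
    unfolding monom_eval_def by (rule degree_prod_sum_le) simp
  also have "\<dots> \<le> (\<Sum>e\<in>Poly_Mapping.keys m. if e \<in> E0 then r else 0)"
  proof (intro sum_mono)
    fix e
    have "degree (coef \<sigma> \<beta> e ^ Poly_Mapping.lookup m e :: 'a poly) \<le> degree (coef \<sigma> \<beta> e :: 'a poly) * Poly_Mapping.lookup m e"
      by (rule degree_power_le)
    also have "\<dots> \<le> of_bool (e \<in> E0) * r"
      using deg assms by (rule mult_le_mono)
    finally show "(degree \<circ> (\<lambda>e. coef \<sigma> \<beta> e ^ Poly_Mapping.lookup m e :: 'a poly)) e \<le> (if e \<in> E0 then r else 0)"
      by (cases "e \<in> E0") simp_all
  qed
  also have "\<dots> = card (Poly_Mapping.keys m \<inter> E0) * r"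
    by (subst sum.inter_restrict[symmetric]) simp_all
  also have "\<dots> \<le> card E0 * r"
    by (intro mult_right_mono card_mono) (auto simp: E0_def)
  also have "\<dots> \<le> k * r"
    using card_image_le[of "{..<k}" "\<lambda>b. (Suc (b * (c + 2)), 1::nat, vert (\<beta> b) 0 0)"]
    by (intro mult_right_mono) (auto simp: E0_def)
  finally show ?thesis .
qed

lemma degree_hom_eval_wt:
  assumes "individual_degree_le r f"
  shows "degree (hom_eval (\<lambda>c. [:c:]) (wt \<sigma> \<beta> X) f :: 'a::comm_ring_1 poly) \<le> k * r"
  unfolding hom_eval_def
proof (rule degree_sum_le)
  fix m assume m: "m \<in> Poly_Mapping.keys f"
  have "degree (monom_eval (wt \<sigma> \<beta> X) m :: 'a poly) \<le> k * r"
    using assms m degree_monom_eval_coef[of m r \<sigma> \<beta>, where ?'a = 'a]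
    by (auto simp: monom_eval_wt individual_degree_le_def)
  then show "degree ([:Poly_Mapping.lookup f m:] * monom_eval (wt \<sigma> \<beta> X) m) \<le> k * r"
    by (simp add: order.trans[OF degree_smult_le])
qed simp

lemma low_degree_poly_hom_eval_wt:
  assumes "kills T \<sigma> K" "Poly_Mapping.keys Q \<subseteq> K"
  shows "low_degree_poly Om T (\<lambda>X. hom_eval (\<lambda>c. [:c:]) (wt \<sigma> \<beta> X) Q :: 'a::comm_ring_1 poly)"
  unfolding low_degree_poly_def[OF finite_Om]
proof
  fix i
  let ?M = "\<lambda>m. monom_eval (coef \<sigma> \<beta>) m :: 'a poly"
  have eq: "coeff (hom_eval (\<lambda>c. [:c:]) (wt \<sigma> \<beta> X) Q) i =
      (\<Sum>m\<in>Poly_Mapping.keys Q. (Poly_Mapping.lookup Q m * coeff (?M m) i) * of_bool (labels m \<subseteq> X))" for X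
    unfolding hom_eval_def coeff_sum monom_eval_wt by (intro sum.cong refl) simp
  show "low_degree Om T (\<lambda>X. coeff (hom_eval (\<lambda>c. [:c:]) (wt \<sigma> \<beta> X) Q) i)"
    unfolding eq
  proof (rule low_degree_sum[OF finite_Om])
    fix m assume "m \<in> Poly_Mapping.keys Q"
    then have m: "m \<in> K"
      using assms(2) by blast
    show "low_degree Om T (\<lambda>X. (Poly_Mapping.lookup Q m * coeff (?M m) i) * of_bool (labels m \<subseteq> X))"
    proof (cases "T < card (labels m) \<or> \<not> labels m \<subseteq> Om")
      case True
      then have "?M m = 0"
        using killsD[OF assms(1) m] by blast
      then show ?thesis
        using low_degree_const[OF finite_Om, of T "0::'a"] by simp
    next
      case False
      then show ?thesis
        by (intro low_degree_indicator[OF finite_Om]) auto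
    qed
  qed
qed

text \<open>At \<tau> = 0 all selecting edges have weight 0, whatever \<open>\<beta>\<close>
  selects. Constant coefficients are therefore the same for all \<open>\<beta>\<close>, and the zero
  function serves as representative.\<close>

lemma coeff_0_hom_eval_wt:
  "coeff (hom_eval (\<lambda>c. [:c:]) (wt \<sigma> \<beta> X) Q) 0 = (mp_eval (\<lambda>e. poly (wt \<sigma> (\<lambda>_. 0) X e) 0) Q :: 'a::comm_ring_1)"
proof -
  have "poly (wt \<sigma> \<beta> X e) 0 = (poly (wt \<sigma> (\<lambda>_. 0) X e) 0 :: 'a)" for e
    by (cases e) (simp add: wt_def)
  then show ?thesis
    by (simp add: poly_hom_eval_const_poly flip: poly_0_coeff_0)
qed

lemma low_degree_poly_minus_const:
  assumes "low_degree_poly Om T F"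
  shows "low_degree_poly Om T (\<lambda>X. F X - [:coeff (F X) 0:])"
  unfolding low_degree_poly_def[OF finite_Om]
proof
  fix i
  show "low_degree Om T (\<lambda>X. coeff (F X - [:coeff (F X) 0:]) i)"
    using assms low_degree_const[OF finite_Om, of T 0]
    by (cases i) (auto simp: low_degree_poly_def[OF finite_Om])
qed

text \<open>The value at \<tau> = 1 is the sum of the coefficients of the restricted output, which
  vanish above degree \<open>k * r\<close>. Each power is expanded around its constant coefficient:
  the powers of that coefficient are shared by all \<open>\<beta>\<close>, and only \<open>H\<close>
  depends on \<open>\<beta>\<close>. The cofactor at \<open>l\<close> has degree at most
  \<open>l * T\<close> in the Boolean variables.\<close>

theorem restricted_representation:
  fixes f :: "(imm_var, 'a::comm_ring_1) mpoly"
  assumes kills: "kills T \<sigma> K"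
    and f: "f = (\<Sum>j\<in>J. of_nat (\<mu> j) * Q j ^ ex j)" "finite J"
    and keys: "\<And>j. j \<in> J \<Longrightarrow> Poly_Mapping.keys (Q j) \<subseteq> K"
    and deg: "individual_degree_le r f"
  shows "\<exists>H. \<forall>X\<subseteq>Om. mp_eval (ev \<sigma> \<beta> X) f = (\<Sum>a\<in>J \<times> {..k * r}.
      mp_eval (\<lambda>e. poly (wt \<sigma> (\<lambda>_. 0) X e) 0) (Q (fst a)) ^ (ex (fst a) - snd a) *
      (\<Sum>A\<in>{A. A \<subseteq> Om \<and> card A \<le> T * (k * r)}. H a A * of_bool (A \<subseteq> X)))"
proof -
  let ?L = "k * r"
  define P where "P j X = (hom_eval (\<lambda>c. [:c:]) (wt \<sigma> \<beta> X) (Q j) :: 'a poly)" for j X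
  define G where "G j X = (mp_eval (\<lambda>e. poly (wt \<sigma> (\<lambda>_. 0) X e) 0) (Q j) :: 'a)" for j X
  define N where "N j l X = of_nat (\<mu> j * (ex j choose l)) * (\<Sum>i\<le>?L. coeff ((P j X - [:coeff (P j X) 0:]) ^ l) i)" for j l X
  have G: "coeff (P j X) 0 = G j X" for j X
    unfolding P_def G_def by (rule coeff_0_hom_eval_wt)
  have low: "low_degree Om (T * ?L) (N j l)" if "j \<in> J" "l \<le> ?L" for j l
  proof -
    have "low_degree_poly Om (l * T) (\<lambda>X. (P j X - [:coeff (P j X) 0:]) ^ l)"
      unfolding P_def using keys[OF that(1)] kills
      by (intro low_degree_poly_power[OF finite_Om] low_degree_poly_minus_const low_degree_poly_hom_eval_wt)
    then have "low_degree Om (l * T) (\<lambda>X. \<Sum>i\<le>?L. coeff ((P j X - [:coeff (P j X) 0:]) ^ l) i)"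
      by (intro low_degree_sum[OF finite_Om]) (simp add: low_degree_poly_def[OF finite_Om])
    from low_degree_mult[OF finite_Om low_degree_const[OF finite_Om, of 0 "of_nat (\<mu> j * (ex j choose l))"] this]
    have "low_degree Om (l * T) (N j l)"
      unfolding N_def by simp
    then show ?thesis
    proof (rule low_degree_mono[OF finite_Om])
      show "l * T \<le> T * ?L"
        using that(2) by (simp add: mult.commute[of T] mult_le_mono)
    qed
  qed
  have "\<forall>a\<in>J \<times> {..?L}. \<exists>h. \<forall>X\<subseteq>Om. N (fst a) (snd a) X = (\<Sum>A\<in>{A. A \<subseteq> Om \<and> card A \<le> T * ?L}. h A * of_bool (A \<subseteq> X))"
    using low unfolding low_degree_def by auto
  from bchoice[OF this] obtain H where H: "\<forall>a\<in>J \<times> {..?L}. \<forall>X\<subseteq>Om.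
      N (fst a) (snd a) X = (\<Sum>A\<in>{A. A \<subseteq> Om \<and> card A \<le> T * ?L}. H a A * of_bool (A \<subseteq> X))" ..
  have main: "mp_eval (ev \<sigma> \<beta> X) f = (\<Sum>a\<in>J \<times> {..?L}. G (fst a) X ^ (ex (fst a) - snd a) * N (fst a) (snd a) X)" for X
  proof -
    let ?F = "hom_eval (\<lambda>c. [:c:]) (wt \<sigma> \<beta> X) f :: 'a poly"
    have F: "?F = (\<Sum>j\<in>J. of_nat (\<mu> j) * P j X ^ ex j)"
    proof -
      have "hom_eval (\<lambda>c. [:c:]) (wt \<sigma> \<beta> X) (of_nat y) = (of_nat y :: 'a poly)" for y
        by (induction y) (simp_all add: const_poly.hom_eval_add)
      then show ?thesis
        by (simp add: f(1) P_def const_poly.hom_eval_sum const_poly.hom_eval_mult const_poly.hom_eval_power)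
    qed
    have "mp_eval (ev \<sigma> \<beta> X) f = poly ?F 1"
      by (simp add: poly_hom_eval_const_poly ev_def[abs_def])
    also have "\<dots> = (\<Sum>i\<le>degree ?F. coeff ?F i)"
      by (simp add: poly_altdef)
    also have "\<dots> = (\<Sum>i\<le>?L. coeff ?F i)"
      using degree_hom_eval_wt[OF deg, of \<sigma> \<beta> X] by (intro sum.mono_neutral_left) (auto simp: coeff_eq_0)
    also have "\<dots> = (\<Sum>i\<le>?L. \<Sum>j\<in>J. of_nat (\<mu> j) * coeff (P j X ^ ex j) i)"
      by (simp add: F coeff_sum of_nat_poly)
    also have "\<dots> = (\<Sum>i\<le>?L. \<Sum>j\<in>J. \<Sum>l\<le>?L. of_nat (\<mu> j) *
        (of_nat (ex j choose l) * G j X ^ (ex j - l) * coeff ((P j X - [:coeff (P j X) 0:]) ^ l) i))"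
      by (intro sum.cong refl) (simp add: coeff_power_expand[of _ ?L] G sum_distrib_left)
    also have "\<dots> = (\<Sum>j\<in>J. \<Sum>l\<le>?L. \<Sum>i\<le>?L. of_nat (\<mu> j) *
        (of_nat (ex j choose l) * G j X ^ (ex j - l) * coeff ((P j X - [:coeff (P j X) 0:]) ^ l) i))"
      by (rule trans[OF sum.swap], rule sum.cong[OF refl], rule sum.swap)
    also have "\<dots> = (\<Sum>j\<in>J. \<Sum>l\<le>?L. G j X ^ (ex j - l) * N j l X)"
      unfolding N_def sum_distrib_left by (intro sum.cong refl) (simp add: mult_ac)
    finally show ?thesis
      by (simp add: sum.cartesian_product case_prod_unfold)
  qed
  show ?thesis
  proof (intro exI[of _ H] allI impI)
    fix X assume X: "X \<subseteq> Om"
    show "mp_eval (ev \<sigma> \<beta> X) f = (\<Sum>a\<in>J \<times> {..?L}.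
      mp_eval (\<lambda>e. poly (wt \<sigma> (\<lambda>_. 0) X e) 0) (Q (fst a)) ^ (ex (fst a) - snd a) *
      (\<Sum>A\<in>{A. A \<subseteq> Om \<and> card A \<le> T * ?L}. H a A * of_bool (A \<subseteq> X)))"
      unfolding main G_def
    proof (intro sum.cong refl)
      fix a assume "a \<in> J \<times> {..?L}"
      then have "N (fst a) (snd a) X = (\<Sum>A\<in>{A. A \<subseteq> Om \<and> card A \<le> T * ?L}. H a A * of_bool (A \<subseteq> X))"
        using H X by blast
      then show "mp_eval (\<lambda>e. poly (wt \<sigma> (\<lambda>_. 0) X e) 0) (Q (fst a)) ^ (ex (fst a) - snd a) * N (fst a) (snd a) X =
          mp_eval (\<lambda>e. poly (wt \<sigma> (\<lambda>_. 0) X e) 0) (Q (fst a)) ^ (ex (fst a) - snd a) *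
          (\<Sum>A\<in>{A. A \<subseteq> Om \<and> card A \<le> T * ?L}. H a A * of_bool (A \<subseteq> X))"
        by (simp only:)
    qed
  qed
qed

end

section \<open>The span of the shifted restrictions\<close>

lemma card_sections:
  fixes k :: nat
  assumes "finite U" "\<And>b. b < k \<Longrightarrow> SS b \<subseteq> Set.Pow U"
  shows "card {E. E \<subseteq> {..<k} \<times> U \<and> (\<forall>b<k. E `` {b} \<in> SS b)} = (\<Prod>b<k. card (SS b))"
proof -
  have fin: "finite (SS b)" if "b < k" for b
    using assms that by (meson finite_Pow_iff finite_subset)
  have "bij_betw (\<lambda>f. Sigma {..<k} f) (Pi\<^sub>E {..<k} SS) {E. E \<subseteq> {..<k} \<times> U \<and> (\<forall>b<k. E `` {b} \<in> SS b)}"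
  proof (rule bij_betw_byWitness[where f' = "\<lambda>E. restrict (\<lambda>b. E `` {b}) {..<k}"])
    show "\<forall>f\<in>Pi\<^sub>E {..<k} SS. restrict (\<lambda>b. Sigma {..<k} f `` {b}) {..<k} = f"
      by (auto simp: PiE_iff extensional_def fun_eq_iff)
    show "(\<lambda>f. Sigma {..<k} f) ` Pi\<^sub>E {..<k} SS \<subseteq> {E. E \<subseteq> {..<k} \<times> U \<and> (\<forall>b<k. E `` {b} \<in> SS b)}"
    proof (intro image_subsetI CollectI conjI allI impI)
      fix f assume f: "f \<in> Pi\<^sub>E {..<k} SS"
      show "Sigma {..<k} f \<subseteq> {..<k} \<times> U"
        using f assms(2) by (fastforce simp: PiE_iff)
      fix b assume b: "b < k"
      then have "Sigma {..<k} f `` {b} = f b"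
        by auto
      then show "Sigma {..<k} f `` {b} \<in> SS b"
        using f b by (simp add: PiE_iff)
    qed
  qed (fastforce simp: restrict_def split: if_splits)+
  then have "card {E. E \<subseteq> {..<k} \<times> U \<and> (\<forall>b<k. E `` {b} \<in> SS b)} = card (Pi\<^sub>E {..<k} SS)"
    by (simp add: bij_betw_same_card)
  then show ?thesis
    using card_PiE[of "{..<k}" SS] by simp
qed

lemma sum_Pow_minus_one_card:
  assumes "finite D"
  shows "(\<Sum>B\<in>Set.Pow D. (- 1) ^ card B) = (of_bool (D = {}) :: 'a::comm_ring_1)"
  using prod_diff_conv_sum[OF assms, of "\<lambda>_. 1 :: 'a" "\<lambda>_. 1"] assms
  by (cases "D = {}") (simp_all add: power_0_left)

text \<open>The sets \<open>T\<close> between \<open>B\<close> and \<open>S\<close> correspond to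
  the subsets of \<open>S - B\<close>, whose alternating sum vanishes unless \<open>S - B\<close> is
  empty.\<close>

lemma moebius_superset_indicator:
  assumes "finite S"
  shows "(\<Sum>T\<in>Set.Pow S. (- 1) ^ card (S - T) * of_bool (B \<subseteq> T)) = (of_bool (B = S) :: 'a::comm_ring_1)"
proof (cases "B \<subseteq> S")
  case True
  have "(\<Sum>T\<in>Set.Pow S. (- 1) ^ card (S - T) * of_bool (B \<subseteq> T)) =
      (\<Sum>T\<in>{T\<in>Set.Pow S. B \<subseteq> T}. (- 1) ^ card (S - T) :: 'a)"
    using assms by (simp add: sum.inter_filter flip: sum.inter_filter) (intro sum.cong; auto)
  also have "\<dots> = (\<Sum>R\<in>Set.Pow (S - B). (- 1) ^ card R)"
    using True by (intro sum.reindex_bij_witness[of _ "\<lambda>R. S - R" "\<lambda>T. S - T"]) auto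
  also have "\<dots> = of_bool (B = S)"
    using assms True by (subst sum_Pow_minus_one_card) auto
  finally show ?thesis .
next
  case False
  then have "(- 1) ^ card (S - T) * of_bool (B \<subseteq> T) = (0::'a)" if "T \<in> Set.Pow S" for T
    using that by auto
  with False show ?thesis
    by (auto intro!: sum.neutral)
qed

lemma card_subsets_between:
  assumes "finite X" "C \<subseteq> X" "card C \<le> m"
  shows "card {A. C \<subseteq> A \<and> A \<subseteq> X \<and> card A = m} = (card X - card C) choose (m - card C)"
proof -
  have fin: "finite A" if "A \<subseteq> X" for A
    using that assms(1) finite_subset by blast
  have "bij_betw (\<lambda>A. A - C) {A. C \<subseteq> A \<and> A \<subseteq> X \<and> card A = m}
      {E. E \<subseteq> X - C \<and> card E = m - card C}"
  proof (rule bij_betw_byWitness[where f' = "\<lambda>E. E \<union> C"])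
    show "(\<lambda>A. A - C) ` {A. C \<subseteq> A \<and> A \<subseteq> X \<and> card A = m} \<subseteq> {E. E \<subseteq> X - C \<and> card E = m - card C}"
      using fin assms by (auto simp: card_Diff_subset)
    have "card (E \<union> C) = m" if "E \<subseteq> X - C" "card E = m - card C" for E
      using that fin[of E] fin[of C] assms by (subst card_Un_disjoint) auto
    then show "(\<lambda>E. E \<union> C) ` {E. E \<subseteq> X - C \<and> card E = m - card C} \<subseteq> {A. C \<subseteq> A \<and> A \<subseteq> X \<and> card A = m}"
      using assms by auto
  qed auto
  then have "card {A. C \<subseteq> A \<and> A \<subseteq> X \<and> card A = m} = card {E. E \<subseteq> X - C \<and> card E = m - card C}"
    by (rule bij_betw_same_card)
  also have "\<dots> = (card X - card C) choose (m - card C)"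
    using assms fin by (subst n_subsets) (auto simp: card_Diff_subset)
  finally show ?thesis .
qed

section \<open>Linear algebra in the space of functions\<close>

abbreviation (input) fun_scale :: "'a \<Rightarrow> ('x \<Rightarrow> 'a) \<Rightarrow> 'x \<Rightarrow> 'a::field"
  where "fun_scale c f \<equiv> (\<lambda>x. c * f x)"

interpretation fun_space: vector_space fun_scale
  by standard (auto simp: fun_eq_iff algebra_simps)

lemma fun_space_sum_apply: "(\<Sum>i\<in>I. f i) x = (\<Sum>i\<in>I. (f i x :: 'a::comm_monoid_add))"
  by (induction I rule: infinite_finite_induct) auto

lemma fun_space_span_sum_scale:
  assumes "\<And>i. i \<in> I \<Longrightarrow> f i \<in> fun_space.span B"
    and "\<And>x. g x = (\<Sum>i\<in>I. a i * f i x)"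
  shows "g \<in> fun_space.span B"
proof -
  have "g = (\<Sum>i\<in>I. fun_scale (a i) (f i))"
    using assms(2) by (simp add: fun_eq_iff fun_space_sum_apply)
  also have "\<dots> \<in> fun_space.span B"
    using assms(1) by (intro fun_space.span_sum fun_space.span_scale)
  finally show ?thesis .
qed

text \<open>Indicators of distinct points are linearly independent, so a finite set whose span
  contains them is at least as large.\<close>

lemma card_le_of_indicators_in_span:
  assumes "finite Y" "finite B"
    and "\<And>S. S \<in> Y \<Longrightarrow> (\<lambda>X. of_bool (X = S) :: 'a::field) \<in> fun_space.span B"
  shows "card Y \<le> card B"
proof -
  let ?d = "\<lambda>S X. of_bool (X = S) :: 'a"
  have inj: "inj_on ?d Y"
  proof (rule inj_onI)
    fix S T assume "?d S = ?d T"
    then have "?d S S = ?d T S"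
      by (rule fun_cong)
    then show "S = T"
      by (simp split: if_splits)
  qed
  have "fun_space.independent (?d ` Y)"
  proof (rule fun_space.independent_if_scalars_zero)
    fix f g assume *: "(\<Sum>x\<in>?d ` Y. fun_scale (f x) x) = 0" and "g \<in> ?d ` Y"
    then obtain S where S: "S \<in> Y" "g = ?d S" by auto
    have "0 = (\<Sum>x\<in>?d ` Y. fun_scale (f x) x) S"
      by (simp add: *)
    also have "\<dots> = (\<Sum>T\<in>Y. f (?d T) * of_bool (S = T))"
      using inj by (simp add: fun_space_sum_apply sum.reindex)
    also have "\<dots> = f g"
      using S assms(1) by simp
    finally show "f g = 0" ..
  qed (use assms in auto)
  then have "card (?d ` Y) \<le> card B"
    using fun_space.independent_span_bound[of B "?d ` Y"] assms by auto
  then show ?thesis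
    using inj by (simp add: card_image)
qed

lemma subset_iff_sections:
  fixes k :: nat
  assumes "E \<subseteq> {..<k} \<times> U"
  shows "E \<subseteq> X \<longleftrightarrow> (\<forall>b<k. E `` {b} \<subseteq> X `` {b})"
  using assms by blast

text \<open>\<open>U\<close> holds the variables of one block, and a subset of
  \<open>{..<k} \<times> U\<close> is a monomial in the variables of all blocks.
  \<open>field_type\<close> names the field of which \<open>choose_nonzero\<close> speaks; that
  condition lets elementary symmetric polynomials of degree \<open>c\<close> generate those of
  degree up to \<open>2 * c - 1\<close>.\<close>

locale cube_rank =
  fixes U :: "'b set" and h k c w :: nat and W :: "nat \<Rightarrow> 'b set" and field_type :: "'a::field itself"
  assumes finite_U: "finite U" and card_U: "card U = 2 * h"
    and W_subset: "\<And>i. i < w \<Longrightarrow> W i \<subseteq> U"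
    and c_le_h: "c \<le> h"
    and choose_nonzero: "\<And>i. c \<le> i \<Longrightarrow> i < 2 * c \<Longrightarrow> of_nat (i choose c) \<noteq> (0::'a)"
begin

definition Om :: "(nat \<times> 'b) set"
  where "Om = {..<k} \<times> U"

definition middle :: "(nat \<times> 'b) set set"
  where "middle = {S. S \<subseteq> Om \<and> (\<forall>b<k. card (S `` {b}) = h)}"

definition lower :: "(nat \<times> 'b) set set"
  where "lower = {A. A \<subseteq> Om \<and> (\<forall>b<k. card (A `` {b}) = h - c)}"

definition choices :: "(nat \<Rightarrow> nat) \<Rightarrow> (nat \<times> 'b) set"
  where "choices \<beta> = Sigma {..<k} (\<lambda>b. W (\<beta> b))"

definition val :: "(nat \<Rightarrow> nat) \<Rightarrow> (nat \<times> 'b) set \<Rightarrow> 'a"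
  where "val \<beta> X = (\<Prod>b<k. of_nat (card (X `` {b} \<inter> W (\<beta> b)) choose c))"

text \<open>Inclusion-exclusion drops \<open>W i\<close> from a block of \<open>S\<close> and adds
  some of \<open>W i - S\<close>. The bias guarantees that at most \<open>h - c\<close> variables of
  the block remain.\<close>

definition covered :: "(nat \<times> 'b) set set"
  where "covered = {S\<in>middle. \<forall>b<k. \<exists>i<w. card (W i - S `` {b}) + c \<le> card (S `` {b} \<inter> W i)}"

text \<open>
  The coefficient at the monomial \<open>S\<close> of the multilinear polynomial agreeing with \<open>f\<close>, by Moebius inversion.
\<close>

definition top_coeff :: "((nat \<times> 'b) set \<Rightarrow> 'a) \<Rightarrow> (nat \<times> 'b) set \<Rightarrow> 'a"
  where "top_coeff f S = of_bool (S \<in> middle) * (\<Sum>T\<in>Set.Pow S. (- 1) ^ card (S - T) * f T)"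

text \<open>
  The \<open>middle\<close> part of the monomial \<open>C\<close> times the elementary symmetric polynomials, in each block,
  of the variables of \<open>choices \<beta>\<close> outside \<open>C\<close>.
\<close>

definition step :: "(nat \<Rightarrow> nat) \<Rightarrow> (nat \<times> 'b) set \<Rightarrow> (nat \<times> 'b) set \<Rightarrow> 'a"
  where "step \<beta> C S = of_bool (S \<in> middle \<and> C \<subseteq> S \<and> S - C \<subseteq> choices \<beta>)"

lemma finite_Om: "finite Om"
  using finite_U by (simp add: Om_def)

lemma finite_subset_Om: "X \<subseteq> Om \<Longrightarrow> finite X"
  using finite_Om finite_subset by blast

lemma finite_section: "X \<subseteq> Om \<Longrightarrow> finite (X `` {b})"
  by (auto intro!: finite_Image finite_subset_Om)

lemma section_subset: "X \<subseteq> Om \<Longrightarrow> X `` {b} \<subseteq> U"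
  by (auto simp: Om_def)

lemma middleD: "S \<in> middle \<Longrightarrow> S \<subseteq> Om" "S \<in> middle \<Longrightarrow> b < k \<Longrightarrow> card (S `` {b}) = h"
  by (auto simp: middle_def)

lemma lowerD: "A \<in> lower \<Longrightarrow> A \<subseteq> Om" "A \<in> lower \<Longrightarrow> b < k \<Longrightarrow> card (A `` {b}) = h - c"
  by (auto simp: lower_def)

lemma choices_section: "b < k \<Longrightarrow> choices \<beta> `` {b} = W (\<beta> b)"
  by (auto simp: choices_def)

lemma choices_subset: "(\<And>b. b < k \<Longrightarrow> \<beta> b < w) \<Longrightarrow> choices \<beta> \<subseteq> Om"
  using W_subset by (fastforce simp: choices_def Om_def)

lemma finite_middle: "finite middle"
  by (rule finite_subset[of _ "Set.Pow Om"]) (auto simp: middle_def finite_Om)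

lemma card_covered:
  "card covered = card {s. s \<subseteq> U \<and> card s = h \<and> (\<exists>i<w. card (W i - s) + c \<le> card (s \<inter> W i))} ^ k"
proof -
  let ?A = "{s. s \<subseteq> U \<and> card s = h \<and> (\<exists>i<w. card (W i - s) + c \<le> card (s \<inter> W i))}"
  have "covered = {E. E \<subseteq> {..<k} \<times> U \<and> (\<forall>b<k. E `` {b} \<in> ?A)}"
    using section_subset by (auto simp: covered_def middle_def Om_def)
  then show ?thesis
    using card_sections[of U k "\<lambda>_. ?A"] finite_U by auto
qed

lemma finite_picks:
  assumes "\<And>b. b < k \<Longrightarrow> \<beta> b < w"
  shows "finite {E. E \<subseteq> choices \<beta> \<and> (\<forall>b<k. card (E `` {b}) = c)}"
proof -
  have "choices \<beta> \<subseteq> Om"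
    using assms by (rule choices_subset)
  then show ?thesis
    by (intro finite_subset[OF _ finite_Pow_iff[THEN iffD2, OF finite_Om]]) auto
qed

text \<open>Each binomial coefficient counts subsets of size \<open>c\<close>, so
  \<open>val \<beta>\<close> is a product over the blocks of elementary symmetric polynomials, here
  written out in monomials.\<close>

lemma val_eq_sum:
  assumes X: "X \<subseteq> Om" and \<beta>: "\<And>b. b < k \<Longrightarrow> \<beta> b < w"
  shows "val \<beta> X = (\<Sum>E\<in>{E. E \<subseteq> choices \<beta> \<and> (\<forall>b<k. card (E `` {b}) = c)}. of_bool (E \<subseteq> X))"
proof -
  let ?EE = "{E. E \<subseteq> choices \<beta> \<and> (\<forall>b<k. card (E `` {b}) = c)}"
  have fin: "finite ?EE"
    using \<beta> by (rule finite_picks)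
  have eq: "{E\<in>?EE. E \<subseteq> X} =
      {E. E \<subseteq> {..<k} \<times> U \<and> (\<forall>b<k. E `` {b} \<in> {e. e \<subseteq> X `` {b} \<inter> W (\<beta> b) \<and> card e = c})}"
    (is "?L = ?R")
  proof (intro set_eqI iffI)
    fix E assume "E \<in> ?L"
    moreover have "choices \<beta> \<subseteq> Om"
      using \<beta> by (rule choices_subset)
    ultimately show "E \<in> ?R"
      by (auto simp: choices_def Om_def)
  next
    fix E assume E: "E \<in> ?R"
    then have "E \<subseteq> X" "E \<subseteq> choices \<beta>"
      using subset_iff_sections[of E k U] choices_section by auto
    with E show "E \<in> ?L"
      by auto
  qed
  have sub: "{e. e \<subseteq> X `` {b} \<inter> W (\<beta> b) \<and> card e = c} \<subseteq> Set.Pow U" for b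
    using section_subset[OF X] by auto
  have "(\<Sum>E\<in>?EE. of_bool (E \<subseteq> X)) = (of_nat (card {E\<in>?EE. E \<subseteq> X}) :: 'a)"
    using fin by (simp add: Int_def)
  also have "card {E\<in>?EE. E \<subseteq> X} = (\<Prod>b<k. card {e. e \<subseteq> X `` {b} \<inter> W (\<beta> b) \<and> card e = c})"
    unfolding eq by (rule card_sections[OF finite_U sub])
  also have "\<dots> = (\<Prod>b<k. card (X `` {b} \<inter> W (\<beta> b)) choose c)"
    using finite_section[OF X] by (intro prod.cong refl n_subsets) auto
  finally show ?thesis
    by (simp add: val_def)
qed

lemma sections_eqI: "X \<subseteq> Om \<Longrightarrow> Y \<subseteq> Om \<Longrightarrow> (\<And>b. b < k \<Longrightarrow> X `` {b} = Y `` {b}) \<Longrightarrow> X = Y"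
  unfolding Om_def by blast

text \<open>A monomial of \<open>val \<beta>\<close> has \<open>c\<close> variables in each block
  and \<open>A\<close> has \<open>h - c\<close>. Their union reaches \<open>h\<close> only if they
  are disjoint, so in this degree the reduction on the cube changes nothing.\<close>

lemma top_coeff_val_times:
  assumes \<beta>: "\<And>b. b < k \<Longrightarrow> \<beta> b < w" and A: "A \<in> lower"
  shows "top_coeff (\<lambda>X. val \<beta> X * of_bool (A \<subseteq> X)) S = step \<beta> A S"
proof (cases "S \<in> middle")
  case True
  let ?EE = "{E. E \<subseteq> choices \<beta> \<and> (\<forall>b<k. card (E `` {b}) = c)}"
  have fin: "finite ?EE"
    using \<beta> by (rule finite_picks)
  have S: "S \<subseteq> Om" "finite S"
    using True middleD finite_subset_Om by auto
  have "top_coeff (\<lambda>X. val \<beta> X * of_bool (A \<subseteq> X)) S =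
      (\<Sum>T\<in>Set.Pow S. \<Sum>E\<in>?EE. (- 1) ^ card (S - T) * of_bool (E \<union> A \<subseteq> T))"
    unfolding top_coeff_def using True S
    by (auto simp: val_eq_sum[OF _ \<beta>] sum_distrib_left sum_distrib_right intro!: sum.cong)
  also have "\<dots> = (\<Sum>E\<in>?EE. \<Sum>T\<in>Set.Pow S. (- 1) ^ card (S - T) * of_bool (E \<union> A \<subseteq> T))"
    by (rule sum.swap)
  also have "\<dots> = (\<Sum>E\<in>?EE. of_bool (E \<union> A = S))"
    by (simp only: moebius_superset_indicator[OF S(2)])
  also have "\<dots> = (\<Sum>E\<in>?EE. of_bool (E = S - A) * of_bool (A \<subseteq> S))"
  proof (intro sum.cong refl)
    fix E assume E: "E \<in> ?EE"
    have "E = S - A" if *: "E \<union> A = S"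
    proof -
      have Om: "E \<subseteq> Om" "A \<subseteq> Om"
        using * S by auto
      have "E `` {b} \<inter> A `` {b} = {}" if b: "b < k" for b
      proof -
        have "card (E `` {b} \<union> A `` {b}) = card (E `` {b}) + card (A `` {b})"
          using * b E lowerD(2)[OF A b] middleD(2)[OF True b] c_le_h by (auto simp: Un_Image)
        then have "card (E `` {b} \<inter> A `` {b}) = 0"
          using card_Un_Int[OF finite_section[OF Om(1), of b] finite_section[OF Om(2), of b]] by linarith
        then show ?thesis
          using finite_section[OF Om(1), of b] by simp
      qed
      then have "E \<inter> A = {}"
        using Om by (force simp: Om_def)
      with * show ?thesis
        by auto
    qed
    then show "of_bool (E \<union> A = S) = (of_bool (E = S - A) * of_bool (A \<subseteq> S) :: 'a)"
      by auto
  qed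
  also have "\<dots> = (\<Sum>E\<in>?EE. if E = S - A then of_bool (A \<subseteq> S) else 0)"
    by (intro sum.cong refl) simp
  also have "\<dots> = (if S - A \<in> ?EE then of_bool (A \<subseteq> S) else 0)"
    by (rule sum.delta[OF fin])
  also have "\<dots> = of_bool (A \<subseteq> S \<and> S - A \<in> ?EE)"
    by (simp only: of_bool_def) metis
  also have "\<dots> = of_bool (A \<subseteq> S \<and> S - A \<subseteq> choices \<beta>)"
  proof -
    have "card ((S - A) `` {b}) = c" if "A \<subseteq> S" "b < k" for b
    proof -
      have "(S - A) `` {b} = S `` {b} - A `` {b}"
        by auto
      moreover have "A `` {b} \<subseteq> S `` {b}"
        using that by auto
      ultimately have "card ((S - A) `` {b}) = card (S `` {b}) - card (A `` {b})"
        using finite_section[OF lowerD(1)[OF A], of b] by (simp only: card_Diff_subset)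
      then show ?thesis
        using lowerD(2)[OF A that(2)] middleD(2)[OF True that(2)] c_le_h by simp
    qed
    then show ?thesis
      by auto
  qed
  also have "\<dots> = step \<beta> A S"
    using True by (simp add: step_def)
  finally show ?thesis .
qed (simp add: top_coeff_def step_def)

text \<open>If \<open>X\<close> in \<open>middle\<close> differs from \<open>S\<close> only inside
  \<open>choices \<beta>\<close>, the sum runs with signs over the subsets of
  \<open>X \<inter> choices \<beta> - S\<close>. It vanishes unless \<open>X \<subseteq> S\<close>,
  and equal sizes of the sections then force \<open>X = S\<close>.\<close>

lemma indicator_eq_sum_step:
  assumes \<beta>: "\<And>b. b < k \<Longrightarrow> \<beta> b < w" and S: "S \<in> middle"
  shows "of_bool (X = S) = (\<Sum>B\<in>Set.Pow (choices \<beta> - S). (- 1) ^ card B * step \<beta> (S - choices \<beta> \<union> B) X)"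
proof (cases "X \<in> middle \<and> S - choices \<beta> \<subseteq> X \<and> X - choices \<beta> \<subseteq> S")
  case True
  have fin: "finite (choices \<beta> - S)"
  proof (rule finite_subset_Om)
    show "choices \<beta> - S \<subseteq> Om"
      using choices_subset[where \<beta> = \<beta>, OF \<beta>] by blast
  qed
  have "(\<Sum>B\<in>Set.Pow (choices \<beta> - S). (- 1) ^ card B * step \<beta> (S - choices \<beta> \<union> B) X)
     = (\<Sum>B\<in>Set.Pow (choices \<beta> - S). if B \<in> Set.Pow (X \<inter> choices \<beta> - S) then (- 1) ^ card B else 0)"
    using True by (intro sum.cong refl) (auto simp: step_def)
  also have "\<dots> = (\<Sum>B\<in>Set.Pow (X \<inter> choices \<beta> - S). (- 1) ^ card B)"
    using fin by (subst sum.inter_restrict[symmetric]) (auto intro!: sum.cong)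
  also have "\<dots> = of_bool (X \<inter> choices \<beta> - S = {})"
    using fin by (intro sum_Pow_minus_one_card) (auto intro: finite_subset[OF _ fin])
  also have "X \<inter> choices \<beta> - S = {} \<longleftrightarrow> X \<subseteq> S"
    using True by auto
  also have "X \<subseteq> S \<longleftrightarrow> X = S"
  proof
    assume XS: "X \<subseteq> S"
    show "X = S"
    proof (rule sections_eqI)
      show "X \<subseteq> Om" "S \<subseteq> Om"
        using True S middleD by auto
      fix b assume b: "b < k"
      show "X `` {b} = S `` {b}"
      proof (rule card_subset_eq)
        show "finite (S `` {b})"
          using S middleD(1) finite_section by blast
        show "X `` {b} \<subseteq> S `` {b}"
          using XS by auto
        show "card (X `` {b}) = card (S `` {b})"
          using True S b by (simp add: middleD(2))
      qed
    qed
  qed simp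
  finally show ?thesis ..
next
  case False
  then have "step \<beta> (S - choices \<beta> \<union> B) X = 0" if "B \<subseteq> choices \<beta> - S" for B
    using that by (auto simp: step_def)
  moreover have "X \<noteq> S"
    using False S by auto
  ultimately show ?thesis
    by simp
qed

text \<open>Let i be \<open>h\<close> minus the number of variables of \<open>C\<close> in a block.
  A set of i further variables splits in (i choose c) ways into \<open>c\<close> of them and a rest
  that extends \<open>C\<close> to size \<open>h - c\<close>. Summing over these extensions gives
  the elementary symmetric polynomial of degree i with this factor.\<close>

lemma step_eq_sum_lower:
  assumes \<beta>: "\<And>b. b < k \<Longrightarrow> \<beta> b < w" and C: "C \<subseteq> Om"
    and size: "\<And>b. b < k \<Longrightarrow> card (C `` {b}) + c \<le> h"
  shows "of_nat (\<Prod>b<k. (h - card (C `` {b})) choose c) * step \<beta> C X =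
    (\<Sum>A\<in>lower. of_bool (C \<subseteq> A \<and> A - C \<subseteq> choices \<beta>) * step \<beta> A X)"
proof (cases "X \<in> middle \<and> C \<subseteq> X \<and> X - C \<subseteq> choices \<beta>")
  case True
  have finl: "finite lower"
    by (rule finite_subset[of _ "Set.Pow Om"]) (auto simp: lower_def finite_Om)
  have X: "X \<subseteq> Om"
    using True middleD by auto
  have eq: "{A\<in>lower. C \<subseteq> A \<and> A \<subseteq> X} =
    {A. A \<subseteq> {..<k} \<times> U \<and> (\<forall>b<k. A `` {b} \<in> {a. C `` {b} \<subseteq> a \<and> a \<subseteq> X `` {b} \<and> card a = h - c})}"
    (is "?L = ?R")
  proof (intro set_eqI iffI)
    fix A assume "A \<in> ?L"
    then show "A \<in> ?R"
      by (auto simp: lower_def Om_def)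
  next
    fix A assume A: "A \<in> ?R"
    then have "A \<subseteq> X" "C \<subseteq> A"
      using subset_iff_sections[of A k U X] subset_iff_sections[of C k U A] C by (auto simp: Om_def)
    with A show "A \<in> ?L"
      by (auto simp: lower_def Om_def)
  qed
  have "(\<Sum>A\<in>lower. of_bool (C \<subseteq> A \<and> A - C \<subseteq> choices \<beta>) * step \<beta> A X) =
      (\<Sum>A\<in>lower. of_bool (C \<subseteq> A \<and> A \<subseteq> X))"
    using True by (intro sum.cong refl) (auto simp: step_def)
  also have "\<dots> = (of_nat (card {A\<in>lower. C \<subseteq> A \<and> A \<subseteq> X}) :: 'a)"
    using finl by (simp add: Int_def)
  also have "card {A\<in>lower. C \<subseteq> A \<and> A \<subseteq> X} =
      (\<Prod>b<k. card {a. C `` {b} \<subseteq> a \<and> a \<subseteq> X `` {b} \<and> card a = h - c})"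
    unfolding eq using section_subset[OF X] by (intro card_sections[OF finite_U]) auto
  also have "\<dots> = (\<Prod>b<k. (h - card (C `` {b})) choose c)"
  proof (intro prod.cong refl)
    fix b assume "b \<in> {..<k}"
    then have b: "b < k" by simp
    have "card {a. C `` {b} \<subseteq> a \<and> a \<subseteq> X `` {b} \<and> card a = h - c} =
        (h - card (C `` {b})) choose (h - c - card (C `` {b}))"
      using card_subsets_between[of "X `` {b}" "C `` {b}" "h - c"] finite_section[OF X, of b] True size[OF b]
        middleD(2)[of X b] b by (simp add: Image_mono)
    also have "h - c - card (C `` {b}) = (h - card (C `` {b})) - c"
      by simp
    also have "(h - card (C `` {b})) choose \<dots> = (h - card (C `` {b})) choose c"
      using size[OF b] by (subst binomial_symmetric[of c]) auto
    finally show "card {a. C `` {b} \<subseteq> a \<and> a \<subseteq> X `` {b} \<and> card a = h - c} = (h - card (C `` {b})) choose c" .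
  qed
  finally show ?thesis
    using True by (simp add: step_def)
next
  case False
  then have "of_bool (C \<subseteq> A \<and> A - C \<subseteq> choices \<beta>) * step \<beta> A X = 0" for A
    by (auto simp: step_def)
  moreover have "step \<beta> C X = 0"
    using False by (auto simp: step_def)
  ultimately show ?thesis
    by (simp only: sum.neutral_const mult_zero_right)
qed

text \<open>
  The functions \<open>rare b0 i C T\<close> span the terms of the inclusion-exclusion expansion in which block \<open>b0\<close>
  asks for an elementary symmetric polynomial of degree at least \<open>2c\<close>, where \<open>choose_nonzero\<close> fails.
\<close>

definition others :: "nat \<Rightarrow> (nat \<times> 'b) set set"
  where "others b0 = {T. T \<subseteq> Om \<and> (\<forall>b<k. card (T `` {b}) = (if b = b0 then 0 else h))}"

definition rare :: "nat \<Rightarrow> nat \<Rightarrow> 'b set \<Rightarrow> (nat \<times> 'b) set \<Rightarrow> (nat \<times> 'b) set \<Rightarrow> 'a"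
  where "rare b0 i C T X = of_bool (X \<in> middle \<and> C \<subseteq> X `` {b0} \<and> X `` {b0} - C \<subseteq> W i \<and> X - {b0} \<times> UNIV = T)"

definition rare_set :: "((nat \<times> 'b) set \<Rightarrow> 'a) set"
  where "rare_set = (\<Union>b0<k. (\<lambda>(i, C, T). rare b0 i C T) `
    ({..<w} \<times> {C. C \<subseteq> U \<and> card C + 2 * c \<le> h} \<times> others b0))"

lemma finite_others: "finite (others b0)"
  by (rule finite_subset[of _ "Set.Pow Om"]) (auto simp: others_def finite_Om)

lemma card_others:
  assumes "b0 < k"
  shows "card (others b0) = (2 * h choose h) ^ (k - 1)"
proof -
  let ?S = "\<lambda>b. {s. s \<subseteq> U \<and> card s = (if b = b0 then 0 else h)}"
  have "others b0 = {E. E \<subseteq> {..<k} \<times> U \<and> (\<forall>b<k. E `` {b} \<in> ?S b)}"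
    using section_subset by (auto simp: others_def Om_def)
  also have "card \<dots> = (\<Prod>b<k. card (?S b))"
    by (rule card_sections) (auto simp: finite_U)
  also have "\<dots> = (\<Prod>b<k. if b = b0 then 1 else 2 * h choose h)"
    using n_subsets[OF finite_U] by (intro prod.cong) (simp_all add: card_U)
  also have "\<dots> = (2 * h choose h) ^ (k - 1)"
    using assms by (subst prod.remove[of _ b0]) (simp_all add: prod.If_cases)
  finally show ?thesis .
qed

lemma finite_low: "finite {C. C \<subseteq> U \<and> card C + 2 * c \<le> h}"
  by (rule finite_subset[of _ "Set.Pow U"]) (auto simp: finite_U)

lemma finite_rare_set: "finite rare_set"
  unfolding rare_set_def using finite_low finite_others by blast

lemma card_rare_set:
  "card rare_set \<le> k * w * card {C. C \<subseteq> U \<and> card C + 2 * c \<le> h} * (2 * h choose h) ^ (k - 1)"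
proof -
  let ?L = "{C. C \<subseteq> U \<and> card C + 2 * c \<le> h}"
  have "card rare_set \<le> (\<Sum>b0<k. card ((\<lambda>(i, C, T). rare b0 i C T) ` ({..<w} \<times> ?L \<times> others b0)))"
    unfolding rare_set_def by (rule card_UN_le) simp
  also have "\<dots> \<le> (\<Sum>b0<k. w * card ?L * (2 * h choose h) ^ (k - 1))"
  proof (rule sum_mono)
    fix b0 assume b0: "b0 \<in> {..<k}"
    have "card ((\<lambda>(i, C, T). rare b0 i C T) ` ({..<w} \<times> ?L \<times> others b0)) \<le> card ({..<w} \<times> ?L \<times> others b0)"
      using finite_low finite_others by (intro card_image_le) auto
    then show "card ((\<lambda>(i, C, T). rare b0 i C T) ` ({..<w} \<times> ?L \<times> others b0)) \<le> w * card ?L * (2 * h choose h) ^ (k - 1)"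
      using b0 by (simp add: card_cartesian_product card_others mult.assoc)
  qed
  finally show ?thesis
    by (simp add: mult.assoc)
qed

text \<open>Split by the part \<open>T\<close> of a monomial outside block \<open>b0\<close>. Only
  that block keeps a polynomial, so \<open>\<beta>\<close> enters the spanning functions through
  \<open>\<beta> b0\<close> alone and they remain few.\<close>

lemma step_in_span_rare:
  assumes \<beta>: "\<And>b. b < k \<Longrightarrow> \<beta> b < w" and C: "C \<subseteq> Om" and b0: "b0 < k" "card (C `` {b0}) + 2 * c \<le> h"
  shows "step \<beta> C \<in> fun_space.span rare_set"
proof (rule fun_space_span_sum_scale)
  let ?a = "\<lambda>T. of_bool (\<forall>b<k. b \<noteq> b0 \<longrightarrow> C `` {b} \<subseteq> T `` {b} \<and> T `` {b} - C `` {b} \<subseteq> W (\<beta> b)) :: 'a"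
  show "rare b0 (\<beta> b0) (C `` {b0}) T \<in> fun_space.span rare_set" if "T \<in> others b0" for T
  proof (rule fun_space.span_base)
    show "rare b0 (\<beta> b0) (C `` {b0}) T \<in> rare_set"
      unfolding rare_set_def using b0 \<beta> section_subset[OF C] that
      by (intro UN_I[of b0] image_eqI[of _ _ "(\<beta> b0, C `` {b0}, T)"]) auto
  qed
  fix X
  show "step \<beta> C X = (\<Sum>T\<in>others b0. ?a T * rare b0 (\<beta> b0) (C `` {b0}) T X)"
  proof (cases "X \<in> middle")
    case True
    let ?T = "X - {b0} \<times> UNIV"
    have X: "X \<subseteq> Om"
      using True middleD by auto
    have sec: "?T `` {b} = (if b = b0 then {} else X `` {b})" for b
      by auto
    have T: "?T \<in> others b0"
      using X middleD(2)[OF True] by (auto simp: others_def sec)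
    have "(\<Sum>T\<in>others b0. ?a T * rare b0 (\<beta> b0) (C `` {b0}) T X) =
        (\<Sum>T\<in>others b0. if T = ?T then ?a ?T * rare b0 (\<beta> b0) (C `` {b0}) ?T X else 0)"
      by (intro sum.cong refl) (auto simp: rare_def)
    also have "\<dots> = ?a ?T * rare b0 (\<beta> b0) (C `` {b0}) ?T X"
      using T finite_others by simp
    also have "\<dots> = of_bool (\<forall>b<k. C `` {b} \<subseteq> X `` {b} \<and> X `` {b} - C `` {b} \<subseteq> W (\<beta> b))"
      using True b0 by (auto simp: rare_def sec)
    also have "(\<forall>b<k. C `` {b} \<subseteq> X `` {b} \<and> X `` {b} - C `` {b} \<subseteq> W (\<beta> b)) \<longleftrightarrow>
        C \<subseteq> X \<and> X - C \<subseteq> choices \<beta>"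
    proof -
      have 1: "C \<subseteq> X \<longleftrightarrow> (\<forall>b<k. C `` {b} \<subseteq> X `` {b})"
        using C unfolding Om_def by (rule subset_iff_sections)
      have "X - C \<subseteq> {..<k} \<times> U"
        using X by (auto simp: Om_def)
      then have "X - C \<subseteq> choices \<beta> \<longleftrightarrow> (\<forall>b<k. (X - C) `` {b} \<subseteq> choices \<beta> `` {b})"
        by (rule subset_iff_sections)
      moreover have "(X - C) `` {b} = X `` {b} - C `` {b}" for b
        by auto
      ultimately have 2: "X - C \<subseteq> choices \<beta> \<longleftrightarrow> (\<forall>b<k. X `` {b} - C `` {b} \<subseteq> W (\<beta> b))"
        by (simp add: choices_section)
      show ?thesis
        unfolding 1 2 by blast
    qed
    finally show ?thesis
      using True by (simp add: step_def)
  qed (auto simp: step_def rare_def)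
qed

text \<open>The indicators of the covered sets lie in the span of \<open>good\<close> and
  \<open>rare_set\<close>. In \<open>good\<close>, a monomial of degree at most \<open>D\<close> is
  joined with a shift in \<open>lower\<close>, of size \<open>k * (h - c)\<close>; since
  \<open>G\<close> is the same for all \<open>\<beta>\<close>, one such set serves all of
  them.\<close>

theorem covered_card_bound:
  fixes G :: "'i \<Rightarrow> (nat \<times> 'b) set \<Rightarrow> 'a"
  assumes fin: "finite I"
    and repr: "\<And>\<beta>. (\<And>b. b < k \<Longrightarrow> \<beta> b < w) \<Longrightarrow> \<exists>r. \<forall>X\<subseteq>Om.
       val \<beta> X = (\<Sum>a\<in>I. G a X * (\<Sum>A\<in>{A. A \<subseteq> Om \<and> card A \<le> D}. r a A * of_bool (A \<subseteq> X)))"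
  shows "card covered \<le> card I * card {A. A \<subseteq> Om \<and> card A \<le> D + k * (h - c)}
     + k * w * card {C. C \<subseteq> U \<and> card C + 2 * c \<le> h} * (2 * h choose h) ^ (k - 1)"
proof -
  define J where "J = {A. A \<subseteq> Om \<and> card A \<le> D + k * (h - c)}"
  define good :: "((nat \<times> 'b) set \<Rightarrow> 'a) set" where
    "good = (\<lambda>(a, A). top_coeff (\<lambda>X. G a X * of_bool (A \<subseteq> X))) ` (I \<times> J)"
  have finJ: "finite J"
    by (rule finite_subset[of _ "Set.Pow Om"]) (auto simp: J_def finite_Om)
  have fingood: "finite good"
    using fin finJ by (simp add: good_def)
  \<comment> \<open>Linearity of \<open>top_coeff\<close> carries the representation of
    \<open>val \<beta>\<close> over to its shift by \<open>A\<close>.\<close>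
  have lower_good: "step \<beta> A \<in> fun_space.span good" if \<beta>: "\<And>b. b < k \<Longrightarrow> \<beta> b < w" and A: "A \<in> lower" for \<beta> A
  proof -
    let ?K = "{A. A \<subseteq> Om \<and> card A \<le> D}"
    have "\<exists>r. \<forall>X\<subseteq>Om. val \<beta> X = (\<Sum>a\<in>I. G a X * (\<Sum>A\<in>?K. r a A * of_bool (A \<subseteq> X)))"
      using \<beta> by (rule repr)
    then obtain r where r: "val \<beta> X = (\<Sum>a\<in>I. G a X * (\<Sum>A\<in>?K. r a A * of_bool (A \<subseteq> X)))"
      if "X \<subseteq> Om" for X
      by blast
    have cardA: "card A \<le> k * (h - c)"
    proof -
      have "A = Sigma {..<k} (\<lambda>b. A `` {b})"
        using lowerD(1)[OF A] by (auto simp: Om_def)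
      also have "card \<dots> = (\<Sum>b<k. card (A `` {b}))"
        using finite_section[OF lowerD(1)[OF A]] by (simp add: card_SigmaI)
      finally show ?thesis
        using lowerD(2)[OF A] by simp
    qed
    have mem: "(a, A' \<union> A) \<in> I \<times> J" if "a \<in> I" "A' \<in> ?K" for a A'
      using that lowerD(1)[OF A] cardA card_Un_le[of A' A] by (auto simp: J_def)
    show ?thesis
    proof (rule fun_space_span_sum_scale)
      show "top_coeff (\<lambda>X. G (fst p) X * of_bool (snd p \<union> A \<subseteq> X)) \<in> fun_space.span good"
        if "p \<in> I \<times> ?K" for p
        using mem[of "fst p" "snd p"] that
        by (intro fun_space.span_base) (force simp: good_def)
      fix S
      have "step \<beta> A S = top_coeff (\<lambda>X. val \<beta> X * of_bool (A \<subseteq> X)) S"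
        using top_coeff_val_times[where \<beta> = \<beta>, OF \<beta> A] by simp
      also have "\<dots> = (\<Sum>p\<in>I \<times> ?K. r (fst p) (snd p) * top_coeff (\<lambda>X. G (fst p) X * of_bool (snd p \<union> A \<subseteq> X)) S)"
      proof (cases "S \<in> middle")
        case True
        then have S: "S \<subseteq> Om"
          using middleD by auto
        have "top_coeff (\<lambda>X. val \<beta> X * of_bool (A \<subseteq> X)) S =
          (\<Sum>T\<in>Set.Pow S. \<Sum>p\<in>I \<times> ?K. r (fst p) (snd p) *
             ((- 1) ^ card (S - T) * (G (fst p) T * of_bool (snd p \<union> A \<subseteq> T))))"
          unfolding top_coeff_def using True S
          by (auto simp: r sum_distrib_left sum_distrib_right sum.cartesian_product intro!: sum.cong)
        also have "\<dots> = (\<Sum>p\<in>I \<times> ?K. \<Sum>T\<in>Set.Pow S. r (fst p) (snd p) *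
             ((- 1) ^ card (S - T) * (G (fst p) T * of_bool (snd p \<union> A \<subseteq> T))))"
          by (rule sum.swap)
        finally show ?thesis
          using True by (simp add: top_coeff_def sum_distrib_left)
      qed (simp add: top_coeff_def)
      finally show "step \<beta> A S = (\<Sum>p\<in>I \<times> ?K. r (fst p) (snd p) * top_coeff (\<lambda>X. G (fst p) X * of_bool (snd p \<union> A \<subseteq> X)) S)" .
    qed
  qed
  have step_span: "step \<beta> C \<in> fun_space.span (good \<union> rare_set)"
    if \<beta>: "\<And>b. b < k \<Longrightarrow> \<beta> b < w" and C: "C \<subseteq> Om" "\<And>b. b < k \<Longrightarrow> card (C `` {b}) + c \<le> h" for \<beta> C
  proof (cases "\<exists>b0<k. card (C `` {b0}) + 2 * c \<le> h")
    case True
    then obtain b0 where "b0 < k" "card (C `` {b0}) + 2 * c \<le> h"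
      by blast
    with \<beta> C(1) have "step \<beta> C \<in> fun_space.span rare_set"
      by (rule step_in_span_rare)
    then show ?thesis
      using fun_space.span_mono[of rare_set "good \<union> rare_set"] by blast
  next
    case False
    \<comment> \<open>Here every block asks for a degree from \<open>c\<close> to
      \<open>2 * c - 1\<close>, so the factor \<open>N\<close> of \<open>step_eq_sum_lower\<close>
      is invertible.\<close>
    define N where "N = (of_nat (\<Prod>b<k. (h - card (C `` {b})) choose c) :: 'a)"
    have "of_nat ((h - card (C `` {b})) choose c) \<noteq> (0::'a)" if b: "b < k" for b
    proof (rule choose_nonzero)
      show "c \<le> h - card (C `` {b})"
        using C(2)[OF b] by simp
      show "h - card (C `` {b}) < 2 * c"
        using False b c_le_h C(2)[OF b] by (cases "c = 0") (force simp: not_le)+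
    qed
    then have "N \<noteq> 0"
      by (simp add: N_def of_nat_prod)
    have eq: "step \<beta> C X = (\<Sum>A\<in>lower. (inverse N * of_bool (C \<subseteq> A \<and> A - C \<subseteq> choices \<beta>)) * step \<beta> A X)" for X
    proof -
      have "step \<beta> C X = inverse N * (N * step \<beta> C X)"
        using \<open>N \<noteq> 0\<close> by simp
      also have "N * step \<beta> C X = (\<Sum>A\<in>lower. of_bool (C \<subseteq> A \<and> A - C \<subseteq> choices \<beta>) * step \<beta> A X)"
        unfolding N_def using \<beta> C by (rule step_eq_sum_lower)
      finally show ?thesis
        by (simp add: sum_distrib_left mult.assoc)
    qed
    have "step \<beta> C \<in> fun_space.span good"
      by (rule fun_space_span_sum_scale[OF _ eq]) (use lower_good \<beta> in auto)
    then show ?thesis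
      using fun_space.span_mono[of good "good \<union> rare_set"] by blast
  qed
  have "card covered \<le> card (good \<union> rare_set)"
  proof (rule card_le_of_indicators_in_span)
    show "finite covered"
      using finite_middle by (simp add: covered_def)
    show "finite (good \<union> rare_set)"
      using fingood finite_rare_set by simp
    fix S assume S: "S \<in> covered"
    then have Sm: "S \<in> middle" and S_Om: "S \<subseteq> Om"
      using middleD by (auto simp: covered_def)
    from S have "\<forall>b. \<exists>i. b < k \<longrightarrow> i < w \<and> card (W i - S `` {b}) + c \<le> card (S `` {b} \<inter> W i)"
      by (auto simp: covered_def)
    then obtain \<beta> where \<beta>: "\<And>b. b < k \<Longrightarrow> \<beta> b < w"
      "\<And>b. b < k \<Longrightarrow> card (W (\<beta> b) - S `` {b}) + c \<le> card (S `` {b} \<inter> W (\<beta> b))"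
      by metis
    have ch: "choices \<beta> \<subseteq> Om"
      using \<beta>(1) by (rule choices_subset)
    show "(\<lambda>X. of_bool (X = S) :: 'a) \<in> fun_space.span (good \<union> rare_set)"
    proof (rule fun_space_span_sum_scale)
      show "of_bool (X = S) = (\<Sum>B\<in>Set.Pow (choices \<beta> - S). (- 1) ^ card B * step \<beta> (S - choices \<beta> \<union> B) X)" for X
        using \<beta>(1) Sm by (rule indicator_eq_sum_step)
      fix B assume B: "B \<in> Set.Pow (choices \<beta> - S)"
      show "step \<beta> (S - choices \<beta> \<union> B) \<in> fun_space.span (good \<union> rare_set)"
      proof (rule step_span)
        show "S - choices \<beta> \<union> B \<subseteq> Om"
          using S_Om B ch by auto
        fix b assume b: "b < k"
        have fin: "finite (S `` {b})" "finite (W (\<beta> b))"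
          using finite_section[OF S_Om] W_subset[OF \<beta>(1)[OF b]] finite_U finite_subset by auto
        have "(S - choices \<beta> \<union> B) `` {b} \<subseteq> (S `` {b} - W (\<beta> b)) \<union> (W (\<beta> b) - S `` {b})"
          using B choices_section[OF b, of \<beta>] by auto
        then have "card ((S - choices \<beta> \<union> B) `` {b}) \<le> card ((S `` {b} - W (\<beta> b)) \<union> (W (\<beta> b) - S `` {b}))"
          using fin by (intro card_mono) auto
        also have "\<dots> \<le> card (S `` {b} - W (\<beta> b)) + card (W (\<beta> b) - S `` {b})"
          by (rule card_Un_le)
        finally have "card ((S - choices \<beta> \<union> B) `` {b}) + c \<le> card (S `` {b} - W (\<beta> b)) + card (S `` {b} \<inter> W (\<beta> b))"
          using \<beta>(2)[OF b] by simp
        also have "\<dots> = h"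
          using middleD(2)[OF Sm b] card_Int_Diff[OF fin(1), of "W (\<beta> b)"] by simp
        finally show "card ((S - choices \<beta> \<union> B) `` {b}) + c \<le> h" .
      qed (fact \<beta>(1))
    qed
  qed
  also have "\<dots> \<le> card good + card rare_set"
    by (rule card_Un_le)
  also have "card good \<le> card (I \<times> J)"
    unfolding good_def using fin finJ by (intro card_image_le) simp
  also have "\<dots> = card I * card J"
    by (rule card_cartesian_product)
  finally show ?thesis
    using card_rare_set by (simp add: J_def)
qed

end

section \<open>Counting biased sets\<close>

lemma cosh_le_exp_half_square: "cosh x \<le> exp (x\<^sup>2 / 2 :: real)"
proof -
  \<comment> \<open>Comparing the Taylor series term by term reduces the claim to this
    bound.\<close>
  have fact_bound: "2 ^ n * fact n \<le> (fact (2 * n) :: real)" for n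
  proof (induction n)
    case (Suc n)
    have "2 ^ Suc n * fact (Suc n) = (2 * (real n + 1)) * (2 ^ n * fact n)"
      by (simp add: algebra_simps)
    also have "\<dots> \<le> (2 * (real n + 1) * (2 * real n + 1)) * fact (2 * n)"
      using Suc by (intro mult_mono) (auto simp: algebra_simps)
    also have "\<dots> = fact (2 * Suc n)"
      by (simp add: algebra_simps)
    finally show ?case .
  qed simp
  have "(\<lambda>n. if even n then x ^ n /\<^sub>R fact n else 0) sums cosh x"
    by (rule cosh_converges)
  moreover have "(if even n then x ^ n /\<^sub>R fact n else 0) = 0" if "n \<notin> range ((*) 2)" for n
  proof -
    have "odd n"
      using that by (auto elim!: evenE)
    then show ?thesis
      by simp
  qed
  ultimately have "(\<lambda>n. if even (2 * n) then x ^ (2 * n) /\<^sub>R fact (2 * n) else 0) sums cosh x"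
    using sums_mono_reindex[of "(*) 2" "\<lambda>n. if even n then x ^ n /\<^sub>R fact n else 0" "cosh x"]
    by (simp add: strict_mono_def)
  then have 1: "(\<lambda>n. x ^ (2 * n) / fact (2 * n)) sums cosh x"
    by (simp add: divide_inverse mult.commute)
  have 2: "(\<lambda>n. (x\<^sup>2 / 2) ^ n / fact n) sums exp (x\<^sup>2 / 2)"
  proof -
    have "y / fact n = y /\<^sub>R fact n" for y :: real and n
      by (simp add: divide_inverse mult.commute)
    then show ?thesis
      using exp_converges[of "x\<^sup>2 / 2"] by (simp only:)
  qed
  show ?thesis
  proof (rule sums_le[OF _ 1 2])
    fix n
    have "x ^ (2 * n) / fact (2 * n) \<le> x ^ (2 * n) / (2 ^ n * fact n)"
      using fact_bound[of n] by (intro divide_left_mono) auto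
    also have "\<dots> = (x\<^sup>2 / 2) ^ n / fact n"
      by (simp add: power_mult power_divide)
    finally show "x ^ (2 * n) / fact (2 * n) \<le> (x\<^sup>2 / 2) ^ n / fact n" .
  qed
qed

text \<open>Chernoff bound: every small set has exponential weight at least 1, and the weights of
  all subsets add up to \<open>exp (- t * a)\<close> times a power of
  \<open>2 * cosh (t / 2)\<close>.\<close>

lemma card_small_subsets_le:
  fixes a :: real
  assumes "finite V" "card V > 0" "a \<ge> 0"
  shows "real (card {A. A \<subseteq> V \<and> real (card A) \<le> real (card V) / 2 - a})
    \<le> 2 ^ card V * exp (- 2 * a\<^sup>2 / card V)"
proof -
  define N where "N = card V"
  have N: "N > 0"
    using assms by (simp add: N_def)
  \<comment> \<open>The value that minimises N t^2 / 8 - t a.\<close>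
  define t where "t = 4 * a / real N"
  let ?B = "{A. A \<subseteq> V \<and> real (card A) \<le> real N / 2 - a}"
  have t: "t \<ge> 0"
    using assms by (simp add: t_def)
  have "real (card ?B) = (\<Sum>A\<in>?B. 1)"
    by simp
  also have "\<dots> \<le> (\<Sum>A\<in>?B. exp (t * (real N / 2 - a - real (card A))))"
    using t by (intro sum_mono) auto
  also have "\<dots> \<le> (\<Sum>A\<in>Set.Pow V. exp (t * (real N / 2 - a - real (card A))))"
    using assms(1) by (intro sum_mono2) auto
  also have "\<dots> = exp (t * (real N / 2 - a)) * (\<Sum>A\<in>Set.Pow V. exp (- t) ^ card A)"
    unfolding sum_distrib_left
    by (intro sum.cong refl) (simp add: algebra_simps flip: exp_of_nat_mult exp_add)
  also have "(\<Sum>A\<in>Set.Pow V. exp (- t) ^ card A) = (exp (- t) + 1) ^ N"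
    using prod_add[OF assms(1), of "\<lambda>_. exp (- t)" "\<lambda>_. 1"] by (simp add: N_def)
  also have "exp (t * (real N / 2 - a)) = exp (- t * a) * exp (t / 2) ^ N"
    by (simp add: algebra_simps flip: exp_of_nat_mult exp_add)
  also have "exp (- t * a) * exp (t / 2) ^ N * (exp (- t) + 1) ^ N =
      exp (- t * a) * (exp (t / 2) * (exp (- t) + 1)) ^ N"
    by (simp only: power_mult_distrib mult.assoc)
  also have "exp (t / 2) * (exp (- t) + 1) = 2 * cosh (t / 2)"
    by (simp add: cosh_def algebra_simps flip: exp_add)
  also have "exp (- t * a) * (2 * cosh (t / 2)) ^ N \<le> exp (- t * a) * (2 * exp ((t / 2)\<^sup>2 / 2)) ^ N"
    by (intro mult_left_mono power_mono cosh_le_exp_half_square) auto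
  also have "\<dots> = exp (- t * a) * (2 ^ N * exp (N * ((t / 2)\<^sup>2 / 2)))"
    by (simp only: power_mult_distrib exp_of_nat_mult)
  also have "\<dots> = 2 ^ N * exp (N * ((t / 2)\<^sup>2 / 2) - t * a)"
    by (simp only: mult.left_commute[of "exp _"] diff_conv_add_uminus add.commute[of _ "- (t * a)"] exp_add mult_minus_left)
  also have "N * ((t / 2)\<^sup>2 / 2) - t * a = - 2 * a\<^sup>2 / N"
    using N by (simp add: t_def field_simps power2_eq_square)
  finally show ?thesis
    by (simp add: N_def)
qed

text \<open>Beyond the middle, consecutive binomial coefficients have ratio (h - j) / (h + j + 1),
  which is at least (h - c) / (h + c) for \<open>j < c\<close>. The inverse of the latter is 1 + 2 c
  / (h - c), at most an exponential.\<close>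

lemma binomial_lower_bound_exp:
  assumes "c < h"
  shows "real (2 * h choose (h + c)) \<ge> real (2 * h choose h) * exp (- (2 * (real c)\<^sup>2 / (real h - real c)))"
proof -
  define q where "q = (real h - real c) / (real h + real c)"
  have q: "q \<ge> 0"
    using assms by (simp add: q_def)
  have "real (2 * h choose (h + j)) \<ge> real (2 * h choose h) * q ^ j" if "j \<le> c" for j
    using that
  proof (induction j)
    case (Suc j)
    have "Suc (h + j) * (2 * h choose Suc (h + j)) = (2 * h - (h + j)) * (2 * h choose (h + j))"
      by (metis binomial_absorb_comp binomial_absorption)
    then have "(real h + real j + 1) * real (2 * h choose Suc (h + j)) = (real h - real j) * real (2 * h choose (h + j))"
    proof -
      have "real (Suc (h + j)) * real (2 * h choose Suc (h + j)) = real (2 * h - (h + j)) * real (2 * h choose (h + j))"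
        using \<open>Suc (h + j) * _ = _\<close> by (simp only: flip: of_nat_mult)
      moreover have "real (2 * h - (h + j)) = real h - real j"
        using Suc.prems assms by (simp add: of_nat_diff)
      ultimately show ?thesis
        by (simp add: add_ac)
    qed
    then have eq: "real (2 * h choose Suc (h + j)) = (real h - real j) / (real h + real j + 1) * real (2 * h choose (h + j))"
      by (simp add: field_simps)
    have "q \<le> (real h - real j) / (real h + real j + 1)"
      unfolding q_def using Suc.prems assms by (intro frac_le) auto
    then have "real (2 * h choose h) * q ^ Suc j \<le> (real h - real j) / (real h + real j + 1) * (real (2 * h choose h) * q ^ j)"
    proof -
      have "q * (real (2 * h choose h) * q ^ j) \<le> (real h - real j) / (real h + real j + 1) * (real (2 * h choose h) * q ^ j)"
        using \<open>q \<le> _\<close> q by (intro mult_right_mono) auto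
      then show ?thesis
        by (simp only: power_Suc mult.left_commute)
    qed
    also have "\<dots> \<le> (real h - real j) / (real h + real j + 1) * real (2 * h choose (h + j))"
      using Suc assms by (intro mult_left_mono) auto
    finally show ?case
      using eq by simp
  qed simp
  then have "real (2 * h choose (h + c)) \<ge> real (2 * h choose h) * q ^ c"
    by simp
  moreover have "q ^ c \<ge> exp (- (2 * (real c)\<^sup>2 / (real h - real c)))"
  proof -
    have "1 + 2 * real c / (real h - real c) = inverse q"
      using assms by (simp add: q_def field_simps)
    then have "inverse q \<le> exp (2 * real c / (real h - real c))"
      by (metis exp_ge_add_one_self)
    moreover have "q > 0"
      using assms by (simp add: q_def)
    ultimately have "exp (- (2 * real c / (real h - real c))) \<le> q"
      by (simp add: exp_minus field_simps)
    then have "exp (- (2 * real c / (real h - real c))) ^ c \<le> q ^ c"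
      by (rule power_mono) simp
    also have "exp (- (2 * real c / (real h - real c))) ^ c = exp (- (2 * (real c)\<^sup>2 / (real h - real c)))"
      by (simp add: power2_eq_square flip: exp_of_nat_mult)
    finally show ?thesis .
  qed
  ultimately show ?thesis
    by (meson mult_left_mono of_nat_0_le_iff order.trans)
qed

text \<open>In each round, averaging yields a \<open>y\<close> related to at least the fraction
  \<open>\<rho>\<close> of the elements still left, so the rest shrinks by the factor
  \<open>1 - \<rho>\<close>.\<close>

lemma greedy_cover:
  fixes R :: "'x \<Rightarrow> 'y \<Rightarrow> bool" and \<rho> :: real
  assumes fin: "finite X" "finite Y" and ne: "Y \<noteq> {}" and \<rho>: "\<rho> \<le> 1"
    and dense: "\<And>x. x \<in> X \<Longrightarrow> real (card {y\<in>Y. R x y}) \<ge> \<rho> * real (card Y)"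
  shows "\<exists>f. (\<forall>i<w. f i \<in> Y) \<and> real (card {x\<in>X. \<forall>i<w::nat. \<not> R x (f i)}) \<le> (1 - \<rho>) ^ w * real (card X)"
proof (induction w)
  case (Suc w)
  then obtain f where f: "\<And>i. i < w \<Longrightarrow> f i \<in> Y"
    "real (card {x\<in>X. \<forall>i<w. \<not> R x (f i)}) \<le> (1 - \<rho>) ^ w * real (card X)"
    by auto
  define Z where "Z = {x\<in>X. \<forall>i<w. \<not> R x (f i)}"
  have finZ: "finite Z"
    using fin by (simp add: Z_def)
  have "\<exists>y\<in>Y. \<rho> * real (card Z) \<le> real (card {x\<in>Z. R x y})"
  proof (rule ccontr)
    assume "\<not> ?thesis"
    then have "(\<Sum>y\<in>Y. real (card {x\<in>Z. R x y})) < (\<Sum>y\<in>Y. \<rho> * real (card Z))"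
      using fin ne by (intro sum_strict_mono) auto
    also have "\<dots> = (\<Sum>x\<in>Z. \<rho> * real (card Y))"
      by simp
    also have "\<dots> \<le> (\<Sum>x\<in>Z. real (card {y\<in>Y. R x y}))"
      using dense by (intro sum_mono) (simp add: Z_def)
    also have "\<dots> = (\<Sum>x\<in>Z. \<Sum>y\<in>Y. of_bool (R x y))"
      using fin by (simp add: Int_def)
    also have "\<dots> = (\<Sum>y\<in>Y. \<Sum>x\<in>Z. of_bool (R x y))"
      by (rule sum.swap)
    also have "\<dots> = (\<Sum>y\<in>Y. real (card {x\<in>Z. R x y}))"
      using finZ by (simp add: Int_def)
    finally show False
      by simp
  qed
  then obtain y where y: "y \<in> Y" "\<rho> * real (card Z) \<le> real (card {x\<in>Z. R x y})"
    by blast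
  have eq: "{x\<in>X. \<forall>i<Suc w. \<not> R x ((f(w := y)) i)} = Z - {x\<in>Z. R x y}"
    by (auto simp: Z_def less_Suc_eq)
  have "real (card {x\<in>X. \<forall>i<Suc w. \<not> R x ((f(w := y)) i)}) = real (card Z) - real (card {x\<in>Z. R x y})"
    unfolding eq using finZ by (subst card_Diff_subset) (auto intro!: of_nat_diff card_mono)
  also have "\<dots> \<le> (1 - \<rho>) * real (card Z)"
    using y(2) by (simp add: algebra_simps)
  also have "\<dots> \<le> (1 - \<rho>) * ((1 - \<rho>) ^ w * real (card X))"
    using f(2) \<rho> by (intro mult_left_mono) (auto simp: Z_def)
  finally show ?case
    using f(1) y(1) by (intro exI[of _ "f(w := y)"]) (auto simp: less_Suc_eq)
qed simp

text \<open>Complementing \<open>T\<close> outside \<open>S\<close> is injective and turns the size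
  \<open>h + c\<close> of \<open>T\<close> into a bias of exactly \<open>c\<close> towards
  \<open>S\<close>.\<close>

lemma card_biased_subsets_ge:
  assumes "finite U" "card U = 2 * h" "S \<subseteq> U" "card S = h"
  shows "card {W\<in>Set.Pow U. card (W - S) + c \<le> card (S \<inter> W)} \<ge> (2 * h choose (h + c))"
proof -
  let ?f = "\<lambda>T. (T \<inter> S) \<union> (U - S - T)"
  have fin: "finite S"
    using assms finite_subset by auto
  have inj: "inj_on ?f {T. T \<subseteq> U \<and> card T = h + c}"
  proof (rule inj_onI)
    fix T T' assume "T \<in> {T. T \<subseteq> U \<and> card T = h + c}" "T' \<in> {T. T \<subseteq> U \<and> card T = h + c}" "?f T = ?f T'"
    then show "T = T'"
      using assms(3) by blast
  qed
  have "?f T \<in> {W\<in>Set.Pow U. card (W - S) + c \<le> card (S \<inter> W)}" if T: "T \<subseteq> U" "card T = h + c" for T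
  proof -
    have finT: "finite T"
      using T(1) assms(1) finite_subset by auto
    have "?f T - S = U - S - T" "S \<inter> ?f T = T \<inter> S"
      by auto
    moreover have "card T = card (T \<inter> S) + card (T - S)"
      using finT by (rule card_Int_Diff)
    moreover have "card (U - S) = card ((U - S) \<inter> T) + card (U - S - T)"
      using assms(1) by (intro card_Int_Diff) simp
    moreover have "(U - S) \<inter> T = T - S"
      using T(1) by auto
    moreover have "card (U - S) = h"
      using assms fin by (simp add: card_Diff_subset)
    ultimately show ?thesis
      using T assms(3) by auto
  qed
  then have "card (?f ` {T. T \<subseteq> U \<and> card T = h + c}) \<le> card {W\<in>Set.Pow U. card (W - S) + c \<le> card (S \<inter> W)}"
    using assms(1) by (intro card_mono) auto
  then show ?thesis
    using assms n_subsets[OF assms(1), of "h + c"] by (simp add: card_image[OF inj])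
qed

lemma central_choose_ratio_le_one: "real (2 * h choose j) / 4 ^ h \<le> 1"
proof -
  have "(2 * h choose j) \<le> 2 ^ (2 * h)"
    by (rule binomial_le_pow2)
  then have "real (2 * h choose j) \<le> real (4 ^ h)"
    unfolding of_nat_le_iff by (simp add: power_mult)
  then show ?thesis
    by simp
qed

text \<open>Greedy cover of the sets of size \<open>h\<close>, with all 4^h subsets of
  \<open>U\<close> as candidates.\<close>

lemma exists_biased_family:
  assumes "finite U" "card U = 2 * h"
  shows "\<exists>W. (\<forall>i<w. W i \<subseteq> U) \<and>
    real (2 * h choose h) * (1 - (1 - real (2 * h choose (h + c)) / 4 ^ h) ^ w) \<le>
    real (card {S. S \<subseteq> U \<and> card S = h \<and> (\<exists>i<w. card (W i - S) + c \<le> card (S \<inter> W i))})"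
proof -
  let ?X = "{S. S \<subseteq> U \<and> card S = h}"
  let ?R = "\<lambda>S W. card (W - S) + c \<le> card (S \<inter> W)"
  let ?\<rho> = "real (2 * h choose (h + c)) / 4 ^ h"
  have finX: "finite ?X"
    by (rule finite_subset[of _ "Set.Pow U"]) (use assms in auto)
  have le1: "?\<rho> \<le> 1"
    by (rule central_choose_ratio_le_one)
  have "\<exists>f. (\<forall>i<w. f i \<in> Set.Pow U) \<and> real (card {S\<in>?X. \<forall>i<w. \<not> ?R S (f i)}) \<le> (1 - ?\<rho>) ^ w * real (card ?X)"
  proof (rule greedy_cover)
    fix S assume "S \<in> ?X"
    then have "real (2 * h choose (h + c)) \<le> real (card {W\<in>Set.Pow U. ?R S W})"
      using card_biased_subsets_ge[OF assms, of S c] by simp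
    then show "?\<rho> * real (card (Set.Pow U)) \<le> real (card {W\<in>Set.Pow U. ?R S W})"
      using assms by (simp add: card_Pow power_mult)
  qed (use finX assms le1 in auto)
  then obtain W where W: "\<And>i. i < w \<Longrightarrow> W i \<subseteq> U"
    "real (card {S\<in>?X. \<forall>i<w. \<not> ?R S (W i)}) \<le> (1 - ?\<rho>) ^ w * real (card ?X)"
    by auto
  let ?Z = "{S\<in>?X. \<forall>i<w. \<not> ?R S (W i)}"
  have sub: "?Z \<subseteq> ?X"
    by auto
  have "{S. S \<subseteq> U \<and> card S = h \<and> (\<exists>i<w. ?R S (W i))} = ?X - ?Z"
    by auto
  then have "real (card {S. S \<subseteq> U \<and> card S = h \<and> (\<exists>i<w. ?R S (W i))}) = real (card ?X) - real (card ?Z)"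
    using card_Diff_subset[OF finite_subset[OF sub finX] sub] card_mono[OF finX sub]
    by (simp only: of_nat_diff)
  moreover have "card ?X = (2 * h choose h)"
    using n_subsets[OF assms(1), of h] assms(2) by simp
  ultimately show ?thesis
    using W by (intro exI[of _ W]) (auto simp: algebra_simps)
qed

section \<open>Choice of parameters and the lower bound\<close>

text \<open>Bookkeeping of powers of \<open>n\<close>: the left side of \<open>main\<close> is at
  least 3/4 of \<open>B ^ k\<close>, the rare term takes at most 1/4, and the remaining half bounds
  \<open>s\<close> from below.\<close>

lemma numeric_size_bound:
  fixes n k h c w s L :: nat
  assumes n: "n \<ge> 1" and k: "k \<ge> 1" and h: "c < h" "2 * real h \<le> real n powr 0.02"
    and kn: "real k \<le> real n powr 0.01" and L: "real L \<le> real n powr 0.01"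
    and lo: "0.1 * ln n \<le> (real c)\<^sup>2 / (2 * real h)"
    and hi: "2 * (real c)\<^sup>2 / (real h - real c) \<le> 0.5 * ln n"
    and w: "real n powr 0.54 \<le> real w" "real w \<le> real n powr 0.55"
    and big: "real n powr 0.01 \<ge> 4" "real n powr 0.02 \<ge> ln 4 + 0.01 * ln n"
    and main: "(real (2 * h choose h) * (1 - (1 - real (2 * h choose (h + c)) / 4 ^ h) ^ w)) ^ k \<le>
      real s * real L * (4 ^ (h * k) * exp (- (real k * (real c)\<^sup>2 / (4 * real h)))) +
      real k * real w * (4 ^ h * exp (- (4 * (real c)\<^sup>2 / real h))) * real (2 * h choose h) ^ (k - 1)"
  shows "real s \<ge> real n powr (0.01 * real k)"
proof -
  define B where "B = real (2 * h choose h)"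
  define \<rho> where "\<rho> = real (2 * h choose (h + c)) / 4 ^ h"
  have n0: "real n > 0" and h0: "real h > 0"
    using n h by auto
  have B: "B > 0"
    by (simp add: B_def)
  have central: "4 ^ h \<le> 2 * real h * B"
    using central_binomial_lower_bound[of h] h0 by (simp add: B_def field_simps)
  have central': "4 ^ h / B \<le> real n powr 0.02"
  proof -
    have "4 ^ h / B \<le> 2 * real h"
      using central B by (simp add: field_simps)
    with h show ?thesis
      by linarith
  qed
  have exp_powr: "exp (a * ln n) = real n powr a" for a
    using n0 by (simp add: powr_def)
  \<comment> \<open>The exponent splits into 0.5 from \<open>hi\<close> and 0.02 from the central
    binomial coefficient.\<close>
  have \<rho>_lower: "real n powr - 0.52 \<le> \<rho>"
  proof -
    have "real n powr - 0.5 \<le> exp (- (2 * (real c)\<^sup>2 / (real h - real c)))"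
      using hi exp_powr[of "- 0.5"] by (simp flip: exp_powr)
    then have "B * real n powr - 0.5 \<le> real (2 * h choose (h + c))"
      using binomial_lower_bound_exp[OF h(1)] B unfolding B_def[symmetric]
      by (meson mult_left_mono less_imp_le order.trans)
    then have "real n powr - 0.5 * (B / 4 ^ h) \<le> \<rho>"
      by (simp add: \<rho>_def field_simps)
    moreover have "real n powr - 0.02 \<le> B / 4 ^ h"
      using central' B n0 by (simp add: powr_minus field_simps)
    ultimately have "real n powr - 0.5 * real n powr - 0.02 \<le> \<rho>"
      by (meson mult_left_mono order.trans powr_ge_zero)
    then show ?thesis
      by (simp flip: powr_add)
  qed
  have \<rho>1: "\<rho> \<le> 1"
    unfolding \<rho>_def by (rule central_choose_ratio_le_one)
  \<comment> \<open>\<open>\<rho> * w\<close> is at least n^0.02, hence at least ln (4 k), so the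
    fraction missed in a block is at most 1 / (4 k).\<close>
  have miss: "real k * (1 - \<rho>) ^ w \<le> 1 / 4"
  proof -
    have "ln (4 * real k) \<le> ln 4 + 0.01 * ln n"
    proof -
      have "ln (real k) \<le> ln (real n powr 0.01)"
        using k kn n0 by (subst ln_le_cancel_iff) auto
      then show ?thesis
        using k n0 by (simp add: ln_mult ln_powr)
    qed
    also have "\<dots> \<le> real n powr 0.02"
      by (rule big)
    also have "\<dots> = real n powr - 0.52 * real n powr 0.54"
      by (simp flip: powr_add)
    also have "\<dots> \<le> \<rho> * real w"
      using \<rho>_lower w(1) by (intro mult_mono) (auto intro: order.trans[OF powr_ge_zero])
    finally have 1: "ln (4 * real k) \<le> \<rho> * real w" .
    have "1 - \<rho> \<le> exp (- \<rho>)"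
      using exp_ge_add_one_self[of "- \<rho>"] by simp
    then have "(1 - \<rho>) ^ w \<le> exp (- \<rho>) ^ w"
      using \<rho>1 by (intro power_mono) auto
    also have "\<dots> = exp (- (\<rho> * real w))"
      by (simp add: mult.commute flip: exp_of_nat_mult)
    also have "\<dots> \<le> exp (- ln (4 * real k))"
      using 1 by simp
    also have "\<dots> = 1 / (4 * real k)"
      using k by (simp add: exp_minus inverse_eq_divide)
    finally show ?thesis
      using k by (simp add: field_simps)
  qed
  have left: "3 / 4 * B ^ k \<le> (B * (1 - (1 - \<rho>) ^ w)) ^ k"
  proof -
    have "0 \<le> \<rho>"
      using \<rho>_lower powr_ge_zero[of "real n" "- 0.52"] by linarith
    then have "0 \<le> (1 - \<rho>) ^ w" "(1 - \<rho>) ^ w \<le> 1"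
      using \<rho>1 by (auto intro!: power_le_one)
    then have "1 + real k * (- ((1 - \<rho>) ^ w)) \<le> (1 + - ((1 - \<rho>) ^ w)) ^ k"
      by (intro Bernoulli_inequality) simp
    then have "3 / 4 \<le> (1 - (1 - \<rho>) ^ w) ^ k"
      using miss by simp
    then show ?thesis
      using B by (simp add: power_mult_distrib mult.commute)
  qed
  \<comment> \<open>Replacing 4^h by \<open>B\<close> costs n^0.02 per block, while the tail bound
    gains n^0.05 per block.\<close>
  have first: "4 ^ (h * k) * exp (- (real k * (real c)\<^sup>2 / (4 * real h))) \<le> B ^ k * real n powr (- 0.03 * real k)"
  proof -
    have "4 ^ (h * k) = B ^ k * (4 ^ h / B) ^ k"
      using B by (simp add: power_divide power_mult)
    also have "\<dots> \<le> B ^ k * (real n powr 0.02) ^ k"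
      using central' B by (intro mult_left_mono power_mono) auto
    also have "(real n powr 0.02) ^ k = real n powr (0.02 * real k)"
      using n0 by (simp add: powr_powr flip: powr_realpow)
    finally have "4 ^ (h * k) \<le> B ^ k * real n powr (0.02 * real k)" .
    moreover have "exp (- (real k * (real c)\<^sup>2 / (4 * real h))) \<le> real n powr (- 0.05 * real k)"
    proof -
      have "(0.05 * ln n) * real k \<le> ((real c)\<^sup>2 / (4 * real h)) * real k"
        using lo h0 by (intro mult_right_mono) (auto simp: field_simps)
      then show ?thesis
        using n0 by (simp add: powr_def mult_ac)
    qed
    ultimately have "4 ^ (h * k) * exp (- (real k * (real c)\<^sup>2 / (4 * real h))) \<le>
        (B ^ k * real n powr (0.02 * real k)) * real n powr (- 0.05 * real k)"
      using B by (intro mult_mono) auto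
    then show ?thesis
      by (simp add: mult.assoc flip: powr_add)
  qed
  \<comment> \<open>The exponents of \<open>k\<close>, \<open>w\<close>, 4^h / B and the tail add
    up: 0.01 + 0.55 + 0.02 - 0.8 = -0.22.\<close>
  have second: "real k * real w * (4 ^ h * exp (- (4 * (real c)\<^sup>2 / real h))) * B ^ (k - 1) \<le> 1 / 4 * B ^ k"
  proof -
    have "exp (- (4 * (real c)\<^sup>2 / real h)) \<le> real n powr - 0.8"
    proof -
      have "0.8 * ln n \<le> 4 * (real c)\<^sup>2 / real h"
        using lo h0 by (simp add: field_simps)
      then show ?thesis
        using n0 by (simp add: powr_def)
    qed
    moreover have "4 ^ h \<le> real n powr 0.02 * B"
      using central' B by (simp add: field_simps)
    ultimately have "real k * real w * (4 ^ h * exp (- (4 * (real c)\<^sup>2 / real h))) \<le>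
        real n powr 0.01 * real n powr 0.55 * ((real n powr 0.02 * B) * real n powr - 0.8)"
      using kn w B by (intro mult_mono) auto
    also have "\<dots> = real n powr - 0.22 * B"
      by (simp add: mult_ac flip: powr_add)
    also have "\<dots> \<le> 1 / 4 * B"
    proof (intro mult_right_mono)
      have "real n powr - 0.22 \<le> real n powr - 0.01"
        using n by (intro powr_mono) auto
      also have "\<dots> \<le> 1 / 4"
        using big(1) n0 by (simp add: powr_minus field_simps)
      finally show "real n powr - 0.22 \<le> 1 / 4" .
    qed (use B in auto)
    finally have "real k * real w * (4 ^ h * exp (- (4 * (real c)\<^sup>2 / real h))) * B ^ (k - 1) \<le> 1 / 4 * B * B ^ (k - 1)"
      using B by (intro mult_right_mono) auto
    also have "\<dots> = 1 / 4 * B ^ k"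
      using k by (cases k) auto
    finally show ?thesis .
  qed
  have "real s * real L * (4 ^ (h * k) * exp (- (real k * (real c)\<^sup>2 / (4 * real h)))) \<le>
      real s * real L * (B ^ k * real n powr (- 0.03 * real k))"
    by (intro mult_left_mono first) simp
  then have "3 / 4 * B ^ k \<le> real s * real L * (B ^ k * real n powr (- 0.03 * real k)) + 1 / 4 * B ^ k"
    using left main second unfolding B_def[symmetric] \<rho>_def[symmetric] by linarith
  then have "1 / 2 * B ^ k \<le> (real s * real L * real n powr (- 0.03 * real k)) * B ^ k"
    by (simp add: mult_ac)
  then have "1 / 2 \<le> real s * real L * real n powr (- 0.03 * real k)"
    using B by (simp only: mult_le_cancel_right_pos zero_less_power)
  also have "\<dots> \<le> real s * real n powr 0.01 * real n powr (- 0.03 * real k)"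
    using L by (intro mult_right_mono mult_left_mono) auto
  finally have half: "1 / 2 \<le> real s * (real n powr 0.01 * real n powr (- 0.03 * real k))"
    by (simp add: mult.assoc)
  have "real n powr (0.01 * real k) = 1 / 2 * (2 * real n powr (0.01 * real k))"
    by simp
  also have "\<dots> \<le> (real s * (real n powr 0.01 * real n powr (- 0.03 * real k))) * (2 * real n powr (0.01 * real k))"
    using half by (intro mult_right_mono) auto
  also have "\<dots> = real s * (2 * real n powr (0.01 - 0.02 * real k))"
    by (simp add: mult_ac flip: powr_add)
  also have "\<dots> \<le> real s * 1"
  proof (intro mult_left_mono)
    have "2 * real n powr (0.01 - 0.02 * real k) \<le> 2 * real n powr - 0.01"
      using n k by (intro mult_left_mono powr_mono) auto
    also have "\<dots> \<le> 1"
      using big(1) n0 by (simp add: powr_minus field_simps)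
    finally show "2 * real n powr (0.01 - 0.02 * real k) \<le> 1" .
  qed simp
  finally show ?thesis
    by simp
qed

text \<open>\<open>c\<close> is within the factor \<open>P\<close> of the available block length,
  and \<open>h\<close> puts c^2 / h near (ln n) / 5. Choosing \<open>T = k div P\<close> compensates
  for the factor \<open>P\<close> lost in \<open>c\<close>, so that \<open>T * r\<close> is at most
  c / 2.\<close>

lemma exists_parameters:
  fixes n d k r P c :: nat
  assumes n: "n \<ge> 1" and k: "k \<ge> 1" and r: "r \<ge> 1" "real r \<le> real d / (1201 * (real k)\<^sup>2)" and P: "P \<ge> 2"
    and d: "real d \<le> real n powr 0.01" "real d \<ge> (real P)\<^sup>2 * (ln n)\<^sup>2"
    and ln: "ln n \<ge> 10"
    and c: "c \<le> d div k - 2" "d div k - 2 \<le> P * c" 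
  defines "h \<equiv> nat \<lfloor>5 * (real c)\<^sup>2 / ln n\<rfloor>" and "T \<equiv> k div P"
  shows "k * (c + 2) \<le> d" "c < h" "2 * real h \<le> real n powr 0.02" "real k \<le> real n powr 0.01"
    "real (k * r + 1) \<le> real n powr 0.01" "0.1 * ln n \<le> (real c)\<^sup>2 / (2 * real h)"
    "2 * (real c)\<^sup>2 / (real h - real c) \<le> 0.5 * ln n" "2 * (T * r) \<le> c"
proof -
  have k0: "real k \<ge> 1" and P0: "real P \<ge> 2" and r0: "real r \<ge> 1"
    using k P r by auto
  have rd: "real r * (1201 * (real k)\<^sup>2) \<le> real d"
    using r(2) k0 by (simp add: field_simps)
  have kd: "1201 * (real k)\<^sup>2 \<le> real d"
  proof -
    have "1 * (1201 * (real k)\<^sup>2) \<le> real r * (1201 * (real k)\<^sup>2)"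
      using r0 by (intro mult_right_mono) auto
    with rd show ?thesis
      by simp
  qed
  have k1: "real k \<le> (real k)\<^sup>2"
    using k0 self_le_power[of "real k" 2] by simp
  have d1: "real d \<ge> 1201"
    using kd k0 k1 by linarith
  have dk: "real d / real k \<ge> 1201 * real k"
    using kd k0 by (simp add: field_simps power2_eq_square)
  have M: "real (d div k - 2) \<ge> real d / (2 * real k)"
  proof -
    have "real d / real k < real (d div k) + 1"
    proof -
      have "d < (d div k + 1) * k"
        using k dividend_less_div_times[of k d] by (simp add: algebra_simps)
      then have "real d < real ((d div k + 1) * k)"
        by (rule of_nat_less_iff[THEN iffD2])
      then have "real d < (real (d div k) + 1) * real k"
        by (simp add: algebra_simps)
      then show ?thesis
        using k0 by (simp add: divide_less_eq)
    qed
    moreover have "real (d div k - 2) \<ge> real (d div k) - 2"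
      by linarith
    moreover have "real d / (2 * real k) = (real d / real k) / 2"
      by simp
    ultimately show ?thesis
      using dk k0 by linarith
  qed
  have cP: "real d / (2 * real k) \<le> real P * real c"
  proof -
    have "real (d div k - 2) \<le> real (P * c)"
      using c(2) by (rule of_nat_mono)
    with M show ?thesis
      by simp
  qed
  show "k * (c + 2) \<le> d"
  proof -
    have "d div k \<ge> 2"
    proof -
      have "real d / (2 * real k) > 0"
        using d1 k0 by simp
      with M have "real (d div k - 2) > 0"
        by linarith
      then show ?thesis
        by simp
    qed
    then have "c + 2 \<le> d div k"
      using c(1) by simp
    then have "k * (c + 2) \<le> k * (d div k)"
      by (rule mult_le_mono2)
    also have "\<dots> \<le> d"
      by simp
    finally show ?thesis .
  qed
  have kc: "real k * real c \<le> real d"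
  proof -
    have "k * c \<le> d"
      using \<open>k * (c + 2) \<le> d\<close> by (simp add: algebra_simps)
    then show ?thesis
      by (metis of_nat_le_iff of_nat_mult)
  qed
  have cd: "real c \<le> real d"
  proof -
    have "1 * real c \<le> real k * real c"
      using k0 by (intro mult_right_mono) auto
    with kc show ?thesis
      by simp
  qed
  \<comment> \<open>Otherwise d < 4 P k ln n up to equality; squaring and using d \<ge> P^2 (ln n)^2
    together with d \<ge> 1201 k^2 gives d^2 \<le> 16 d^2 / 1201.\<close>
  have c2: "real c \<ge> 2 * ln n"
  proof (rule ccontr)
    assume "\<not> ?thesis"
    then have lt: "real c < 2 * ln n"
      by simp
    have "real d \<le> real P * real c * (2 * real k)"
      using cP k0 by (simp add: field_simps)
    also have "\<dots> \<le> real P * (2 * ln n) * (2 * real k)"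
      using lt k0 P0 by (intro mult_right_mono mult_left_mono) auto
    finally have 1: "real d \<le> 4 * (real P * ln n) * real k"
      by (simp add: mult_ac)
    have "(real d)\<^sup>2 \<le> (4 * (real P * ln n) * real k)\<^sup>2"
      using 1 by (intro power_mono) auto
    also have "\<dots> = 16 * ((real P)\<^sup>2 * (ln n)\<^sup>2) * (real k)\<^sup>2"
      by (simp add: power_mult_distrib)
    also have "\<dots> \<le> 16 * real d * (real k)\<^sup>2"
      using d(2) by (intro mult_right_mono mult_left_mono) auto
    also have "\<dots> \<le> 16 * real d * (real d / 1201)"
      using kd by (intro mult_left_mono) auto
    also have "\<dots> < (real d)\<^sup>2"
      using d1 by (simp add: power2_eq_square field_simps)
    finally show False
      by simp
  qed
  have ln0: "ln n > 0"
    using ln by simp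
  define z where "z = (real c)\<^sup>2 / ln n"
  have hz: "real h \<le> 5 * z" "real h > 5 * z - 1"
  proof -
    have "5 * z \<ge> 0"
      using ln0 by (simp add: z_def)
    then show "real h \<le> 5 * z" "real h > 5 * z - 1"
      unfolding h_def z_def by (simp_all add: of_nat_floor)
  qed
  have z: "z \<ge> 2 * real c"
  proof -
    have "2 * real c * ln n \<le> real c * real c"
      using mult_left_mono[OF c2, of "real c"] by (simp add: mult_ac)
    then show ?thesis
      using ln0 by (simp add: z_def field_simps power2_eq_square)
  qed
  have c20: "real c \<ge> 20"
    using c2 ln by linarith
  \<comment> \<open>One of the five \<open>z\<close> pays for \<open>c\<close> and for the rounding
    of \<open>h\<close>, as \<open>z \<ge> 2 * c \<ge> c + 1\<close>.\<close>
  have hc: "real h - real c \<ge> 4 * z"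
    using hz z c20 by linarith
  have z0: "z > 0"
    using z c20 by linarith
  show "c < h"
    using hc z0 by linarith
  show "2 * real h \<le> real n powr 0.02"
  proof -
    have "2 * real h \<le> 10 * z"
      using hz by simp
    also have "\<dots> \<le> (real c)\<^sup>2"
    proof -
      have "10 * (real c)\<^sup>2 \<le> ln n * (real c)\<^sup>2"
        using ln by (intro mult_right_mono) auto
      then show ?thesis
        using ln0 by (simp add: z_def field_simps)
    qed
    also have "\<dots> \<le> (real n powr 0.01)\<^sup>2"
      using cd d(1) by (intro power_mono) auto
    also have "\<dots> = real n powr 0.02"
      using n by (simp add: powr_powr flip: powr_realpow)
    finally show ?thesis .
  qed
  show "real k \<le> real n powr 0.01"
    using k1 kd d(1) k0 zero_le_power2[of "real k"] by linarith
  show "real (k * r + 1) \<le> real n powr 0.01"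
  proof -
    have "real r * (1201 * real k) \<le> real r * (1201 * (real k)\<^sup>2)"
      using k1 by (intro mult_left_mono) auto
    then have "1201 * (real k * real r) \<le> real d"
      using rd by (simp add: mult_ac)
    then show ?thesis
      using d1 d(1) by simp
  qed
  show "0.1 * ln n \<le> (real c)\<^sup>2 / (2 * real h)"
  proof -
    have "0.1 * ln n * (2 * real h) \<le> 0.1 * ln n * (2 * (5 * z))"
      using hz ln0 by (intro mult_left_mono) auto
    also have "\<dots> = (real c)\<^sup>2"
      using ln0 by (simp add: z_def)
    finally show ?thesis
      using \<open>c < h\<close> by (simp add: field_simps)
  qed
  show "2 * (real c)\<^sup>2 / (real h - real c) \<le> 0.5 * ln n"
  proof -
    have "2 * (real c)\<^sup>2 = 0.5 * ln n * (4 * z)"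
      using ln0 by (simp add: z_def)
    also have "\<dots> \<le> 0.5 * ln n * (real h - real c)"
      using hc ln0 by (intro mult_left_mono) auto
    finally show ?thesis
      using \<open>c < h\<close> by (simp add: field_simps)
  qed
  show "2 * (T * r) \<le> c"
  proof -
    have "P * T \<le> k"
      unfolding T_def by simp
    then have "real P * real T \<le> real k"
      by (metis of_nat_le_iff of_nat_mult)
    then have "(real P * real T) * real r \<le> real k * real r"
      by (intro mult_right_mono) auto
    then have "1201 * (real k * (real P * real T * real r)) \<le> 1201 * (real k * (real k * real r))"
      using k0 by simp
    also have "\<dots> \<le> real d"
      using rd by (simp add: power2_eq_square mult_ac)
    also have "real d \<le> 2 * (real k * (real P * real c))"
      using cP k0 by (simp add: field_simps)
    finally have "real k * (real P * (1201 * (real T * real r))) \<le> real k * (real P * (2 * real c))"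
      by (simp add: mult_ac)
    then have "1201 * (real T * real r) \<le> 2 * real c"
      using k0 P0 by simp
    then have "2 * (real T * real r) \<le> real c"
      using zero_le_mult_iff[of "real T" "real r"] by simp
    then show ?thesis
      by (simp flip: of_nat_mult)
  qed
qed

lemma real_nat_floor_bounds:
  fixes x :: real
  assumes "x \<ge> 0"
  shows "real (nat \<lfloor>x\<rfloor>) \<le> x" "x - 1 < real (nat \<lfloor>x\<rfloor>)"
  using assms by linarith+

text \<open>The decomposition supplies \<open>J\<close> and \<open>K\<close>, the small size a
  choice of copies that kills all monomials with more than \<open>T\<close> labels, and equivalence
  on the cube identifies the restricted output with \<open>val \<beta>\<close>.\<close>

lemma circuit_counting_bound:
  fixes C :: "(imm_var, 'a::field) circuit"
  assumes nz: "\<And>i. c \<le> i \<Longrightarrow> i < 2 * c \<Longrightarrow> of_nat (i choose c) \<noteq> (0::'a)"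
    and k: "k \<ge> 1" and depth: "k * (c + 2) \<le> d" and width: "1 + w * (2 * h + 1) * q \<le> n" and ch: "c \<le> h"
    and W: "\<And>i. i < w \<Longrightarrow> W i \<subseteq> {1..2 * h}"
    and circ: "circuit_over V C" "sum_pow_sum_prod C" "individual_degree_le r (output_poly C)"
    and equiv: "equivalent_on_cube V (output_poly C) (IMM n d)"
    and small: "circuit_size C < q ^ (T + 1)"
  shows "card {S. S \<subseteq> {1..2 * h} \<and> card S = h \<and> (\<exists>i<w. card (W i - S) + c \<le> card (S \<inter> W i))} ^ k \<le>
    circuit_size C * (k * r + 1) * card {A. A \<subseteq> {..<k} \<times> {1..2 * h} \<and> card A \<le> T * (k * r) + k * (h - c)} +
    k * w * card {B. B \<subseteq> {1..2 * h} \<and> card B + 2 * c \<le> h} * (2 * h choose h) ^ (k - 1)"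
proof -
  interpret R: imm_restriction n d k c w q "2 * h" W
    by standard (use k depth width W in auto)
  interpret Q: cube_rank "{1..2 * h}" h k c w W "TYPE('a)"
    by standard (use W ch nz in auto)
  have Om: "R.Om = Q.Om"
    unfolding R.Om_def Q.Om_def ..
  obtain J :: "nat set" and K :: "(imm_var \<Rightarrow>\<^sub>0 nat) set" and Q :: "nat \<Rightarrow> (imm_var, 'a) mpoly"
      and e m :: "nat \<Rightarrow> nat"
    where dec: "finite J" "card J \<le> circuit_size C" "finite K" "card K \<le> circuit_size C"
      "\<And>j. j \<in> J \<Longrightarrow> Poly_Mapping.keys (Q j) \<subseteq> K"
      "output_poly C = (\<Sum>j\<in>J. of_nat (m j) * Q j ^ e j)"
  proof (rule sum_pow_sum_prod_decomposition[OF circ(1,2)])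
    fix J :: "nat set" and K :: "(imm_var \<Rightarrow>\<^sub>0 nat) set" and Q :: "nat \<Rightarrow> (imm_var, 'a) mpoly"
      and e m :: "nat \<Rightarrow> nat"
    assume *: "finite J" "card J \<le> circuit_size C" "finite K" "card K \<le> circuit_size C"
      "\<And>j. j \<in> J \<Longrightarrow> Poly_Mapping.keys (Q j) \<subseteq> K"
      "output_poly C = (\<Sum>j\<in>J. of_nat (m j) * Q j ^ e j)"
    show thesis
      by (rule that[OF *])
  qed
  have "card K < q ^ (T + 1)"
    using dec(4) small by (rule le_less_trans)
  with dec(3) have "\<exists>\<sigma>. (\<forall>x. \<sigma> x < q) \<and> R.kills T \<sigma> K"
    by (rule R.exists_kills)
  then obtain \<sigma> where \<sigma>: "\<And>x. \<sigma> x < q" "R.kills T \<sigma> K"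
    by blast
  define G where "G a X = mp_eval (\<lambda>v. poly (R.wt \<sigma> (\<lambda>_. 0) X v) 0) (Q (fst a)) ^ (e (fst a) - snd a)"
    for a :: "nat \<times> nat" and X
  have "card Q.covered \<le> card (J \<times> {..k * r}) * card {A. A \<subseteq> Q.Om \<and> card A \<le> T * (k * r) + k * (h - c)}
     + k * w * card {B. B \<subseteq> {1..2 * h} \<and> card B + 2 * c \<le> h} * (2 * h choose h) ^ (k - 1)"
  proof (rule Q.covered_card_bound[where G = G])
    fix \<beta> :: "nat \<Rightarrow> nat"
    assume \<beta>: "\<And>b. b < k \<Longrightarrow> \<beta> b < w"
    obtain H where H: "\<forall>X\<subseteq>R.Om. mp_eval (R.ev \<sigma> \<beta> X) (output_poly C) = (\<Sum>a\<in>J \<times> {..k * r}.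
      mp_eval (\<lambda>v. poly (R.wt \<sigma> (\<lambda>_. 0) X v) 0) (Q (fst a)) ^ (e (fst a) - snd a) *
      (\<Sum>A\<in>{A. A \<subseteq> R.Om \<and> card A \<le> T * (k * r)}. H a A * of_bool (A \<subseteq> X)))"
      using R.restricted_representation[OF \<sigma>(2) dec(6,1,5) circ(3)] by blast
    have "Q.val \<beta> X = mp_eval (R.ev \<sigma> \<beta> X) (output_poly C)" for X
    proof -
      have "mp_eval (R.ev \<sigma> \<beta> X) (output_poly C) = mp_eval (R.ev \<sigma> \<beta> X) (IMM n d)"
      proof -
        have "(R.ev \<sigma> \<beta> X :: imm_var \<Rightarrow> 'a) \<in> V \<rightarrow> {0, 1}"
          using \<sigma>(1) \<beta> by (rule R.ev_Pi)
        then show ?thesis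
          using equiv by (simp add: equivalent_on_cube_def)
      qed
      also have "\<dots> = Q.val \<beta> X"
        unfolding Q.val_def using \<sigma>(1) \<beta> by (rule R.mp_eval_ev_IMM)
      finally show ?thesis ..
    qed
    then show "\<exists>H. \<forall>X\<subseteq>Q.Om. Q.val \<beta> X =
        (\<Sum>a\<in>J \<times> {..k * r}. G a X * (\<Sum>A\<in>{A. A \<subseteq> Q.Om \<and> card A \<le> T * (k * r)}. H a A * of_bool (A \<subseteq> X)))"
      using H unfolding Om G_def by (intro exI[of _ H]) simp
  qed (use dec in simp)
  moreover have "card (J \<times> {..k * r}) \<le> circuit_size C * (k * r + 1)"
    unfolding card_cartesian_product using dec(2) by (intro mult_le_mono) simp_all
  ultimately show ?thesis
    unfolding Q.card_covered Q.Om_def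
    by (meson add_right_mono mult_le_mono1 order.trans)
qed

lemma circuit_size_lower_bound:
  fixes C :: "(imm_var, 'a::field) circuit"
  assumes nz: "\<And>i. c \<le> i \<Longrightarrow> i < 2 * c \<Longrightarrow> of_nat (i choose c) \<noteq> (0::'a)"
    and k: "k \<ge> 1" and depth: "k * (c + 2) \<le> d" and width: "1 + w * (2 * h + 1) * q \<le> n"
    and h: "c < h" "2 * real h \<le> real n powr 0.02"
    and kn: "real k \<le> real n powr 0.01" and L: "real (k * r + 1) \<le> real n powr 0.01"
    and lo: "0.1 * ln n \<le> (real c)\<^sup>2 / (2 * real h)"
    and hi: "2 * (real c)\<^sup>2 / (real h - real c) \<le> 0.5 * ln n"
    and w: "real n powr 0.54 \<le> real w" "real w \<le> real n powr 0.55"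
    and big: "real n powr 0.01 \<ge> 4" "real n powr 0.02 \<ge> ln 4 + 0.01 * ln n"
    and T: "2 * (T * r) \<le> c"
    and circ: "circuit_over V C" "sum_pow_sum_prod C" "individual_degree_le r (output_poly C)"
    and equiv: "equivalent_on_cube V (output_poly C) (IMM n d)"
    and small: "circuit_size C < q ^ (T + 1)"
  shows "real (circuit_size C) \<ge> real n powr (0.01 * real k)"
proof -
  let ?U = "{1..2 * h}"
  let ?s = "circuit_size C"
  have n: "n \<ge> 1"
    using width by simp
  have h0: "h > 0"
    using h by simp
  obtain W where W: "\<And>i. i < w \<Longrightarrow> W i \<subseteq> ?U"
    "real (2 * h choose h) * (1 - (1 - real (2 * h choose (h + c)) / 4 ^ h) ^ w) \<le>
    real (card {S. S \<subseteq> ?U \<and> card S = h \<and> (\<exists>i<w. card (W i - S) + c \<le> card (S \<inter> W i))})"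
    (is "?x \<le> real (card ?cov)")
    using exists_biased_family[of ?U h w c] by auto
  let ?low = "{A. A \<subseteq> {..<k} \<times> ?U \<and> card A \<le> T * (k * r) + k * (h - c)}"
  let ?rare = "{B. B \<subseteq> ?U \<and> card B + 2 * c \<le> h}"
  have count: "card ?cov ^ k \<le> ?s * (k * r + 1) * card ?low + k * w * card ?rare * (2 * h choose h) ^ (k - 1)"
    by (rule circuit_counting_bound[OF nz k depth width less_imp_le[OF h(1)] W(1) circ equiv small])
  \<comment> \<open>Since \<open>2 * (T * r) \<le> c\<close>, these sets are at least k c / 2 below
    the mean size k h; with 2 h k variables the tail exponent is k c^2 / (4 h).\<close>
  have low: "real (card ?low) \<le> 4 ^ (h * k) * exp (- (real k * (real c)\<^sup>2 / (4 * real h)))"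
  proof -
    let ?V = "{..<k} \<times> ?U"
    have cV: "card ?V = 2 * h * k"
      by (simp add: card_cartesian_product)
    have "?low \<subseteq> {A. A \<subseteq> ?V \<and> real (card A) \<le> real (card ?V) / 2 - real k * real c / 2}"
    proof (intro Collect_mono impI conjI)
      fix A assume A: "A \<subseteq> ?V \<and> card A \<le> T * (k * r) + k * (h - c)"
      have "real (2 * (T * r)) \<le> real c"
        using T by (rule of_nat_mono)
      then have "real k * real (2 * (T * r)) \<le> real k * real c"
        by (rule mult_left_mono) simp
      moreover have "real (card A) \<le> real T * (real k * real r) + real k * (real h - real c)"
      proof -
        have "real (card A) \<le> real (T * (k * r) + k * (h - c))"
          using A by (intro of_nat_mono) blast
        also have "\<dots> = real T * (real k * real r) + real k * (real h - real c)"
          using h(1) by (simp only: of_nat_add of_nat_mult of_nat_diff less_imp_le)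
        finally show ?thesis .
      qed
      ultimately show "real (card A) \<le> real (card ?V) / 2 - real k * real c / 2"
        unfolding cV by (simp add: algebra_simps)
    qed auto
    then have "card ?low \<le> card {A. A \<subseteq> ?V \<and> real (card A) \<le> real (card ?V) / 2 - real k * real c / 2}"
      by (rule card_mono[OF finite_subset[of _ "Set.Pow ?V"], rotated 2]) auto
    then have "real (card ?low) \<le> real (card {A. A \<subseteq> ?V \<and> real (card A) \<le> real (card ?V) / 2 - real k * real c / 2})"
      by (rule of_nat_mono)
    also have "\<dots> \<le> 2 ^ card ?V * exp (- 2 * (real k * real c / 2)\<^sup>2 / card ?V)"
      using h0 k by (intro card_small_subsets_le) auto
    also have "2 ^ card ?V = (4 ^ (h * k) :: real)"
      unfolding cV by (simp only: mult.assoc power_mult) simp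
    also have "- 2 * (real k * real c / 2)\<^sup>2 / card ?V = - (real k * (real c)\<^sup>2 / (4 * real h))"
      unfolding cV using h0 k by (simp add: field_simps power2_eq_square)
    finally show ?thesis .
  qed
  \<comment> \<open>Here the deviation is 2 c among 2 h variables.\<close>
  have rare: "real (card ?rare) \<le> 4 ^ h * exp (- (4 * (real c)\<^sup>2 / real h))"
  proof -
    have "?rare \<subseteq> {B. B \<subseteq> ?U \<and> real (card B) \<le> real (card ?U) / 2 - 2 * real c}"
      by (auto simp flip: of_nat_add of_nat_mult simp: le_diff_eq)
    then have "card ?rare \<le> card {B. B \<subseteq> ?U \<and> real (card B) \<le> real (card ?U) / 2 - 2 * real c}"
      by (rule card_mono[OF finite_subset[of _ "Set.Pow ?U"], rotated 2]) auto
    then have "real (card ?rare) \<le> real (card {B. B \<subseteq> ?U \<and> real (card B) \<le> real (card ?U) / 2 - 2 * real c})"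
      by (rule of_nat_mono)
    also have "\<dots> \<le> 2 ^ card ?U * exp (- 2 * (2 * real c)\<^sup>2 / card ?U)"
      using h0 by (intro card_small_subsets_le) auto
    also have "2 ^ card ?U = (4 ^ h :: real)"
      by (simp add: power_mult)
    also have "- 2 * (2 * real c)\<^sup>2 / card ?U = - (4 * (real c)\<^sup>2 / real h)"
      using h0 by (simp add: field_simps power2_eq_square)
    finally show ?thesis .
  qed
  have "(1 - real (2 * h choose (h + c)) / 4 ^ h) ^ w \<le> 1"
    using central_choose_ratio_le_one[of h "h + c"] by (intro power_le_one) auto
  then have x0: "?x \<ge> 0"
    by simp
  have "?x ^ k \<le> real (card ?cov) ^ k"
    using W(2) x0 by (rule power_mono)
  also have "\<dots> \<le> real ?s * real (k * r + 1) * real (card ?low) +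
      real k * real w * real (card ?rare) * real (2 * h choose h) ^ (k - 1)"
    using of_nat_mono[OF count, where ?'a = real] by (simp only: of_nat_add of_nat_mult of_nat_power)
  also have "\<dots> \<le> real ?s * real (k * r + 1) * (4 ^ (h * k) * exp (- (real k * (real c)\<^sup>2 / (4 * real h)))) +
      real k * real w * (4 ^ h * exp (- (4 * (real c)\<^sup>2 / real h))) * real (2 * h choose h) ^ (k - 1)"
    using low rare by (intro add_mono mult_left_mono mult_right_mono) auto
  finally show ?thesis
    by (rule numeric_size_bound[OF n k h kn L lo hi w big])
qed

lemma individual_degree_0_constant:
  assumes "individual_degree_le 0 f"
  shows "mp_eval a f = mp_eval b f"
proof -
  have "m = 0" if "m \<in> Poly_Mapping.keys f" for m
    using assms that by (intro poly_mapping_eqI) (auto simp: individual_degree_le_def)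
  then show ?thesis
    unfolding mp_eval_def by (intro sum.cong refl) fastforce
qed

text \<open>Zero matrices give 0, while matrices with ones in the first column and zeros elsewhere
  give 1. This excludes \<open>r = 0\<close>, where the output would be constant.\<close>

lemma IMM_not_constant:
  assumes "n \<ge> 1" "d \<ge> 1"
  shows "\<exists>a b. a \<in> V \<rightarrow> {0, 1} \<and> b \<in> V \<rightarrow> {0, 1} \<and> mp_eval a (IMM n d) \<noteq> (mp_eval b (IMM n d) :: 'a::comm_ring_1)"
proof -
  let ?b = "\<lambda>(t, v', v). of_bool (v = 1) :: 'a"
  have b: "path_weight n ?b t v = of_bool (v = 1)" for t v
  proof (induction t arbitrary: v)
    case (Suc t)
    have "path_weight n ?b (Suc t) v = (\<Sum>v'\<in>{1..n}. if v' = 1 then of_bool (v = 1) else 0)"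
      by (simp only: path_weight.simps Suc) (auto intro!: sum.cong)
    then show ?case
      using assms(1) by simp
  qed simp
  have "path_weight n (\<lambda>_. 0 :: 'a) d 1 = 0"
    using assms(2) by (cases d) auto
  then have "mp_eval (\<lambda>_. 0) (IMM n d) \<noteq> mp_eval ?b (IMM n d)"
    using b[of d 1] by (simp add: mp_eval_IMM[OF assms])
  moreover have "(\<lambda>_. 0) \<in> V \<rightarrow> {0, 1 :: 'a}" "?b \<in> V \<rightarrow> {0, 1}"
    by auto
  ultimately show ?thesis
    by blast
qed

theorem theorem1:
  shows "\<exists>c::real. c > 0 \<and>
    (\<forall>d :: nat \<Rightarrow> nat.
       (\<lambda>n. real (d n)) \<in> \<omega>(\<lambda>n. (ln (real n))\<^sup>2) \<longrightarrow>
       (\<forall>\<^sub>F n in sequentially. real (d n) \<le> real n powr 0.01) \<longrightarrow>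
       (\<forall>\<^sub>F n in sequentially. \<forall>k r :: nat.
          k \<ge> 1 \<longrightarrow> real r \<le> real (d n) / (1201 * (real k)\<^sup>2) \<longrightarrow>
          (\<forall>C :: (imm_var, 'a::field) circuit.
             circuit_over (imm_vars n (d n)) C \<longrightarrow>
             sum_pow_sum_prod C \<longrightarrow>
             individual_degree_le r (output_poly C) \<longrightarrow>
             equivalent_on_cube (imm_vars n (d n)) (output_poly C) (IMM n (d n)) \<longrightarrow>
             real (circuit_size C) \<ge> real n powr (c * real k))))"
proof -
  obtain P where P: "P \<ge> 2" and good: "\<And>M. M \<ge> 1 \<Longrightarrow> \<exists>c::nat. 1 \<le> c \<and> c \<le> M \<and> M \<le> P * c \<and>
     (\<forall>i. c \<le> i \<longrightarrow> i < 2 * c \<longrightarrow> of_nat (i choose c) \<noteq> (0 :: 'a))"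
    using exists_nonvanishing_choose[where ?'a = 'a] by blast
  \<comment> \<open>The exponent 0.01 comes from the counting; 0.25 / P puts circuits of size below
    n^(c0 k) under the threshold q^(T + 1).\<close>
  define c0 :: real where "c0 = min 0.01 (0.25 / real P)"
  have c0: "c0 > 0" "c0 \<le> 0.01" "c0 * real P \<le> 0.25"
    using P by (auto simp: c0_def min_def field_simps)
  show ?thesis
  proof (intro exI[of _ c0] conjI allI impI)
    fix d :: "nat \<Rightarrow> nat"
    assume om: "(\<lambda>n. real (d n)) \<in> \<omega>(\<lambda>n. (ln (real n))\<^sup>2)"
      and up: "\<forall>\<^sub>F n in sequentially. real (d n) \<le> real n powr 0.01"
    have "\<forall>\<^sub>F n in sequentially. norm (real (d n)) \<ge> (real P)\<^sup>2 * norm ((ln (real n))\<^sup>2)"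
      using P by (intro landau_omega.smallD[OF om]) simp
    moreover have "\<forall>\<^sub>F n::nat in sequentially. ln (real n) \<ge> 10" by real_asymp
    moreover have "\<forall>\<^sub>F n::nat in sequentially. real n powr 0.01 \<ge> 4" by real_asymp
    moreover have "\<forall>\<^sub>F n::nat in sequentially. real n powr 0.02 \<ge> ln 4 + 0.01 * ln (real n)" by real_asymp
    moreover have "\<forall>\<^sub>F n::nat in sequentially. real n powr 0.54 \<le> real n powr 0.55 - 1" by real_asymp
    moreover have "\<forall>\<^sub>F n::nat in sequentially. real n powr 0.25 \<le> real n powr 0.3 - 1" by real_asymp
    \<comment> \<open>The exponents 0.55, 0.02 and 0.3 for \<open>w\<close>, \<open>2 * h\<close>
      and \<open>q\<close> add up to 0.87, so all vertices fit into width \<open>n\<close>.\<close>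
    moreover have "\<forall>\<^sub>F n::nat in sequentially.
        1 + real n powr 0.55 * (real n powr 0.02 + 1) * real n powr 0.3 \<le> real n" by real_asymp
    ultimately show "\<forall>\<^sub>F n in sequentially. \<forall>k r :: nat.
          k \<ge> 1 \<longrightarrow> real r \<le> real (d n) / (1201 * (real k)\<^sup>2) \<longrightarrow>
          (\<forall>C :: (imm_var, 'a::field) circuit.
             circuit_over (imm_vars n (d n)) C \<longrightarrow>
             sum_pow_sum_prod C \<longrightarrow>
             individual_degree_le r (output_poly C) \<longrightarrow>
             equivalent_on_cube (imm_vars n (d n)) (output_poly C) (IMM n (d n)) \<longrightarrow>
             real (circuit_size C) \<ge> real n powr (c0 * real k))"
      using up
    proof eventually_elim
      case (elim n)
      note ev = elim
      have n: "n \<ge> 1"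
        using ev(2) by (cases n) auto
      have dbig: "real (d n) \<ge> (real P)\<^sup>2 * (ln n)\<^sup>2"
        using ev(1) by simp
      show ?case
      proof (intro allI impI)
        fix k r :: nat and C :: "(imm_var, 'a) circuit"
        assume k: "k \<ge> 1" and r: "real r \<le> real (d n) / (1201 * (real k)\<^sup>2)"
          and circ: "circuit_over (imm_vars n (d n)) C" "sum_pow_sum_prod C" "individual_degree_le r (output_poly C)"
          and equiv: "equivalent_on_cube (imm_vars n (d n)) (output_poly C) (IMM n (d n))"
        show "real (circuit_size C) \<ge> real n powr (c0 * real k)"
        proof (cases "r = 0")
          case True
          have "0 < (real P)\<^sup>2 * (ln n)\<^sup>2"
            using P ev(2) by simp
          then have "d n \<ge> 1"
            using dbig by (cases "d n") auto
          from IMM_not_constant[OF n this, of "imm_vars n (d n)", where ?'a = 'a] obtain a b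
            where "a \<in> imm_vars n (d n) \<rightarrow> {0, 1}" "b \<in> imm_vars n (d n) \<rightarrow> {0, 1}"
              "mp_eval a (IMM n (d n)) \<noteq> (mp_eval b (IMM n (d n)) :: 'a)"
            by blast
          moreover have "mp_eval a (output_poly C) = mp_eval b (output_poly C)"
            using circ(3) True by (intro individual_degree_0_constant) simp
          ultimately have False
            using equiv by (simp add: equivalent_on_cube_def)
          then show ?thesis ..
        next
          case False
          then have r1: "r \<ge> 1"
            by simp
          define M where "M = d n div k - 2"
          have "M \<ge> 1"
          proof -
            have "1 * (1201 * (real k)\<^sup>2) \<le> real r * (1201 * (real k)\<^sup>2)"
              using r1 by (intro mult_right_mono) auto
            also have "\<dots> \<le> real (d n)"
              using r k by (simp add: field_simps)
            finally have "real (1201 * k\<^sup>2) \<le> real (d n)"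
              by simp
            then have "1201 * k\<^sup>2 \<le> d n"
              by (simp only: of_nat_le_iff)
            moreover have "3 * k \<le> 1201 * k\<^sup>2"
              using self_le_power[of k 2] k by simp
            ultimately have "3 * k \<le> d n"
              by (rule order.trans[rotated])
            then have "3 \<le> d n div k"
              using k by (simp add: less_eq_div_iff_mult_less_eq)
            then show ?thesis
              by (simp add: M_def)
          qed
          from good[OF this] obtain c where c: "1 \<le> c" "c \<le> M" "M \<le> P * c"
            "\<And>i. c \<le> i \<Longrightarrow> i < 2 * c \<Longrightarrow> of_nat (i choose c) \<noteq> (0 :: 'a)"
            by blast
          define h where "h = nat \<lfloor>5 * (real c)\<^sup>2 / ln n\<rfloor>"
          define T where "T = k div P"
          define w where "w = nat \<lfloor>real n powr 0.55\<rfloor>"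
          define q where "q = nat \<lfloor>real n powr 0.3\<rfloor>"
          note par = exists_parameters[OF n k r1 r P ev(8) dbig ev(2) c(2,3)[unfolded M_def],
            folded h_def T_def]
          have w: "real n powr 0.54 \<le> real w" "real w \<le> real n powr 0.55"
            using ev(5) real_nat_floor_bounds[OF powr_ge_zero, of "real n" "0.55"] unfolding w_def by linarith+
          have q: "real n powr 0.25 \<le> real q" "real q \<le> real n powr 0.3"
            using ev(6) real_nat_floor_bounds[OF powr_ge_zero, of "real n" "0.3"] unfolding q_def by linarith+
          have width: "1 + w * (2 * h + 1) * q \<le> n"
          proof -
            have "real (1 + w * (2 * h + 1) * q) = 1 + real w * (2 * real h + 1) * real q"
              by (simp add: algebra_simps)
            also have "\<dots> \<le> 1 + real n powr 0.55 * (real n powr 0.02 + 1) * real n powr 0.3"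
              using w(2) q(2) par(3) by (intro add_left_mono mult_mono) auto
            also have "\<dots> \<le> real n"
              by (rule ev(7))
            finally show ?thesis
              by (simp only: of_nat_le_iff)
          qed
          show ?thesis
          \<comment> \<open>The negated claim itself provides the smallness: as
            \<open>k < P * (T + 1)\<close>, the size is below n^(0.25 (T + 1)), hence below q^(T +
            1), and copies can be chosen.\<close>
          proof (rule ccontr)
            assume "\<not> ?thesis"
            then have lt: "real (circuit_size C) < real n powr (c0 * real k)"
              by simp
            have "real k < real P * (real T + 1)"
            proof -
              have "k < (T + 1) * P"
                using P dividend_less_div_times[of P k] by (simp add: T_def algebra_simps)
              then have "real k < real ((T + 1) * P)"
                by (rule of_nat_less_iff[THEN iffD2])
              then show ?thesis
                by (simp add: algebra_simps)
            qed
            then have "c0 * real k \<le> c0 * (real P * (real T + 1))"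
              using c0 by (intro mult_left_mono) auto
            also have "\<dots> = (c0 * real P) * (real T + 1)"
              by simp
            also have "\<dots> \<le> 0.25 * (real T + 1)"
              using c0(3) by (intro mult_right_mono) auto
            finally have "real n powr (c0 * real k) \<le> real n powr (0.25 * (real T + 1))"
              using n by (intro powr_mono) auto
            also have "\<dots> = (real n powr 0.25) ^ (T + 1)"
            proof -
              have "(real n powr 0.25) ^ (T + 1) = (real n powr 0.25) powr real (T + 1)"
                using n by (intro powr_realpow[symmetric]) simp
              then show ?thesis
                by (simp add: powr_powr add.commute)
            qed
            also have "\<dots> \<le> real q ^ (T + 1)"
              using q(1) by (intro power_mono) auto
            finally have "real (circuit_size C) < real (q ^ (T + 1))"
              using lt by simp
            then have small: "circuit_size C < q ^ (T + 1)"
              by (simp only: of_nat_less_iff)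
            have "real (circuit_size C) \<ge> real n powr (0.01 * real k)"
              by (rule circuit_size_lower_bound[OF c(4) k par(1) width par(2-7) w ev(3,4) par(8) circ equiv small])
            moreover have "real n powr (c0 * real k) \<le> real n powr (0.01 * real k)"
              using c0(2) n by (intro powr_mono mult_right_mono) auto
            ultimately show False
              using lt by simp
          qed
        qed
      qed
    qed
  qed (fact c0(1))
qed

end
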